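(* Let $n\ge1$ and $\mathfrak{g}=\mathfrak{sl}(n+1)\ltimes\mathbb{C}^{n+1}$. For any $\mathcal{M}\in\mathfrak{M}$ there exists a finite dimensional cyclic $\mathfrak{g}$-module $V$ (generated by an $\mathfrak{sl}(n+1)$-highest weight vector) such that $\mathcal{J}(V)=\mathcal{M}$. Such a module $V$ can be constructed as a quotient of a suitable $\mathfrak{g}$-module $V(\lambda)_\Phi$, obtained as the restriction to $\mathfrak{g}$, through the embedding $\Phi$, of a finite dimensional irreducible $\mathfrak{sl}(n+2)$-module $V(\lambda)$.
   Context: Everything is over $\mathbb{C}$ and all modules are finite dimensional. $A_{i,j}$ denotes a matrix unit. In $\mathfrak{sl}(n+1)$ put $E_{p,q}=A_{p,q+1}$, $F_{p,q}=A_{q+1,p}$ for $1\le p\le q\le n$, $H_i=A_{i,i}-A_{i+1,i+1}$, $F_i=F_{i,i}$. $\mathfrak{sl}(n+1)\ltimes\mathbb{C}^{n+1}$ is the semidirect sum of $\mathfrak{sl}(n+1)$ with its standard representation $\mathfrak{p}=\mathbb{C}^{n+1}$ (an abelian ideal), with standard basis $P_1,\dots,P_{n+1}$, so $[X,P_j]=XP_j$ for $X\in\mathfrak{sl}(n+1)$. $\omega_1,\dots,\omega_n$ are the fundamental weights of $\mathfrak{sl}(n+1)$ ($\omega_i(H_j)=\delta_{ij}$), $\omega_0=\omega_{n+1}=0$. A highest weight vector of weight $\mu=\sum_i\mu_i\omega_i$ is a nonzero vector $v$ with $H_iv=\mu_iv$ and $E_{p,q}v=0$ for all $i,p,q$.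 A module $V$ is cyclic if $V=\mathcal{U}(\mathfrak{g})v$ for some $v\in V$. Embedding $\Phi:\mathfrak{sl}(n+1)\ltimes\mathbb{C}^{n+1}\to\mathfrak{sl}(n+2)$: $\Phi(H_i)=A_{i+1,i+1}-A_{i+2,i+2}$ $(1\le i\le n)$, $\Phi(E_{p,q})=A_{p+1,q+2}$, $\Phi(F_{p,q})=A_{q+2,p+1}$ $(1\le p\le q\le n)$, $\Phi(P_j)=A_{j+1,1}$ $(1\le j\le n+1)$. $V(\lambda)$ is the irreducible $\mathfrak{sl}(n+2)$-module with dominant integral highest weight $\lambda$, and $V(\lambda)_\Phi$ is $V(\lambda)$ viewed as $\mathfrak{g}$-module via $\Phi$. Maps $\varphi_i$. For an integral weight $\mu=\sum\mu_i\omega_i$ of $\mathfrak{sl}(n+1)$ and $1\le k\le s\le n$ put $\mu_{k,s}=-\sum_{i=k}^s(\mu_i+1)$; $P_i^{(\mu(s))}=\bigl(\prod_{k=1}^{i-1}\mu_{k,s-1}\bigr)P_i$ for $1\le i\le s\le n+1$; $F_{i,j}^{(\mu(s))}=\bigl(\prod_{k=i+1}^{j}\mu_{k,s}\bigr)F_{i,j}$ for $1\le i\le j\le s\le n$ (empty products are $1$); and define $Q^{(\mu(s))}_k\in\mathcal{U}(\mathfrak{sl}(n+1))$ by $Q^{(\mu(s))}_{s+1}=1$, $Q^{(\mu(s))}_{k}=\sum_{l=k}^{s}Q^{(\mu(s))}_{l+1}F^{(\mu(s))}_{k,l}$ for $1\le k\le s$. For a highest weight vector $v_\mu$ of weight $\mu$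 in a $\mathfrak{g}$-module, $\varphi_i(v_\mu)=P^{(\mu(i))}_iv_\mu+\sum_{k=1}^{i-1}Q^{(\mu(i-1))}_kP^{(\mu(i))}_kv_\mu$, $1\le i\le n+1$. Each $\varphi_i(v_\mu)$ is zero or a highest weight vector of weight $\mu+\omega_i-\omega_{i-1}$, so the $\varphi_i$ can be iterated (each time using the weight of the current vector), with $\varphi_i(0)=0$. The invariant $\mathcal{J}(V)$. Let $V$ be cyclic, generated by an $\mathfrak{sl}(n+1)$-highest weight vector $v_{\mu_0}$ of weight $\mu_0$. Let $J_1$ be the smallest positive integer with $\varphi_1^{J_1}(v_{\mu_0})=0$; recursively, for $2\le k\le n+1$ and integers $0\le i_1<J_1$, $0\le i_h<J_h(i_1,\dots,i_{h-1})$ $(2\le h\le k-1)$, let $J_k(i_1,\dots,i_{k-1})$ be the smallest positive integer $J$ with $\varphi_k^{J}(\varphi_{k-1}^{i_{k-1}}(\cdots\varphi_1^{i_1}(v_{\mu_0})\cdots))=0$. $\mathcal{J}(V)$ is $\mu_0$ together with the indexed family of integers $J_1$, $J_k(i_1,\dots,i_{k-1})$ $(2\le k\le n+1)$. The collection $\mathfrak{M}$. It consists of all pairs $(\mu_0,\mathcal{M}^{\mu_0})$ where $\mu_0=\sum_{l=1}^n\mu_l\omega_l$ is a dominant integral weight of $\mathfrak{sl}(n+1)$ and $\mathcal{M}^{\mu_0}$ is an indexed family of positive integers $M_1$ and $M_k(i_1,\dots,i_{k-1})$, $2\le k\le n+1$, defined for all integers with $0\le i_1<M_1$, $0\le i_h<M_h(i_1,\dots,i_{h-1})$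 $(2\le h\le k-1)$, such that $M_1\ge1$; $1\le M_k(i_1,\dots,i_{k-1})\le\mu_{k-1}+1$ for $2\le k\le n+1$; and $M_k(i_1,\dots,i_{k-1})\ge M_k(j_1,\dots,j_{k-1})$ whenever $i_l\le j_l$ for all $1\le l\le k-1$. *)

theory Defs
  imports "Jordan_Normal_Form.VS_Connect" "HOL-Algebra.AbelCoset" "HOL-Library.FuncSet"
begin

section \<open>Lie algebras and their modules\<close>

text \<open>Vector spaces are carrier-based (\<open>vectorspace class_ring V\<close>, scalars in the type
  \<^typ>\<open>complex\<close>); in the records below the unused fields \<open>mult\<close> and \<open>one\<close>
  of the module record are left unspecified.\<close>

record 'g lie_alg = "(complex, 'g) module" +
  lie_bracket :: "'g \<Rightarrow> 'g \<Rightarrow> 'g"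

locale lie_module = vectorspace "class_ring :: complex ring" V
  for L :: "'g lie_alg" and V :: "(complex, 'v) module" (structure)
    and act :: "'g \<Rightarrow> 'v \<Rightarrow> 'v" +
  assumes act_closed: "x \<in> carrier L \<Longrightarrow> v \<in> carrier V \<Longrightarrow> act x v \<in> carrier V"
    and act_add: "x \<in> carrier L \<Longrightarrow> v \<in> carrier V \<Longrightarrow> w \<in> carrier V \<Longrightarrow>
      act x (v \<oplus> w) = act x v \<oplus> act x w"
    and act_smult: "x \<in> carrier L \<Longrightarrow> v \<in> carrier V \<Longrightarrow> act x (c \<odot> v) = c \<odot> act x v"
    and add_act: "x \<in> carrier L \<Longrightarrow> y \<in> carrier L \<Longrightarrow> v \<in> carrier V \<Longrightarrow>
      act (x \<oplus>\<^bsub>L\<^esub> y) v = act x v \<oplus> act y v"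
    and smult_act: "x \<in> carrier L \<Longrightarrow> v \<in> carrier V \<Longrightarrow> act (c \<odot>\<^bsub>L\<^esub> x) v = c \<odot> act x v"
    and bracket_act: "x \<in> carrier L \<Longrightarrow> y \<in> carrier L \<Longrightarrow> v \<in> carrier V \<Longrightarrow>
      act (lie_bracket L x y) v = act x (act y v) \<ominus> act y (act x v)"

definition fin_dim_lie_module ::
    "'g lie_alg \<Rightarrow> (complex, 'v) module \<Rightarrow> ('g \<Rightarrow> 'v \<Rightarrow> 'v) \<Rightarrow> bool" where
  "fin_dim_lie_module L V act \<longleftrightarrow>
     lie_module L V act \<and> vectorspace.fin_dim (class_ring :: complex ring) V"

definition lie_submodule ::
    "'g lie_alg \<Rightarrow> (complex, 'v) module \<Rightarrow> ('g \<Rightarrow> 'v \<Rightarrow> 'v) \<Rightarrow> 'v set \<Rightarrow> bool" where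
  "lie_submodule L V act W \<longleftrightarrow>
     VectorSpace.subspace (class_ring :: complex ring) W V \<and>
     (\<forall>x\<in>carrier L. \<forall>w\<in>W. act x w \<in> W)"

definition irreducible_lie_module ::
    "'g lie_alg \<Rightarrow> (complex, 'v) module \<Rightarrow> ('g \<Rightarrow> 'v \<Rightarrow> 'v) \<Rightarrow> bool" where
  "irreducible_lie_module L V act \<longleftrightarrow>
     lie_module L V act \<and> carrier V \<noteq> {\<zero>\<^bsub>V\<^esub>} \<and>
     (\<forall>W. lie_submodule L V act W \<longrightarrow> W = {\<zero>\<^bsub>V\<^esub>} \<or> W = carrier V)"

text \<open>The quotient \<open>V / W\<close>, realised on the set of cosets \<open>W + v\<close>. The unions below are over
  representatives of a coset, and are single cosets when \<open>W\<close> is a submodule.\<close>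

definition quotient_space ::
    "(complex, 'v) module \<Rightarrow> 'v set \<Rightarrow> (complex, 'v set) module" where
  "quotient_space V W = \<lparr>
     carrier = a_rcosets\<^bsub>V\<^esub> W,
     mult = undefined,
     one = undefined,
     zero = W,
     add = (\<lambda>X Y. X <+>\<^bsub>V\<^esub> Y),
     smult = (\<lambda>c X. \<Union>v\<in>X. W +>\<^bsub>V\<^esub> (c \<odot>\<^bsub>V\<^esub> v))\<rparr>"

definition quotient_act ::
    "(complex, 'v) module \<Rightarrow> 'v set \<Rightarrow> ('g \<Rightarrow> 'v \<Rightarrow> 'v) \<Rightarrow> 'g \<Rightarrow> 'v set \<Rightarrow> 'v set" where
  "quotient_act V W act x X = (\<Union>v\<in>X. W +>\<^bsub>V\<^esub> act x v)"

section \<open>Enveloping algebra\<close>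

text \<open>A list \<open>[(c\<^sub>1, w\<^sub>1), \<dots>]\<close> represents the element \<open>c\<^sub>1 w\<^sub>1 + \<dots>\<close> of
  \<open>U(L)\<close>, a word \<open>w = [x\<^sub>1, \<dots>, x\<^sub>r]\<close> standing for the product \<open>x\<^sub>1 \<cdots> x\<^sub>r\<close> (the empty word
  for \<open>1\<close>). Every element of \<open>U(L)\<close> has such representatives, and all of them act in the
  same way on a module.\<close>

type_synonym 'g env = "(complex \<times> 'g list) list"

definition env :: "'g lie_alg \<Rightarrow> 'g env set" where
  "env L = {u. \<forall>(c, w) \<in> set u. set w \<subseteq> carrier L}"

definition env_mult :: "'g env \<Rightarrow> 'g env \<Rightarrow> 'g env" where
  "env_mult u u' = [(c * c', w @ w'). (c, w) \<leftarrow> u, (c', w') \<leftarrow> u']"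

definition env_act ::
    "(complex, 'v) module \<Rightarrow> ('g \<Rightarrow> 'v \<Rightarrow> 'v) \<Rightarrow> 'g env \<Rightarrow> 'v \<Rightarrow> 'v" where
  "env_act V act u v =
     foldr (\<lambda>(c, w) s. c \<odot>\<^bsub>V\<^esub> (foldr act w v) \<oplus>\<^bsub>V\<^esub> s) u \<zero>\<^bsub>V\<^esub>"

definition generates ::
    "'g lie_alg \<Rightarrow> (complex, 'v) module \<Rightarrow> ('g \<Rightarrow> 'v \<Rightarrow> 'v) \<Rightarrow> 'v \<Rightarrow> bool" where
  "generates L V act v \<longleftrightarrow>
     v \<in> carrier V \<and> carrier V = (\<lambda>u. env_act V act u v) ` env L"

section \<open>The Lie algebras\<close>

text \<open>The matrix unit \<open>A\<^sub>i\<^sub>,\<^sub>j\<close> of size \<open>m\<close>; the indices \<open>i\<close>, \<open>j\<close>, as all indices in the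
  definitions below, start from \<open>1\<close>, whereas the library indexes matrices from \<open>0\<close>.\<close>

definition mat_unit :: "nat \<Rightarrow> nat \<Rightarrow> nat \<Rightarrow> complex mat" where
  "mat_unit m i j = mat m m (\<lambda>(r, c). if Suc r = i \<and> Suc c = j then 1 else 0)"

definition sl :: "nat \<Rightarrow> complex mat lie_alg" where
  "sl m = \<lparr>
     carrier = {X \<in> carrier_mat m m. (\<Sum>i<m. X $$ (i, i)) = 0},
     mult = undefined,
     one = undefined,
     zero = 0\<^sub>m m m,
     add = (+),
     smult = (\<cdot>\<^sub>m),
     lie_bracket = (\<lambda>X Y. X * Y - Y * X)\<rparr>"

text \<open>The root vectors and coroots of \<open>sl(n+1)\<close>.\<close>

definition H_el :: "nat \<Rightarrow> nat \<Rightarrow> complex mat" where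
  "H_el n i = mat_unit (n + 1) i i - mat_unit (n + 1) (i + 1) (i + 1)"

definition E_el :: "nat \<Rightarrow> nat \<Rightarrow> nat \<Rightarrow> complex mat" where
  "E_el n p q = mat_unit (n + 1) p (q + 1)"

definition F_el :: "nat \<Rightarrow> nat \<Rightarrow> nat \<Rightarrow> complex mat" where
  "F_el n p q = mat_unit (n + 1) (q + 1) p"

text \<open>\<open>(X, p)\<close> is the element \<open>X + p\<close> of the semidirect sum of \<open>sl(n+1)\<close> and its
  standard representation.\<close>

definition sl_semidirect :: "nat \<Rightarrow> (complex mat \<times> complex vec) lie_alg" where
  "sl_semidirect n = \<lparr>
     carrier = carrier (sl (n + 1)) \<times> carrier_vec (n + 1),
     mult = undefined,
     one = undefined,
     zero = (0\<^sub>m (n + 1) (n + 1), 0\<^sub>v (n + 1)),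
     add = (\<lambda>(X, p) (Y, q). (X + Y, p + q)),
     smult = (\<lambda>c (X, p). (c \<cdot>\<^sub>m X, c \<cdot>\<^sub>v p)),
     lie_bracket = (\<lambda>(X, p) (Y, q). (X * Y - Y * X, X *\<^sub>v q - Y *\<^sub>v p))\<rparr>"

definition of_sl :: "nat \<Rightarrow> complex mat \<Rightarrow> complex mat \<times> complex vec" where
  "of_sl n X = (X, 0\<^sub>v (n + 1))"

definition P_el :: "nat \<Rightarrow> nat \<Rightarrow> complex mat \<times> complex vec" where
  "P_el n j = (0\<^sub>m (n + 1) (n + 1), unit_vec (n + 1) (j - 1))"

text \<open>The embedding into \<open>sl(n+2)\<close>: \<open>(X, p)\<close> goes to the block matrix with rows
  \<open>(0, 0)\<close> and \<open>(p, X)\<close>; the lemmas give the values on the generators.\<close>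

definition Phi :: "nat \<Rightarrow> complex mat \<times> complex vec \<Rightarrow> complex mat" where
  "Phi n = (\<lambda>(X, p). mat (n + 2) (n + 2)
     (\<lambda>(r, c). if r = 0 then 0 else if c = 0 then p $ (r - 1) else X $$ (r - 1, c - 1)))"

lemma Phi_H:
  assumes "1 \<le> i" "i \<le> n"
  shows "Phi n (of_sl n (H_el n i)) =
    mat_unit (n + 2) (i + 1) (i + 1) - mat_unit (n + 2) (i + 2) (i + 2)"
  using assms by (intro eq_matI) (auto simp: Phi_def of_sl_def H_el_def mat_unit_def)

lemma Phi_E:
  assumes "1 \<le> p" "p \<le> q" "q \<le> n"
  shows "Phi n (of_sl n (E_el n p q)) = mat_unit (n + 2) (p + 1) (q + 2)"
  using assms by (intro eq_matI) (auto simp: Phi_def of_sl_def E_el_def mat_unit_def)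

lemma Phi_F:
  assumes "1 \<le> p" "p \<le> q" "q \<le> n"
  shows "Phi n (of_sl n (F_el n p q)) = mat_unit (n + 2) (q + 2) (p + 1)"
  using assms by (intro eq_matI) (auto simp: Phi_def of_sl_def F_el_def mat_unit_def)

lemma Phi_P:
  assumes "1 \<le> j" "j \<le> n + 1"
  shows "Phi n (P_el n j) = mat_unit (n + 2) (j + 1) 1"
  using assms by (intro eq_matI) (auto simp: Phi_def P_el_def mat_unit_def)

section \<open>Weights and highest weight vectors\<close>

text \<open>An integral weight \<open>\<Sum>i. \<mu>\<^sub>i \<omega>\<^sub>i\<close> of \<open>sl(n+1)\<close> is the function \<open>i \<mapsto> \<mu>\<^sub>i\<close>, which is
  \<open>0\<close> outside \<open>{1..n}\<close>.\<close>

definition dominant_integral :: "nat \<Rightarrow> (nat \<Rightarrow> int) \<Rightarrow> bool" where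
  "dominant_integral n \<mu> \<longleftrightarrow> (\<forall>i\<in>{1..n}. \<mu> i \<ge> 0) \<and> (\<forall>i. i \<notin> {1..n} \<longrightarrow> \<mu> i = 0)"

definition highest_weight_vector ::
    "nat \<Rightarrow> (complex, 'v) module \<Rightarrow> (complex mat \<Rightarrow> 'v \<Rightarrow> 'v) \<Rightarrow> (nat \<Rightarrow> int) \<Rightarrow> 'v \<Rightarrow> bool" where
  "highest_weight_vector n V act \<mu> v \<longleftrightarrow>
     v \<in> carrier V \<and> v \<noteq> \<zero>\<^bsub>V\<^esub> \<and>
     (\<forall>i\<in>{1..n}. act (H_el n i) v = of_int (\<mu> i) \<odot>\<^bsub>V\<^esub> v) \<and>
     (\<forall>p q. 1 \<le> p \<and> p \<le> q \<and> q \<le> n \<longrightarrow> act (E_el n p q) v = \<zero>\<^bsub>V\<^esub>)"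

text \<open>\<open>U\<close> with action \<open>\<pi>\<close> is the \<open>sl(n+1)\<close>-module \<open>V(\<Lambda>)\<close>, which is determined up to
  isomorphism.\<close>

definition is_irreducible_of_highest_weight ::
    "nat \<Rightarrow> (nat \<Rightarrow> int) \<Rightarrow> (complex, 'v) module \<Rightarrow> (complex mat \<Rightarrow> 'v \<Rightarrow> 'v) \<Rightarrow> bool" where
  "is_irreducible_of_highest_weight n \<Lambda> U \<pi> \<longleftrightarrow>
     fin_dim_lie_module (sl (n + 1)) U \<pi> \<and> irreducible_lie_module (sl (n + 1)) U \<pi> \<and>
     (\<exists>v. highest_weight_vector n U \<pi> \<Lambda> v)"

text \<open>The weight of a nonzero weight vector of integral weight.\<close>

definition weight_of ::
    "nat \<Rightarrow> (complex, 'v) module \<Rightarrow> (complex mat \<Rightarrow> 'v \<Rightarrow> 'v) \<Rightarrow> 'v \<Rightarrow> nat \<Rightarrow> int" where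
  "weight_of n V act v = (\<lambda>i. if i \<in> {1..n}
     then (THE m. act (H_el n i) v = of_int m \<odot>\<^bsub>V\<^esub> v) else 0)"

section \<open>The maps between highest weight vectors\<close>

definition mu_sum :: "(nat \<Rightarrow> int) \<Rightarrow> nat \<Rightarrow> nat \<Rightarrow> int" where
  "mu_sum \<mu> k s = - (\<Sum>i=k..s. (\<mu> i + 1))"

definition P_mu :: "nat \<Rightarrow> (nat \<Rightarrow> int) \<Rightarrow> nat \<Rightarrow> nat \<Rightarrow> complex mat \<times> complex vec" where
  "P_mu n \<mu> s i =
     of_int (\<Prod>k\<in>{1..<i}. mu_sum \<mu> k (s - 1)) \<odot>\<^bsub>sl_semidirect n\<^esub> P_el n i"

definition F_mu :: "nat \<Rightarrow> (nat \<Rightarrow> int) \<Rightarrow> nat \<Rightarrow> nat \<Rightarrow> nat \<Rightarrow> complex mat" where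
  "F_mu n \<mu> s i j = of_int (\<Prod>k=i+1..j. mu_sum \<mu> k s) \<odot>\<^bsub>sl (n + 1)\<^esub> F_el n i j"

function Q_mu :: "nat \<Rightarrow> (nat \<Rightarrow> int) \<Rightarrow> nat \<Rightarrow> nat \<Rightarrow> complex mat env" where
  "Q_mu n \<mu> s k = (if k > s then [(1, [])]
     else concat (map (\<lambda>l. env_mult (Q_mu n \<mu> s (l + 1)) [(1, [F_mu n \<mu> s k l])]) [k..<s + 1]))"
  by pat_completeness auto
termination by (relation "measure (\<lambda>(n, \<mu>, s, k). s + 1 - k)") auto

declare Q_mu.simps [simp del]

text \<open>From here on \<open>\<rho>\<close> is an action of \<open>sl_semidirect n\<close> on \<open>V\<close>.\<close>

definition phi_of_weight ::
    "nat \<Rightarrow> (complex, 'v) module \<Rightarrow> (complex mat \<times> complex vec \<Rightarrow> 'v \<Rightarrow> 'v) \<Rightarrow>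
      (nat \<Rightarrow> int) \<Rightarrow> nat \<Rightarrow> 'v \<Rightarrow> 'v" where
  "phi_of_weight n V \<rho> \<mu> i v = \<rho> (P_mu n \<mu> i i) v \<oplus>\<^bsub>V\<^esub>
     (\<Oplus>\<^bsub>V\<^esub>k\<in>{1..<i}. env_act V (\<rho> \<circ> of_sl n) (Q_mu n \<mu> (i - 1) k) (\<rho> (P_mu n \<mu> i k) v))"

definition phi ::
    "nat \<Rightarrow> (complex, 'v) module \<Rightarrow> (complex mat \<times> complex vec \<Rightarrow> 'v \<Rightarrow> 'v) \<Rightarrow>
      nat \<Rightarrow> 'v \<Rightarrow> 'v" where
  "phi n V \<rho> i v = (if v = \<zero>\<^bsub>V\<^esub> then \<zero>\<^bsub>V\<^esub>
     else phi_of_weight n V \<rho> (weight_of n V (\<rho> \<circ> of_sl n) v) i v)"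

text \<open>\<open>phi_seq n V \<rho> [i\<^sub>1, \<dots>, i\<^sub>k] v\<close> is \<open>\<phi>\<^sub>k\<^bsup>i\<^sub>k\<^esup> (\<cdots> (\<phi>\<^sub>1\<^bsup>i\<^sub>1\<^esup> v))\<close>.\<close>

definition phi_seq ::
    "nat \<Rightarrow> (complex, 'v) module \<Rightarrow> (complex mat \<times> complex vec \<Rightarrow> 'v \<Rightarrow> 'v) \<Rightarrow>
      nat list \<Rightarrow> 'v \<Rightarrow> 'v" where
  "phi_seq n V \<rho> js v = fold (\<lambda>(k, i). phi n V \<rho> k ^^ i) (List.enumerate 1 js) v"

section \<open>The invariant and the collection of its possible values\<close>

text \<open>A family \<open>M\<^sub>1\<close>, \<open>M\<^sub>k(i\<^sub>1, \<dots>, i\<^sub>k\<^sub>-\<^sub>1)\<close> for \<open>2 \<le> k \<le> n+1\<close> is a function of the list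
  \<open>[i\<^sub>1, \<dots>, i\<^sub>k\<^sub>-\<^sub>1]\<close>, with \<open>k - 1 \<in> {0..n}\<close> its length and \<open>M\<^sub>1\<close> the value at \<open>[]\<close>.
  The admissible lists depend on the family itself; outside of them the family is
  \<^const>\<open>undefined\<close>, so that equality of families is equality of functions.\<close>

definition index_dom :: "nat \<Rightarrow> (nat list \<Rightarrow> nat) \<Rightarrow> nat list set" where
  "index_dom n M = {js. length js \<le> n \<and> (\<forall>h<length js. js ! h < M (take h js))}"

definition J_val ::
    "nat \<Rightarrow> (complex, 'v) module \<Rightarrow> (complex mat \<times> complex vec \<Rightarrow> 'v \<Rightarrow> 'v) \<Rightarrow>
      'v \<Rightarrow> nat list \<Rightarrow> nat" where
  "J_val n V \<rho> v js =
     (LEAST J. J > 0 \<and> (phi n V \<rho> (length js + 1) ^^ J) (phi_seq n V \<rho> js v) = \<zero>\<^bsub>V\<^esub>)"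

definition J_invariant ::
    "nat \<Rightarrow> (complex, 'v) module \<Rightarrow> (complex mat \<times> complex vec \<Rightarrow> 'v \<Rightarrow> 'v) \<Rightarrow>
      'v \<Rightarrow> (nat \<Rightarrow> int) \<times> (nat list \<Rightarrow> nat)" where
  "J_invariant n V \<rho> v =
     (weight_of n V (\<rho> \<circ> of_sl n) v,
      restrict (J_val n V \<rho> v) (index_dom n (J_val n V \<rho> v)))"

definition collection_M :: "nat \<Rightarrow> ((nat \<Rightarrow> int) \<times> (nat list \<Rightarrow> nat)) set" where
  "collection_M n = {(\<mu>, M). dominant_integral n \<mu> \<and>
     M \<in> extensional (index_dom n M) \<and>
     (\<forall>js\<in>index_dom n M. M js \<ge> 1) \<and>
     (\<forall>js\<in>index_dom n M. js \<noteq> [] \<longrightarrow> int (M js) \<le> \<mu> (length js) + 1) \<and>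
     (\<forall>hs\<in>index_dom n M. \<forall>js\<in>index_dom n M. list_all2 (\<le>) hs js \<longrightarrow> M hs \<ge> M js)}"

end

theory Submission
  imports Defs "HOL-Library.Function_Algebras" "HOL-Library.Product_Lexorder"
begin

text \<open>
  The plan is the classical one: restrict an irreducible \<open>sl(n+2)\<close>-module \<open>V(\<Lambda>)\<close> to
  \<open>sl(n+1) \<ltimes> \<complex>\<^bsup>n+1\<^esup>\<close> and divide out what is generated by the unwanted highest weight vectors.
  Rows of \<open>(n+2) \<times> (n+2)\<close> matrices are numbered from \<open>0\<close>, and \<open>T a b\<close> is the operator by
  which the matrix unit in row \<open>a\<close> and column \<open>b\<close> acts. Under the embedding, \<open>P\<^sub>j\<close> becomes
  \<open>T j 0\<close> and \<open>sl(n+1)\<close> occupies the rows and columns \<open>1, \<dots>, n+1\<close>.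

  Let \<open>\<Lambda>\<^sub>1 = M\<^sub>1 - 1\<close> and \<open>\<Lambda>\<^bsub>i+1\<^esub> = \<mu>\<^sub>i\<close>, let \<open>v\<close> be the highest weight vector of
  \<open>V(\<Lambda>)\<close>, and for \<open>j = (j\<^sub>1, \<dots>, j\<^bsub>n+1\<^esub>)\<close> let \<open>v\<^sub>j = \<phi>\<^bsub>n+1\<^esub>\<^bsup>j\<^esup> \<cdots> \<phi>\<^sub>1\<^bsup>j\<^esup> v\<close>,
  where \<open>\<phi>\<^sub>k\<close> is applied \<open>j\<^sub>k\<close> times. The admissible \<open>j\<close>, those with \<open>j\<^sub>k < M\<^sub>k(j\<^sub>1, \<dots>, j\<^bsub>k-1\<^esub>)\<close> for all \<open>k\<close>,
  form a set \<open>D\<close> inside the box \<open>j\<^sub>k \<le> \<Lambda>\<^sub>k\<close>, and monotonicity of the family says exactly that \<open>D\<close>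
  is closed downwards. Let \<open>W\<close> be the submodule generated by the \<open>v\<^sub>j\<close> with \<open>j \<notin> D\<close>. The
  invariant of \<open>V(\<Lambda>) / W\<close> is the given family as soon as \<open>v\<^sub>j \<in> W\<close> holds precisely for
  \<open>j \<notin> D\<close>.

  To decide this, each \<open>v\<^sub>j\<close> is tested against an explicit vector \<open>f\<^sub>j\<close> of the same weight in a larger unitary space, in which \<open>T a b\<close>
  and \<open>T b a\<close> are adjoint. Three facts about \<open>f\<^sub>j\<close> suffice: it is singular for \<open>sl(n+1)\<close>, it
  has the weight of \<open>v\<^sub>j\<close>, and \<open>T 0 k\<close> maps \<open>f\<close> at \<open>j + e\<^sub>k\<close> to a nonzero multiple of \<open>f\<^sub>j\<close>
  when \<open>j\<^sub>k < \<Lambda>\<^sub>k\<close> and \<open>j\<^sub>l = 0\<close> for \<open>l > k\<close>.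

  \<^item> \<open>\<langle>v\<^sub>j, f\<^sub>j\<rangle> \<noteq> 0\<close> for \<open>j\<close> in the box (\<open>chain_pairing\<close>): in every summand of \<open>\<phi>\<^sub>k\<close> except
    the one of \<open>P\<^sub>k\<close> the operator applied last lowers in \<open>sl(n+1)\<close>, and its adjoint kills \<open>f\<close>; hence
    pairing \<open>\<phi>\<^sub>k v\<^sub>j\<close> with \<open>f\<close> at \<open>j + e\<^sub>k\<close> gives a nonzero multiple of \<open>\<langle>v\<^sub>j, f\<^sub>j\<rangle>\<close>.
  \<^item> \<open>W\<close> is orthogonal to \<open>f\<^sub>i\<close> for \<open>i \<in> D\<close> (\<open>cut_perp\<close>): as \<open>v\<^sub>j\<close> is singular
    (\<open>levi_singular_phi\<close>), triangular decomposition reduces the claim to vectors obtained from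
    \<open>v\<^sub>j\<close> by operators \<open>P\<^sub>k\<close>. Those have weights at least \<open>j\<close>, so not the weight of \<open>f\<^sub>i\<close>.

  The unitary space is a fermionic Fock space: its basis states are the sets of boxes of a grid with
  \<open>n+2\<close> rows, in which \<open>\<Lambda>\<^sub>k\<close> columns are assigned the length \<open>k\<close> for each \<open>k\<close>, and \<open>T a b\<close> moves a particle from row \<open>b\<close>
  to row \<open>a\<close> inside its column. The highest weight vector is the state in which every column is
  filled from the top down to its length, and \<open>f\<^sub>j\<close> is the sum of the states in which \<open>j\<^sub>k\<close> of
  the columns of length \<open>k\<close> are shifted by one row. The inner product
  also shows that the module generated by \<open>v\<close> is irreducible (\<open>gen_span_irreducible\<close>).
\<close>

section \<open>Lowering operators in a module of matrix units\<close>

locale gl_module = vector_space scale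
  for scale :: "complex \<Rightarrow> 'a::ab_group_add \<Rightarrow> 'a" (infixr "*s" 75) +
  fixes m :: nat and T :: "nat \<Rightarrow> nat \<Rightarrow> 'a \<Rightarrow> 'a"
  assumes T_add: "T a b (x + y) = T a b x + T a b y"
    and T_scale: "T a b (c *s x) = c *s T a b x"
    and T_bracket: "\<lbrakk>a < m; b < m; p < m; q < m\<rbrakk> \<Longrightarrow> T a b (T p q x) =
      T p q (T a b x) + (if b = p then T a q x else 0) - (if a = q then T p b x else 0)"
begin

lemma T_zero [simp]: "T a b 0 = 0"
  using T_scale[of a b 0 0] by simp

lemma T_minus: "T a b (- x) = - T a b x"
  using T_scale[of a b "-1" x] by simp

lemma T_diff: "T a b (x - y) = T a b x - T a b y"
  using T_add[of a b x "- y"] by (simp add: T_minus)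

lemma T_sum: "T a b (sum f A) = (\<Sum>i\<in>A. T a b (f i))"
  by (induction A rule: infinite_finite_induct) (auto simp: T_add)

text \<open>With \<open>F\<^bsub>0,l\<^esub> = P\<^bsub>l+1\<^esub>\<close> this is the scalar in \<open>F\<^bsub>k,l\<^esub>\<^bsup>(\<mu>(s))\<^esup>\<close> for \<open>k \<ge> 1\<close> and the
  one in \<open>P\<^bsub>l+1\<^esub>\<^bsup>(\<mu>(s+1))\<^esup>\<close> for \<open>k = 0\<close>. The product is over the points that a step from \<open>k\<close> to
  \<open>l + 1\<close> skips.\<close>

definition skip_factor :: "(nat \<Rightarrow> int) \<Rightarrow> nat \<Rightarrow> nat \<Rightarrow> nat \<Rightarrow> complex" where
  "skip_factor \<mu> s k l = of_int (\<Prod>r=k+1..l. mu_sum \<mu> r s)"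

text \<open>Expanding the recursion gives a sum over all chains \<open>k = a\<^sub>0 < a\<^sub>1 < \<cdots> < a\<^sub>r = s + 1\<close> of products of
  the \<open>T a\<^bsub>i+1\<^esub> a\<^sub>i\<close>, weighted by the points that the chain skips. For \<open>k \<ge> 1\<close> it is the operator \<open>Q\<^sub>k\<close>;
  starting the chains at \<open>0\<close> turns the first factor into some \<open>P\<^sub>l\<close>, so that \<open>k = 0\<close> is
  \<open>\<phi>\<^bsub>s+1\<^esub>\<close>. Treating both as one recursion makes one commutation argument serve for all.\<close>

function lower_op :: "(nat \<Rightarrow> int) \<Rightarrow> nat \<Rightarrow> nat \<Rightarrow> 'a \<Rightarrow> 'a" where
  "lower_op \<mu> s k x = (if k > s then x
     else (\<Sum>l=k..s. lower_op \<mu> s (l + 1) (skip_factor \<mu> s k l *s T (l + 1) k x)))"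
  by pat_completeness auto
termination by (relation "measure (\<lambda>(\<mu>, s, k, x). s + 1 - k)") auto

declare lower_op.simps [simp del]

lemma lower_op_above: "s < k \<Longrightarrow> lower_op \<mu> s k x = x"
  by (subst lower_op.simps) simp

lemma lower_op_rec: "k \<le> s \<Longrightarrow>
    lower_op \<mu> s k x = (\<Sum>l=k..s. lower_op \<mu> s (l + 1) (skip_factor \<mu> s k l *s T (l + 1) k x))"
  by (subst lower_op.simps) simp

lemma lower_op_add: "lower_op \<mu> s k (x + y) = lower_op \<mu> s k x + lower_op \<mu> s k y"
proof (induction "s + 1 - k" arbitrary: k x y rule: less_induct)
  case less
  show ?case
  proof (cases "k \<le> s")
    case True
    have "lower_op \<mu> s (l + 1) (skip_factor \<mu> s k l *s T (l + 1) k (x + y)) =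
      lower_op \<mu> s (l + 1) (skip_factor \<mu> s k l *s T (l + 1) k x) + lower_op \<mu> s (l + 1) (skip_factor \<mu> s k l *s T (l + 1) k y)"
      if "l \<in> {k..s}" for l
      using that less[of "l + 1"] by (auto simp: T_add scale_right_distrib)
    then show ?thesis
      using True by (simp add: lower_op_rec sum.distrib)
  qed (simp add: lower_op_above)
qed

lemma lower_op_scale: "lower_op \<mu> s k (c *s x) = c *s lower_op \<mu> s k x"
proof (induction "s + 1 - k" arbitrary: c k x rule: less_induct)
  case less
  show ?case
  proof (cases "k \<le> s")
    case True
    have "lower_op \<mu> s (l + 1) (skip_factor \<mu> s k l *s T (l + 1) k (c *s x)) =
      c *s lower_op \<mu> s (l + 1) (skip_factor \<mu> s k l *s T (l + 1) k x)"
      if "l \<in> {k..s}" for l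
      using that less[of "l + 1"] by (auto simp: T_scale)
    then show ?thesis
      using True by (simp add: lower_op_rec scale_sum_right)
  qed (simp add: lower_op_above)
qed

lemma lower_op_zero [simp]: "lower_op \<mu> s k 0 = 0"
  using lower_op_scale[of \<mu> s k 0 0] by simp

lemma lower_op_diff: "lower_op \<mu> s k (x - y) = lower_op \<mu> s k x - lower_op \<mu> s k y"
  using lower_op_add[of \<mu> s k "x - y" y] by simp

lemma mu_sum_rec: "i \<le> s \<Longrightarrow> mu_sum \<mu> i s = mu_sum \<mu> (i + 1) s - (\<mu> i + 1)"
  by (simp add: mu_sum_def sum.atLeast_Suc_atMost)

lemma skip_factor_same [simp]: "skip_factor \<mu> s k k = 1"
  by (simp add: skip_factor_def)

lemma skip_factor_first: "k < l \<Longrightarrow> skip_factor \<mu> s k l = of_int (mu_sum \<mu> (k + 1) s) * skip_factor \<mu> s (k + 1) l"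
  by (simp add: skip_factor_def prod.atLeast_Suc_atMost)

lemma skip_factor_last: "k < l \<Longrightarrow> skip_factor \<mu> s k l = skip_factor \<mu> s k (l - 1) * of_int (mu_sum \<mu> l s)"
  by (cases l) (auto simp: skip_factor_def)

text \<open>The chains of \<open>lower_op \<mu> s l\<close> start at \<open>l > i\<close>, so no factor \<open>T q p\<close> has \<open>p = i\<close> or
  \<open>q = i + 1\<close>, which is where the commutator with \<open>T i (i + 1)\<close> could be nonzero.\<close>

lemma raise_lower_op_above:
  assumes "i < l" "s + 1 < m" "i + 1 < m"
  shows "T i (i + 1) (lower_op \<mu> s l x) = lower_op \<mu> s l (T i (i + 1) x)"
  using assms(1)
proof (induction "s + 1 - l" arbitrary: l x rule: less_induct)
  case less
  show ?case
  proof (cases "l \<le> s")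
    case True
    have "T i (i + 1) (lower_op \<mu> s (p + 1) (skip_factor \<mu> s l p *s T (p + 1) l x)) =
        lower_op \<mu> s (p + 1) (skip_factor \<mu> s l p *s T (p + 1) l (T i (i + 1) x))" if "p \<in> {l..s}" for p
      using that less(1)[of "p + 1"] less(2) assms True T_bracket[of i "i+1" "p+1" l x]
      by (auto simp: T_scale)
    then show ?thesis
      using True by (simp add: lower_op_rec T_sum)
  qed (simp add: lower_op_above)
qed

text \<open>The direct step \<open>i \<rightarrow> i + 1\<close> contributes the coroot \<open>H\<^sub>i\<close>; a
  longer first step \<open>i \<rightarrow> p + 1\<close> is replaced by \<open>i + 1 \<rightarrow> p + 1\<close>, and since it had skipped \<open>i + 1\<close>
  these terms subtract the scalar of the point \<open>i + 1\<close> times the operator started at \<open>i + 1\<close>.\<close>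

lemma raise_lower_op_same:
  assumes "i \<le> s" "s + 1 < m"
  shows "T i (i + 1) (lower_op \<mu> s i x) = lower_op \<mu> s i (T i (i + 1) x) +
    lower_op \<mu> s (i + 1) (T i i x - T (i + 1) (i + 1) x - of_int (mu_sum \<mu> (i + 1) s) *s x)"
proof -
  let ?E = "T i (i + 1)"
  define t where "t y p = lower_op \<mu> s (p + 1) (skip_factor \<mu> s i p *s T (p + 1) i y)" for y p
  have first: "?E (t x i) = t (?E x) i + lower_op \<mu> s (i + 1) (T i i x - T (i + 1) (i + 1) x)"
    using assms raise_lower_op_above[of i "i+1" s] T_bracket[of i "i+1" "i+1" i x]
    by (simp add: t_def T_scale lower_op_add lower_op_diff)
  have later: "?E (t x p) = t (?E x) p -
      of_int (mu_sum \<mu> (i + 1) s) *s lower_op \<mu> s (p + 1) (skip_factor \<mu> s (i + 1) p *s T (p + 1) (i + 1) x)"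
    if "p \<in> {i+1..s}" for p
    using that assms raise_lower_op_above[of i "p+1" s] T_bracket[of i "i+1" "p+1" i x] 
    by (simp add: t_def T_scale lower_op_diff scale_right_diff_distrib skip_factor_first lower_op_scale)
  have tail: "(\<Sum>p=i+1..s. lower_op \<mu> s (p + 1) (skip_factor \<mu> s (i + 1) p *s T (p + 1) (i + 1) x)) =
      (if i + 1 \<le> s then lower_op \<mu> s (i + 1) x else 0)"
    by (auto simp: lower_op_rec)
  have end_zero: "\<not> i + 1 \<le> s \<Longrightarrow> mu_sum \<mu> (i + 1) s = 0"
    by (simp add: mu_sum_def)
  have split: "lower_op \<mu> s i y = t y i + (\<Sum>p=i+1..s. t y p)" for y
    using assms(1) by (simp add: lower_op_rec t_def sum.atLeast_Suc_atMost)
  have "?E (lower_op \<mu> s i x) = ?E (t x i) + (\<Sum>p=i+1..s. ?E (t x p))"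
    by (simp only: split T_add T_sum)
  also have "(\<Sum>p=i+1..s. ?E (t x p)) = (\<Sum>p=i+1..s. t (?E x) p) - of_int (mu_sum \<mu> (i + 1) s) *s
      (if i + 1 \<le> s then lower_op \<mu> s (i + 1) x else 0)"
    by (simp only: later sum_subtractf tail[symmetric] scale_sum_right cong: sum.cong)
  also have "?E (t x i) = t (?E x) i + lower_op \<mu> s (i + 1) (T i i x - T (i + 1) (i + 1) x)"
    by (rule first)
  finally show ?thesis
    using end_zero by (auto simp: split lower_op_diff lower_op_scale)
qed

text \<open>The commutator receives contributions from chains whose first step jumps over \<open>i\<close> to \<open>i + 1\<close>
  and from chains whose first step ends in \<open>i\<close>. Both are multiples of the same vector, and the scalars cancel because
  \<open>mu_sum \<mu> i s = mu_sum \<mu> (i + 1) s - (\<mu> i + 1)\<close>. This is what the weights of the chains are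
  made for. The hypothesis on \<open>x\<close> survives each step because \<open>T (p + 1) l\<close> with \<open>p + 1 < i\<close> commutes with
  \<open>H\<^sub>i\<close>, so the induction on \<open>i - l\<close> applies to the chains whose first step ends below \<open>i\<close>.\<close>

lemma raise_lower_op_below:
  assumes "l < i" "i \<le> s" "s + 1 < m"
    and "T i i x - T (i + 1) (i + 1) x = of_int (\<mu> i) *s x"
  shows "T i (i + 1) (lower_op \<mu> s l x) = lower_op \<mu> s l (T i (i + 1) x)"
  using assms(1,4)
proof (induction "i - l" arbitrary: l x rule: less_induct)
  case less
  let ?E = "T i (i + 1)"
  define t where "t y p = lower_op \<mu> s (p + 1) (skip_factor \<mu> s l p *s T (p + 1) l y)" for y p
  \<comment> \<open>the commutator with the summand of index \<open>p\<close> is \<open>d p\<close> times the common vector \<open>z\<close>\<close>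
  define d where "d p = (if p = i - 1 then of_int (\<mu> i + 1 - mu_sum \<mu> (i + 1) s) * skip_factor \<mu> s l (i - 1)
    else if p = i then skip_factor \<mu> s l i else 0)" for p
  define z where "z = lower_op \<mu> s (i + 1) (T i l x)"
  have summand: "?E (t x p) = t (?E x) p + d p *s z" if p: "p \<in> {l..s}" for p
  proof -
    consider "p + 1 < i" | "p = i - 1" | "p = i" | "i < p"
      by linarith
    then show ?thesis
    proof cases
      case 1
      have H: "T i i (T (p + 1) l x) - T (i + 1) (i + 1) (T (p + 1) l x) = of_int (\<mu> i) *s T (p + 1) l x"
        using 1 p assms less(2,3) T_bracket[of i i "p+1" l x] T_bracket[of "i+1" "i+1" "p+1" l x]
        by (simp flip: T_scale T_diff)
      have "?E (lower_op \<mu> s (p + 1) (T (p + 1) l x)) = lower_op \<mu> s (p + 1) (?E (T (p + 1) l x))"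
        using less(1)[OF _ 1 H] 1 p by auto
      moreover have "?E (T (p + 1) l x) = T (p + 1) l (?E x)"
        using 1 p assms less(2) T_bracket[of i "i+1" "p+1" l x] by simp
      ultimately show ?thesis
        using 1 by (auto simp: t_def d_def T_scale lower_op_scale)
    next
      case 2
      have comm: "?E (T i l x) = T i l (?E x)"
        using assms less(2) T_bracket[of i "i+1" i l x] by simp
      have "T i i (T i l x) - T (i + 1) (i + 1) (T i l x) = T i l (T i i x - T (i + 1) (i + 1) x) + T i l x"
        using assms less(2) T_bracket[of i i i l x] T_bracket[of "i+1" "i+1" i l x]
        by (simp add: T_diff)
      then have H: "T i i (T i l x) - T (i + 1) (i + 1) (T i l x) = of_int (\<mu> i + 1) *s T i l x"
        using less(3) by (simp add: T_scale scale_left_distrib)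
      have "?E (lower_op \<mu> s i (T i l x)) = lower_op \<mu> s i (T i l (?E x)) + of_int (\<mu> i + 1 - mu_sum \<mu> (i + 1) s) *s z"
        using raise_lower_op_same[OF assms(2,3), of \<mu> "T i l x"]
        by (simp only: comm H z_def lower_op_scale flip: scale_left_diff_distrib) simp
      moreover have "i - 1 + 1 = i" "p + 1 = i" using 2 less(2) by auto
      ultimately show ?thesis
        using 2 by (simp add: t_def d_def T_scale lower_op_scale scale_right_distrib mult.commute)
    next
      case 3
      have "?E (T (i + 1) l x) = T (i + 1) l (?E x) + T i l x"
        using assms less(2) T_bracket[of i "i+1" "i+1" l x] by simp
      then show ?thesis
        using 3 less(2) assms raise_lower_op_above[of i "i+1" s \<mu> "T (i + 1) l x"]
        by (auto simp: t_def d_def z_def T_scale lower_op_scale lower_op_add scale_right_distrib)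
    next
      case 4
      have "?E (T (p + 1) l x) = T (p + 1) l (?E x)"
        using 4 p assms less(2) T_bracket[of i "i+1" "p+1" l x] by simp
      then show ?thesis
        using 4 assms raise_lower_op_above[of i "p+1" s \<mu> "T (p + 1) l x"]
        by (auto simp: t_def d_def T_scale lower_op_scale)
    qed
  qed
  have "sum d {l..s} = sum d {i - 1, i}"
    using less(2) assms(2) by (intro sum.mono_neutral_right) (auto simp: d_def)
  also have "\<dots> = 0"
    using less(2) skip_factor_last[of l i \<mu> s] mu_sum_rec[OF assms(2), of \<mu>]
    by (auto simp: d_def algebra_simps)
  finally have d0: "sum d {l..s} = 0" .
  have ls: "l \<le> s" using less(2) assms(2) by simp
  have Q: "lower_op \<mu> s l y = (\<Sum>p=l..s. t y p)" for y
    using ls by (simp add: lower_op_rec t_def)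
  have "?E (lower_op \<mu> s l x) = (\<Sum>p=l..s. t (?E x) p + d p *s z)"
    by (simp only: Q T_sum summand cong: sum.cong)
  also have "\<dots> = lower_op \<mu> s l (?E x) + sum d {l..s} *s z"
    by (simp only: sum.distrib Q scale_sum_left)
  finally show ?case
    by (simp add: d0)
qed

end

section \<open>Singular vectors and generated subspaces\<close>

context gl_module
begin

text \<open>The simple roots above the range of the chains: all factors \<open>T q p\<close> have \<open>p < q \<le> s + 1 \<le> i\<close>.\<close>

lemma raise_lower_op_beyond:
  assumes "s < i" "i + 1 < m"
  shows "T i (i + 1) (lower_op \<mu> s l x) = lower_op \<mu> s l (T i (i + 1) x)"
proof (induction "s + 1 - l" arbitrary: l x rule: less_induct)
  case less
  show ?case
  proof (cases "l \<le> s")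
    case True
    have "T i (i + 1) (lower_op \<mu> s (p + 1) (skip_factor \<mu> s l p *s T (p + 1) l x)) =
        lower_op \<mu> s (p + 1) (skip_factor \<mu> s l p *s T (p + 1) l (T i (i + 1) x))" if "p \<in> {l..s}" for p
      using that less(1)[of "p + 1"] assms True T_bracket[of i "i+1" "p+1" l x]
      by (auto simp: T_scale)
    then show ?thesis
      using True by (simp add: lower_op_rec T_sum)
  qed (simp add: lower_op_above)
qed

definition weight_vector :: "(nat \<Rightarrow> int) \<Rightarrow> 'a \<Rightarrow> bool" where
  "weight_vector w x \<longleftrightarrow> (\<forall>a<m. T a a x = of_int (w a) *s x)"

definition shift :: "nat \<Rightarrow> nat \<Rightarrow> (nat \<Rightarrow> int) \<Rightarrow> nat \<Rightarrow> int" where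
  "shift a b w = (\<lambda>r. w r + of_bool (r = a) - of_bool (r = b))"

lemma weight_vector_T:
  assumes "weight_vector w x" "a < m" "b < m"
  shows "weight_vector (shift a b w) (T a b x)"
  unfolding weight_vector_def
proof (intro allI impI)
  fix r assume r: "r < m"
  have "T r r (T a b x) = T a b (T r r x) + (if r = a then T a b x else 0) - (if r = b then T a b x else 0)"
    using T_bracket[of r r a b x] r assms by auto
  also have "\<dots> = of_int (shift a b w r) *s T a b x"
    using assms r by (auto simp: weight_vector_def shift_def T_scale scale_left_distrib scale_left_diff_distrib)
  finally show "T r r (T a b x) = of_int (shift a b w r) *s T a b x" .
qed

lemma weight_vector_scale: "weight_vector w x \<Longrightarrow> weight_vector w (c *s x)"
  by (simp add: weight_vector_def T_scale mult.commute)

lemma weight_vector_sum: "(\<And>i. i \<in> I \<Longrightarrow> weight_vector w (g i)) \<Longrightarrow> weight_vector w (sum g I)"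
  by (simp add: weight_vector_def T_sum scale_sum_right)

lemma weight_vector_lower_op:
  assumes "weight_vector w x" "k \<le> s + 1" "s + 1 < m"
  shows "weight_vector (shift (s + 1) k w) (lower_op \<mu> s k x)"
  using assms(1,2)
proof (induction "s + 1 - k" arbitrary: k w x rule: less_induct)
  case less
  show ?case
  proof (cases "k \<le> s")
    case True
    have "weight_vector (shift (s + 1) k w) (lower_op \<mu> s (l + 1) (skip_factor \<mu> s k l *s T (l + 1) k x))"
      if "l \<in> {k..s}" for l
    proof -
      have "shift (s + 1) k w = shift (s + 1) (l + 1) (shift (l + 1) k w)"
        by (auto simp: shift_def)
      moreover have "weight_vector (shift (l + 1) k w) (skip_factor \<mu> s k l *s T (l + 1) k x)"
        using less(2) that assms(3) by (intro weight_vector_scale weight_vector_T) auto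
      ultimately show ?thesis
        using less(1)[of "l + 1" "shift (l + 1) k w"] that True by auto
    qed
    then show ?thesis
      using True by (auto simp: lower_op_rec intro!: weight_vector_sum)
  next
    case False
    then have "k = s + 1" "shift (s + 1) k w = w"
      using less(3) by (auto simp: shift_def)
    then show ?thesis
      using less(2) by (simp add: lower_op_above)
  qed
qed

text \<open>Highest weight vectors for the rows and columns from \<open>1\<close> on, that is for \<open>sl(n+1)\<close>; zero is
  included so that the notion is preserved when a lowering operator happens to vanish.\<close>

definition levi_singular :: "(nat \<Rightarrow> int) \<Rightarrow> 'a \<Rightarrow> bool" where
  "levi_singular w x \<longleftrightarrow> weight_vector w x \<and> (\<forall>a b. 1 \<le> a \<longrightarrow> a < b \<longrightarrow> b < m \<longrightarrow> T a b x = 0)"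

lemma raising_from_simple:
  assumes "\<And>i. 1 \<le> i \<Longrightarrow> i + 1 < m \<Longrightarrow> T i (i + 1) x = 0" "1 \<le> a" "a < b" "b < m"
  shows "T a b x = 0"
  using assms(3,4)
proof (induction b)
  case (Suc b)
  show ?case
  proof (cases "a = b")
    case False
    then have "T a b x = 0" "T b (b + 1) x = 0"
      using Suc assms(1)[of b] assms(2) by auto
    then show ?thesis
      using T_bracket[of a b b "b + 1" x] Suc.prems False by simp
  qed (use assms(1,2) Suc.prems in auto)
qed simp

text \<open>The \<open>sl(n+1)\<close>-weight in terms of fundamental weights, read off from the eigenvalues of the diagonal
  matrix units; it is \<open>0\<close> outside the range of indices so that it can be compared as a function.\<close>

definition levi_weight :: "(nat \<Rightarrow> int) \<Rightarrow> nat \<Rightarrow> int" where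
  "levi_weight w = (\<lambda>i. if 1 \<le> i \<and> i + 1 < m then w i - w (i + 1) else 0)"

lemma levi_singular_phi:
  assumes "levi_singular w x" "1 \<le> k" "k < m"
  shows "levi_singular (shift k 0 w) (lower_op (levi_weight w) (k - 1) 0 x)"
proof -
  have x: "weight_vector w x" "\<And>a b. 1 \<le> a \<Longrightarrow> a < b \<Longrightarrow> b < m \<Longrightarrow> T a b x = 0"
    using assms(1) by (auto simp: levi_singular_def)
  have simple: "T i (i + 1) (lower_op (levi_weight w) (k - 1) 0 x) = 0" if "1 \<le> i" "i + 1 < m" for i
  proof (cases "i \<le> k - 1")
    case True
    have "T i i x - T (i + 1) (i + 1) x = of_int (levi_weight w i) *s x"
      using x(1) that by (simp add: weight_vector_def levi_weight_def scale_left_diff_distrib)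
    then show ?thesis
      using raise_lower_op_below[of 0 i "k - 1" x "levi_weight w"] x(2)[of i "i + 1"] that True assms by simp
  next
    case False
    then show ?thesis
      using raise_lower_op_beyond[of "k - 1" i] x(2)[of i "i + 1"] that by simp
  qed
  show ?thesis
    using weight_vector_lower_op[OF x(1), of 0 "k - 1"] assms raising_from_simple[OF simple]
    by (auto simp: levi_singular_def)
qed

text \<open>The smallest linear subspace that contains \<open>B\<close> and is stable under \<open>T a b\<close> for \<open>(a, b) \<in> N\<close>.
  For a Lie subalgebra this is the submodule generated by \<open>B\<close>; smaller index sets give the pieces
  of a triangular decomposition.\<close>

inductive_set gen_span :: "(nat \<times> nat) set \<Rightarrow> 'a set \<Rightarrow> 'a set"
  for N :: "(nat \<times> nat) set" and B :: "'a set" where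
  gen_span_base: "x \<in> B \<Longrightarrow> x \<in> gen_span N B"
| gen_span_zero: "0 \<in> gen_span N B"
| gen_span_add: "x \<in> gen_span N B \<Longrightarrow> y \<in> gen_span N B \<Longrightarrow> x + y \<in> gen_span N B"
| gen_span_scale: "x \<in> gen_span N B \<Longrightarrow> c *s x \<in> gen_span N B"
| gen_span_T: "x \<in> gen_span N B \<Longrightarrow> (a, b) \<in> N \<Longrightarrow> T a b x \<in> gen_span N B"

lemma gen_span_diff: "x \<in> gen_span N B \<Longrightarrow> y \<in> gen_span N B \<Longrightarrow> x - y \<in> gen_span N B"
  using gen_span_add[of x N B "(-1) *s y"] gen_span_scale[of y N B "-1"] by simp

lemma gen_span_sum: "(\<And>i. i \<in> I \<Longrightarrow> g i \<in> gen_span N B) \<Longrightarrow> sum g I \<in> gen_span N B"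
  by (induction I rule: infinite_finite_induct) (auto intro: gen_span_zero gen_span_add)

lemma gen_span_least:
  assumes "B \<subseteq> S" "0 \<in> S" "\<And>x y. x \<in> S \<Longrightarrow> y \<in> S \<Longrightarrow> x + y \<in> S"
    "\<And>c x. x \<in> S \<Longrightarrow> c *s x \<in> S" "\<And>a b x. (a, b) \<in> N \<Longrightarrow> x \<in> S \<Longrightarrow> T a b x \<in> S"
  shows "gen_span N B \<subseteq> S"
proof
  show "x \<in> S" if "x \<in> gen_span N B" for x
    using that by induction (use assms in auto)
qed

lemma gen_span_subset:
  assumes "B \<subseteq> gen_span N' B'" "N \<subseteq> N'"
  shows "gen_span N B \<subseteq> gen_span N' B'"
  using assms by (intro gen_span_least) (auto intro: gen_span.intros)

text \<open>The part of the Poincare-Birkhoff-Witt theorem that is needed: if \<open>[G, N] \<subseteq> G\<close>, then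
  operators from \<open>G\<close> can be commuted to the right past those from \<open>N\<close>, producing only further operators
  from \<open>G\<close>, until they meet \<open>B\<close>. So only their effect on \<open>B\<close> matters.\<close>

lemma gen_span_triangular:
  assumes idx: "G \<subseteq> {..<m} \<times> {..<m}" "N \<subseteq> G"
    and ideal: "\<And>a b p q. (a, b) \<in> G \<Longrightarrow> (p, q) \<in> N \<Longrightarrow>
      (b = p \<longrightarrow> (a, q) \<in> G) \<and> (a = q \<longrightarrow> (p, b) \<in> G)"
    and base: "\<And>a b x. (a, b) \<in> G - N \<Longrightarrow> x \<in> B \<Longrightarrow> T a b x \<in> gen_span N B"
  shows "gen_span G B = gen_span N B"
proof
  have "\<forall>(a, b)\<in>G. T a b x \<in> gen_span N B" if "x \<in> gen_span N B" for x
    using that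
  proof induction
    case (gen_span_base x)
    then show ?case
      using base by (auto intro: gen_span.intros)
  next
    case (gen_span_T x p q)
    show ?case
    proof safe
      fix a b assume ab: "(a, b) \<in> G"
      have eq: "T a b (T p q x) =
          T p q (T a b x) + (if b = p then T a q x else 0) - (if a = q then T p b x else 0)"
        using T_bracket ab gen_span_T(2) idx by (metis (no_types) lessThan_iff mem_Sigma_iff subsetD)
      have stable: "(a, b) \<in> G \<Longrightarrow> T a b x \<in> gen_span N B" for a b
        using gen_span_T.IH by auto
      show "T a b (T p q x) \<in> gen_span N B"
        unfolding eq
        using ideal[OF ab gen_span_T(2)] stable stable[OF ab] gen_span_T(2)
        by (intro gen_span_diff gen_span.gen_span_add gen_span.gen_span_T[OF _ gen_span_T(2)])
          (auto intro: gen_span.gen_span_zero)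
    qed
  qed (auto simp: T_add T_scale intro: gen_span.intros)
  then show "gen_span G B \<subseteq> gen_span N B"
    by (intro gen_span_least) (auto intro: gen_span.intros)
  show "gen_span N B \<subseteq> gen_span G B"
    using idx by (intro gen_span_subset) (auto intro: gen_span.intros)
qed

end

section \<open>Contravariant inner products\<close>

text \<open>The inner product is required to be definite only on the subspace \<open>A\<close>, and the operators that
  raise the weight are required to be nilpotent there. The latter is
  the source of highest weight vectors in submodules.\<close>

locale unitary_gl_module = gl_module +
  fixes A :: "'a set" and ip :: "'a \<Rightarrow> 'a \<Rightarrow> complex"
  assumes A_zero: "0 \<in> A"
    and A_add: "x \<in> A \<Longrightarrow> y \<in> A \<Longrightarrow> x + y \<in> A"
    and A_scale: "x \<in> A \<Longrightarrow> c *s x \<in> A"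
    and A_T: "a < m \<Longrightarrow> b < m \<Longrightarrow> x \<in> A \<Longrightarrow> T a b x \<in> A"
    and ip_add: "ip (x + y) z = ip x z + ip y z"
    and ip_scale: "ip (c *s x) z = c * ip x z"
    and ip_cnj: "ip y x = cnj (ip x y)"
    and ip_adjoint: "a < m \<Longrightarrow> b < m \<Longrightarrow> ip (T a b x) y = ip x (T b a y)"
    and ip_definite: "x \<in> A \<Longrightarrow> ip x x = 0 \<Longrightarrow> x = 0"
    and raising_nilpotent: "\<exists>N. \<forall>ws x. length ws = N \<longrightarrow> (\<forall>(a, b)\<in>set ws. a < b \<and> b < m) \<longrightarrow>
      x \<in> A \<longrightarrow> foldr (\<lambda>(a, b). T a b) ws x = 0"
begin

lemma ip_zero [simp]: "ip 0 y = 0" "ip y 0 = 0"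
  using ip_scale[of 0 0 y] ip_cnj[of y 0] by simp_all

lemma ip_sum: "ip (sum g I) y = (\<Sum>i\<in>I. ip (g i) y)"
  by (induction I rule: infinite_finite_induct) (auto simp: ip_add)

lemma ip_scale_right: "ip x (c *s y) = cnj c * ip x y"
  by (metis ip_cnj ip_scale complex_cnj_mult)

lemma ip_diff: "ip (x - y) z = ip x z - ip y z"
  using ip_add[of "x - y" y z] by simp

lemma ip_of_int_eq:
  assumes "T a a x = of_int p *s x" "T a a y = of_int q *s y" "p \<noteq> q" "a < m"
  shows "ip x y = 0"
proof -
  have "of_int p * ip x y = of_int q * ip x y"
    using ip_adjoint[of a a x y] assms by (simp add: ip_scale ip_scale_right)
  then show ?thesis
    using assms(3) by simp
qed

definition highest_in :: "'a \<Rightarrow> bool" where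
  "highest_in x \<longleftrightarrow> (\<forall>a b. a < b \<longrightarrow> b < m \<longrightarrow> T a b x = 0)"

abbreviation all_units :: "(nat \<times> nat) set" where
  "all_units \<equiv> {..<m} \<times> {..<m}"

abbreviation lowering :: "(nat \<times> nat) set" where
  "lowering \<equiv> {(a, b). b < a \<and> a < m}"

lemma gen_span_highest:
  assumes "weight_vector w v" "highest_in v"
  shows "gen_span all_units {v} = gen_span lowering {v}"
proof (rule gen_span_triangular)
  fix a b x assume ab: "(a, b) \<in> all_units - lowering" and x: "x \<in> {v}"
  then consider "a = b" "a < m" | "a < b" "b < m"
    by (cases a b rule: linorder_cases) auto
  then show "T a b x \<in> gen_span lowering {v}"
    using assms x by cases (auto simp: weight_vector_def highest_in_def intro: gen_span.intros)
qed auto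

lemma gen_span_in_A: "v \<in> A \<Longrightarrow> gen_span all_units {v} \<subseteq> A"
  by (rule gen_span_least) (auto intro: A_zero A_add A_scale A_T)

lemma foldr_zero: "foldr (\<lambda>(a, b). T a b) ws 0 = 0"
  by (induction ws) auto

text \<open>A longest word of raising operators that does not kill \<open>y\<close> ends in a vector killed by all of them.\<close>

lemma highest_exists:
  assumes S: "S \<subseteq> A" "\<And>a b x. a < b \<Longrightarrow> b < m \<Longrightarrow> x \<in> S \<Longrightarrow> T a b x \<in> S"
    and y: "y \<in> S" "y \<noteq> 0"
  obtains x where "x \<in> S" "x \<noteq> 0" "highest_in x"
proof -
  define good where "good ws \<longleftrightarrow> (\<forall>(a, b)\<in>set ws. a < b \<and> b < m) \<and>
    foldr (\<lambda>(a, b). T a b) ws y \<noteq> 0" for ws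
  obtain N where N: "\<And>ws x. length ws = N \<Longrightarrow> (\<forall>(a, b)\<in>set ws. a < b \<and> b < m) \<Longrightarrow>
      x \<in> A \<Longrightarrow> foldr (\<lambda>(a, b). T a b) ws x = 0"
    using raising_nilpotent by blast
  have in_S: "foldr (\<lambda>(a, b). T a b) ws y \<in> S" if "\<forall>(a, b)\<in>set ws. a < b \<and> b < m" for ws
    using that by (induction ws) (auto intro: S y)
  have bound: "length ws < N" if "good ws" for ws
  proof (rule ccontr)
    assume "\<not> length ws < N"
    then have len: "length (drop (length ws - N) ws) = N" by auto
    have "\<forall>(a, b)\<in>set (drop (length ws - N) ws). a < b \<and> b < m"
      using that by (auto simp: good_def dest: in_set_dropD)
    then have zero: "foldr (\<lambda>(a, b). T a b) (drop (length ws - N) ws) y = 0"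
      using N[OF len] y(1) S(1) by blast
    have "foldr (\<lambda>(a, b). T a b) ws y =
        foldr (\<lambda>(a, b). T a b) (take (length ws - N) ws) (foldr (\<lambda>(a, b). T a b) (drop (length ws - N) ws) y)"
      by (metis append_take_drop_id foldr_append comp_apply)
    also have "\<dots> = 0"
      unfolding zero by (rule foldr_zero)
    finally show False
      using that by (simp add: good_def)
  qed
  have "good []"
    using y by (simp add: good_def)
  then obtain ws where ws: "good ws" "\<And>ws'. good ws' \<Longrightarrow> length ws' \<le> length ws"
    using ex_has_greatest_nat[of good "[]" length N] bound less_imp_le by blast
  have "T a b (foldr (\<lambda>(a, b). T a b) ws y) = 0" if "a < b" "b < m" for a b
    using ws(2)[of "(a, b) # ws"] ws(1) that by (auto simp: good_def)
  then show ?thesis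
    using that[of "foldr (\<lambda>(a, b). T a b) ws y"] ws(1) in_S[of ws] by (auto simp: good_def highest_in_def)
qed

text \<open>A nonzero submodule \<open>S\<close> contains some nonzero highest weight vector \<open>x\<close>. Subtract from \<open>x\<close> its projection to
  \<open>v\<close>: the difference is killed by raising operators and orthogonal to \<open>v\<close>, hence orthogonal to everything
  that lowering operators produce from \<open>v\<close>, in particular to itself. So \<open>x\<close> is a multiple of \<open>v\<close>,
  and \<open>v \<in> S\<close>.\<close>

lemma gen_span_irreducible:
  assumes v: "v \<in> A" "v \<noteq> 0" "weight_vector w v" "highest_in v"
    and S: "S \<subseteq> gen_span all_units {v}" "S \<noteq> {0}" "0 \<in> S"
      "\<And>x y. x \<in> S \<Longrightarrow> y \<in> S \<Longrightarrow> x + y \<in> S" "\<And>c x. x \<in> S \<Longrightarrow> c *s x \<in> S"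
      "\<And>a b x. a \<noteq> b \<Longrightarrow> a < m \<Longrightarrow> b < m \<Longrightarrow> x \<in> S \<Longrightarrow> T a b x \<in> S"
  shows "S = gen_span all_units {v}"
proof -
  let ?U = "gen_span all_units {v}"
  have UA: "?U \<subseteq> A"
    using gen_span_in_A v(1) .
  have perp: "x = 0" if x: "x \<in> ?U" "highest_in x" "ip v x = 0" for x
  proof -
    have "ip u x = 0" if "u \<in> gen_span lowering {v}" for u
      using that
    proof induction
      case (gen_span_T u a b)
      then show ?case
        using x(2) ip_adjoint[of a b u x] by (simp add: highest_in_def)
    qed (use x in \<open>auto simp: ip_add ip_scale\<close>)
    then have "ip x x = 0"
      using x(1) gen_span_highest[OF v(3,4)] by auto
    then show ?thesis
      using ip_definite x(1) UA by auto
  qed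
  obtain y where "y \<in> S" "y \<noteq> 0"
    using S(2,3) by blast
  then obtain x where x: "x \<in> S" "x \<noteq> 0" "highest_in x"
    using highest_exists[of S y] S UA by (metis (no_types, lifting) less_trans nat_neq_iff subset_trans)
  have vv: "ip v v \<noteq> 0"
    using ip_definite v by blast
  define c where "c = ip x v / ip v v"
  have "x - c *s v = 0"
  proof (rule perp)
    show "x - c *s v \<in> ?U"
      using x(1) S(1) by (intro gen_span_diff gen_span_scale) (auto intro: gen_span_base)
    show "highest_in (x - c *s v)"
      using x(3) v(4) by (simp add: highest_in_def T_diff T_scale)
    have "ip (x - c *s v) v = 0"
      using vv by (simp add: ip_diff ip_scale c_def)
    then show "ip v (x - c *s v) = 0"
      by (simp add: ip_cnj[of v])
  qed
  then have "x = c *s v" by simp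
  then have "v = (1 / c) *s x"
    using x(2) by auto
  then have "v \<in> S"
    using S(5) x(1) by metis
  then have "gen_span lowering {v} \<subseteq> S"
    using S by (intro gen_span_least) auto
  then show ?thesis
    using S(1) gen_span_highest[OF v(3,4)] by auto
qed

text \<open>For \<open>k \<ge> 1\<close> the last factor of every chain lowers inside the rows from \<open>1\<close> on, so its adjoint raises
  there and kills \<open>y\<close>.\<close>

lemma ip_lower_op_lower:
  assumes "1 \<le> k" "k \<le> s" "s + 1 < m"
    and "\<And>a b. 1 \<le> a \<Longrightarrow> a < b \<Longrightarrow> b < m \<Longrightarrow> T a b y = 0"
  shows "ip (lower_op \<mu> s k x) y = 0"
  using assms(1,2)
proof (induction "s + 1 - k" arbitrary: k x rule: less_induct)
  case less
  have "ip (lower_op \<mu> s (l + 1) (skip_factor \<mu> s k l *s T (l + 1) k x)) y = 0" if l: "l \<in> {k..s}" for l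
  proof (cases "l = s")
    case True
    then show ?thesis
      using less(2,3) assms(3,4) ip_adjoint[of "s + 1" k x y] by (simp add: lower_op_above ip_scale)
  next
    case False
    then show ?thesis
      using l less by auto
  qed
  then show ?case
    using less(3) by (simp add: lower_op_rec[of k s] ip_sum)
qed

text \<open>Against a singular vector only the one-step chain \<open>0 \<rightarrow> k\<close>, that is the summand of \<open>P\<^sub>k\<close>, is
  visible.\<close>

lemma ip_phi:
  assumes "1 \<le> k" "k < m"
    and "\<And>a b. 1 \<le> a \<Longrightarrow> a < b \<Longrightarrow> b < m \<Longrightarrow> T a b y = 0"
  shows "ip (lower_op \<mu> (k - 1) 0 x) y = skip_factor \<mu> (k - 1) 0 (k - 1) * ip x (T 0 k y)"
proof -
  define s where "s = k - 1"
  have k: "k = s + 1" using assms(1) by (simp add: s_def)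
  have lower: "ip (lower_op \<mu> s (l + 1) (skip_factor \<mu> s 0 l *s T (l + 1) 0 x)) y = 0" if "l < s" for l
    using that assms k by (intro ip_lower_op_lower) auto
  have "ip (lower_op \<mu> s 0 x) y = (\<Sum>l\<le>s. ip (lower_op \<mu> s (l + 1) (skip_factor \<mu> s 0 l *s T (l + 1) 0 x)) y)"
    by (simp only: lower_op_rec[of 0 s] ip_sum atLeast0AtMost le0)
  also have "\<dots> = (\<Sum>l\<in>{s}. ip (lower_op \<mu> s (l + 1) (skip_factor \<mu> s 0 l *s T (l + 1) 0 x)) y)"
    by (rule sum.mono_neutral_right) (use lower in auto)
  also have "\<dots> = ip (lower_op \<mu> s (s + 1) (skip_factor \<mu> s 0 s *s T (s + 1) 0 x)) y"
    by simp
  also have "\<dots> = skip_factor \<mu> s 0 s * ip x (T 0 (s + 1) y)"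
    using assms(2) k by (simp add: lower_op_above ip_scale ip_adjoint)
  finally show ?thesis
    by (simp add: k)
qed

end

section \<open>Test vectors and iterated lowering operators\<close>

text \<open>A list of iteration numbers as a function on \<open>1, 2, \<dots>\<close>, so that appending zeros makes no
  difference.\<close>

definition pad :: "nat list \<Rightarrow> nat \<Rightarrow> nat" where
  "pad js r = (if 1 \<le> r \<and> r \<le> length js then js ! (r - 1) else 0)"

lemma pad_snoc: "pad (js @ [i]) = (pad js)(length js + 1 := i)"
  by (auto simp: pad_def nth_append fun_eq_iff)

lemma pad_beyond: "length js < r \<Longrightarrow> pad js r = 0"
  by (simp add: pad_def)

text \<open>The family \<open>f\<close> consists of the test vectors described at the beginning. They live in the ambient space,
  possibly outside the module generated by \<open>v\<close>.\<close>

locale extremal_family = unitary_gl_module +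
  fixes v :: 'a and w\<^sub>0 :: "nat \<Rightarrow> int" and \<Lambda> :: "nat \<Rightarrow> nat" and f :: "(nat \<Rightarrow> nat) \<Rightarrow> 'a"
  assumes v_in_A: "v \<in> A" and v_nonzero: "v \<noteq> 0"
    and v_weight: "weight_vector w\<^sub>0 v" and v_highest: "highest_in v"
    and w\<^sub>0_diff: "1 \<le> i \<Longrightarrow> i < m \<Longrightarrow> w\<^sub>0 (i - 1) - w\<^sub>0 i = int (\<Lambda> i)"
    and f_start: "f (\<lambda>_. 0) = v"
    and f_raise: "1 \<le> a \<Longrightarrow> a < b \<Longrightarrow> b < m \<Longrightarrow> T a b (f j) = 0"
    and f_weight: "1 \<le> r \<Longrightarrow> r < m \<Longrightarrow> T r r (f j) = of_int (w\<^sub>0 r + int (j r)) *s f j"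
    and f_descend: "1 \<le> k \<Longrightarrow> k < m \<Longrightarrow> \<forall>l>k. j l = 0 \<Longrightarrow> j k < \<Lambda> k \<Longrightarrow>
      \<exists>c. c \<noteq> 0 \<and> T 0 k (f (j(k := j k + 1))) = c *s f j"
begin

text \<open>The weight is carried along because the formula for \<open>\<phi>\<^sub>k\<close> depends on it, and because the weight
  cannot be recovered from the vector once the vector is zero.\<close>

definition step :: "nat \<Rightarrow> (nat \<Rightarrow> int) \<times> 'a \<Rightarrow> (nat \<Rightarrow> int) \<times> 'a" where
  "step k = (\<lambda>(w, x). (shift k 0 w, lower_op (levi_weight w) (k - 1) 0 x))"

definition chain :: "nat list \<Rightarrow> (nat \<Rightarrow> int) \<times> 'a" where
  "chain js = fold (\<lambda>(k, i). step k ^^ i) (List.enumerate 1 js) (w\<^sub>0, v)"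

abbreviation parabolic :: "(nat \<times> nat) set" where
  "parabolic \<equiv> {(a, b). 1 \<le> a \<and> a < m \<and> b < m}"

lemma chain_Nil [simp]: "chain [] = (w\<^sub>0, v)"
  by (simp add: chain_def)

lemma chain_snoc: "chain (js @ [i]) = (step (length js + 1) ^^ i) (chain js)"
  by (simp add: chain_def enumerate_append_eq)

lemma chain_snoc_0: "chain (js @ [0]) = chain js"
  by (simp add: chain_snoc)

lemma chain_snoc_Suc: "chain (js @ [Suc i]) = step (length js + 1) (chain (js @ [i]))"
  by (simp add: chain_snoc)

text \<open>The order in which \<open>chain\<close> is built up: append a new iteration number, starting from \<open>0\<close>, and
  increase the last one.\<close>

lemma chain_induct [case_names Nil zero Suc]:
  assumes "P []" "\<And>js. P js \<Longrightarrow> P (js @ [0])" "\<And>js i. P (js @ [i]) \<Longrightarrow> P (js @ [Suc i])"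
  shows "P js"
proof (induction js rule: rev_induct)
  case (snoc i js)
  then show ?case
    by (induction i) (use assms in auto)
qed (use assms in auto)

lemma chain_weight: "1 \<le> r \<Longrightarrow> fst (chain js) r = w\<^sub>0 r + int (pad js r)"
proof (induction js rule: chain_induct)
  case (zero js)
  then show ?case
    by (simp add: chain_snoc_0 pad_snoc pad_beyond)
next
  case (Suc js i)
  then show ?case
    by (auto simp: chain_snoc_Suc step_def shift_def pad_snoc split: prod.splits)
qed (simp add: pad_def)

lemma chain_singular: "length js < m \<Longrightarrow> levi_singular (fst (chain js)) (snd (chain js))"
proof (induction js rule: chain_induct)
  case Nil
  then show ?case
    using v_weight v_highest by (simp add: levi_singular_def highest_in_def)
next
  case (zero js)
  then show ?case
    by (simp add: chain_snoc_0)
next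
  case (Suc js i)
  then show ?case
    using levi_singular_phi[of "fst (chain (js @ [i]))" "snd (chain (js @ [i]))" "length js + 1"]
    by (auto simp: chain_snoc_Suc step_def split: prod.splits)
qed

lemma lower_op_in_gen_span:
  assumes "x \<in> gen_span N B" "\<And>a b. a \<le> s + 1 \<Longrightarrow> b < a \<Longrightarrow> (a, b) \<in> N"
  shows "lower_op \<mu> s k x \<in> gen_span N B"
  using assms(1)
proof (induction "s + 1 - k" arbitrary: k x rule: less_induct)
  case less
  show ?case
  proof (cases "k \<le> s")
    case True
    have "lower_op \<mu> s (l + 1) (skip_factor \<mu> s k l *s T (l + 1) k x) \<in> gen_span N B" if "l \<in> {k..s}" for l
      using that less(2) by (intro less(1) gen_span_scale gen_span_T assms(2)) auto
    then show ?thesis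
      using True by (simp only: lower_op_rec[of k s] gen_span_sum)
  qed (use less in \<open>simp add: lower_op_above\<close>)
qed

lemma chain_in_gen_span: "length js < m \<Longrightarrow> snd (chain js) \<in> gen_span parabolic {v}"
proof (induction js rule: chain_induct)
  case Nil
  then show ?case
    by (simp add: gen_span_base)
next
  case (zero js)
  then show ?case
    by (simp add: chain_snoc_0)
next
  case (Suc js i)
  obtain w x where wx: "chain (js @ [i]) = (w, x)" by fastforce
  then have "x \<in> gen_span parabolic {v}"
    using Suc by simp
  then have "lower_op (levi_weight w) (length js) 0 x \<in> gen_span parabolic {v}"
    using Suc.prems by (rule_tac lower_op_in_gen_span) auto
  then show ?case
    by (simp add: chain_snoc_Suc step_def wx)
qed

text \<open>For a dominant weight every \<open>mu_sum\<close> is negative.\<close>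

lemma skip_factor_nonzero:
  assumes "\<And>i. 1 \<le> i \<Longrightarrow> i \<le> s \<Longrightarrow> 0 \<le> \<mu> i"
  shows "skip_factor \<mu> s 0 s \<noteq> 0"
proof -
  have "0 < (\<Sum>i=r..s. \<mu> i + 1)" if "r \<in> {1..s}" for r
    using that assms by (intro sum_pos) (auto simp: add_nonneg_pos)
  then have "mu_sum \<mu> r s \<noteq> 0" if "r \<in> {1..s}" for r
    using that by (fastforce simp: mu_sum_def)
  then show ?thesis
    by (simp add: skip_factor_def)
qed

text \<open>Moving the last \<open>\<phi>\<^sub>k\<close> to the other side turns the pairing at \<open>j + e\<^sub>k\<close> into a nonzero multiple of
  the one at \<open>j\<close>. Inside the box the weights \<open>\<Lambda>\<^bsub>i+1\<^esub> + j\<^sub>i - j\<^bsub>i+1\<^esub>\<close> stay nonnegative, so the scalar from \<open>\<phi>\<^sub>k\<close> is nonzero.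
  In particular \<open>chain js\<close> does not vanish.\<close>

lemma chain_pairing:
  assumes "length js < m" "\<And>r. pad js r \<le> \<Lambda> r"
  shows "ip (snd (chain js)) (f (pad js)) \<noteq> 0"
  using assms
proof (induction js rule: chain_induct)
  case Nil
  have "pad [] = (\<lambda>_. 0)"
    by (auto simp: pad_def)
  then show ?case
    using f_start ip_definite v_in_A v_nonzero by auto
next
  case (zero js)
  moreover have "pad (js @ [0]) = pad js"
    by (auto simp: pad_def nth_append fun_eq_iff)
  ultimately show ?case
    by (simp add: chain_snoc_0)
next
  case (Suc js i)
  define k where "k = length js + 1"
  let ?j = "pad (js @ [i])"
  obtain w x where wx: "chain (js @ [i]) = (w, x)" by fastforce
  have k: "1 \<le> k" "k < m" using Suc.prems(1) by (simp_all add: k_def)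
  have j: "pad (js @ [Suc i]) = ?j(k := ?j k + 1)" "?j k < \<Lambda> k" "\<forall>l>k. ?j l = 0"
    using Suc.prems(2)[of k] by (auto simp: pad_snoc k_def pad_def)
  have box: "?j r \<le> \<Lambda> r" for r
    using Suc.prems(2)[of r] j by (cases "r = k") auto
  have IH: "ip x (f ?j) \<noteq> 0"
    using Suc.IH Suc.prems(1) box wx by simp
  obtain c where c: "c \<noteq> 0" "T 0 k (f (?j(k := ?j k + 1))) = c *s f ?j"
    using f_descend[OF k j(3,2)] by blast
  have w: "w r = w\<^sub>0 r + int (?j r)" if "1 \<le> r" for r
    using chain_weight[OF that, of "js @ [i]"] wx by simp
  have "0 \<le> levi_weight w r" if "1 \<le> r" "r \<le> k - 1" for r
    using w[of r] w[of "r + 1"] w\<^sub>0_diff[of "r + 1"] box[of "r + 1"] that k by (auto simp: levi_weight_def)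
  then have "skip_factor (levi_weight w) (k - 1) 0 (k - 1) \<noteq> 0"
    by (rule skip_factor_nonzero)
  moreover have "snd (chain (js @ [Suc i])) = lower_op (levi_weight w) (k - 1) 0 x"
    by (simp add: chain_snoc_Suc wx step_def k_def)
  moreover have "ip (lower_op (levi_weight w) (k - 1) 0 x) (f (pad (js @ [Suc i]))) =
      skip_factor (levi_weight w) (k - 1) 0 (k - 1) * ip x (c *s f ?j)"
    unfolding j(1) c(2)[symmetric] by (intro ip_phi k f_raise)
  ultimately show ?case
    using IH c(1) by (simp only: ip_scale_right) simp
qed

text \<open>The submodule for the parabolic subalgebra of matrices with zero top row, which contains the image of the
  embedding, generated by the iterates outside \<open>D\<close>.\<close>

definition cut :: "(nat \<Rightarrow> nat) set \<Rightarrow> 'a set" where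
  "cut D = gen_span parabolic {snd (chain js) | js. length js < m \<and> pad js \<notin> D}"

context
  fixes D :: "(nat \<Rightarrow> nat) set"
  assumes D_down: "\<And>i j. i \<in> D \<Longrightarrow> (\<And>r. 1 \<le> r \<Longrightarrow> r < m \<Longrightarrow> j r \<le> i r) \<Longrightarrow> j \<in> D"
begin

text \<open>Weight vectors whose displacement from \<open>w\<^sub>0\<close> is not in \<open>D\<close>. As \<open>D\<close> is closed downwards, the operators
  \<open>P\<^sub>k\<close>, which increase the displacement, stay in this set.\<close>

definition outer :: "'a set" where
  "outer = {x. \<exists>w j. weight_vector w x \<and> j \<notin> D \<and> (\<forall>r. 1 \<le> r \<longrightarrow> r < m \<longrightarrow> w r = w\<^sub>0 r + int (j r))}"

lemma outer_perp:
  assumes "i \<in> D" "x \<in> outer"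
  shows "ip x (f i) = 0"
proof -
  obtain w j where wj: "weight_vector w x" "j \<notin> D" "\<And>r. 1 \<le> r \<Longrightarrow> r < m \<Longrightarrow> w r = w\<^sub>0 r + int (j r)"
    using assms(2) by (auto simp: outer_def)
  then obtain r where r: "1 \<le> r" "r < m" "\<not> j r \<le> i r"
    using D_down[OF assms(1), of j] by blast
  then show ?thesis
    using wj(1,3) f_weight[of r i] by (intro ip_of_int_eq[of r _ "w r" _ "w\<^sub>0 r + int (i r)"])
      (auto simp: weight_vector_def)
qed

lemma outer_P:
  assumes "x \<in> outer" "1 \<le> a" "a < m"
  shows "T a 0 x \<in> outer"
proof -
  obtain w j where wj: "weight_vector w x" "j \<notin> D" "\<And>r. 1 \<le> r \<Longrightarrow> r < m \<Longrightarrow> w r = w\<^sub>0 r + int (j r)"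
    using assms(1) by (auto simp: outer_def)
  have "weight_vector (shift a 0 w) (T a 0 x)"
    using weight_vector_T[OF wj(1), of a 0] assms by simp
  moreover have "j(a := j a + 1) \<notin> D"
  proof
    assume "j(a := j a + 1) \<in> D"
    then have "j \<in> D"
      by (rule D_down) simp
    then show False
      using wj(2) by simp
  qed
  ultimately show ?thesis
    using wj(3) assms(2)
    by (auto simp: outer_def shift_def intro!: exI[of _ "shift a 0 w"] exI[of _ "j(a := j a + 1)"])
qed

text \<open>Triangular decomposition is applied twice. Diagonal matrix units and raising operators act on the generators by
  scalars, so together with the \<open>P\<^sub>k\<close> they produce no more than the \<open>P\<^sub>k\<close> alone; the result is
  spanned by vectors from \<open>outer\<close>. The remaining lowering operators have adjoints that kill \<open>f i\<close>.\<close>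

lemma cut_perp:
  assumes "i \<in> D" "x \<in> cut D"
  shows "ip x (f i) = 0"
proof -
  define B where "B = {snd (chain js) | js. length js < m \<and> pad js \<notin> D}"
  let ?P = "{(a, b). 1 \<le> a \<and> a < m \<and> b = 0}" and ?F = "{(a, b). 1 \<le> b \<and> b < a \<and> a < m}"
  let ?Q = "{(a, b). 1 \<le> a \<and> a < m \<and> (b = 0 \<or> a \<le> b \<and> b < m)}"
  have B_singular: "\<exists>w j. levi_singular w x \<and> j \<notin> D \<and> (\<forall>r. 1 \<le> r \<longrightarrow> r < m \<longrightarrow> w r = w\<^sub>0 r + int (j r))"
    if x: "x \<in> B" for x
  proof -
    obtain js where js: "x = snd (chain js)" "length js < m" "pad js \<notin> D"
      using x unfolding B_def by blast
    show ?thesis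
      using chain_singular[OF js(2)] js chain_weight[of _ js]
      by (intro exI[of _ "fst (chain js)"] exI[of _ "pad js"]) simp
  qed
  then have B: "B \<subseteq> outer"
    unfolding outer_def levi_singular_def by blast
  have QP: "gen_span ?Q B = gen_span ?P B"
  proof (rule gen_span_triangular)
    fix a b x assume ab: "(a, b) \<in> ?Q - ?P" and x: "x \<in> B"
    then obtain w where w: "levi_singular w x"
      using B_singular by blast
    show "T a b x \<in> gen_span ?P B"
    proof (cases "a = b")
      case True
      then have "T a b x = of_int (w a) *s x"
        using w ab by (auto simp: levi_singular_def weight_vector_def)
      then show ?thesis
        using x by (simp add: gen_span_scale gen_span_base)
    next
      case False
      then show ?thesis
        using w ab by (auto simp: levi_singular_def intro: gen_span_zero)
    qed
  qed auto
  have "gen_span parabolic (gen_span ?P B) = gen_span ?F (gen_span ?P B)"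
  proof (rule gen_span_triangular)
    fix a b x assume "(a, b) \<in> parabolic - ?F" and x: "x \<in> gen_span ?P B"
    then have "(a, b) \<in> ?Q" by auto
    then have "T a b x \<in> gen_span ?P B"
      using gen_span_T[of x ?Q B a b] x unfolding QP by blast
    then show "T a b x \<in> gen_span ?F (gen_span ?P B)"
      by (rule gen_span_base)
  qed auto
  moreover have "cut D \<subseteq> gen_span parabolic (gen_span ?P B)"
    unfolding cut_def B_def[symmetric] by (rule gen_span_subset) (auto intro: gen_span_base)
  ultimately have "x \<in> gen_span ?F (gen_span ?P B)"
    using assms(2) by blast
  then show ?thesis
  proof induction
    case (gen_span_base x)
    have "x \<in> gen_span {} outer"
      using gen_span_base
    proof induction
      case (gen_span_base x)
      then show ?case using B by (blast intro: gen_span.gen_span_base)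
    next
      case (gen_span_T x a b)
      have "T a 0 y \<in> gen_span {} outer" if "y \<in> gen_span {} outer" for y
        using that
      proof induction
        case (gen_span_base y)
        then show ?case
          using outer_P gen_span_T(2) by (auto intro: gen_span.gen_span_base)
      qed (auto simp: T_add T_scale intro: gen_span.intros)
      then show ?case using gen_span_T by auto
    qed (auto intro: gen_span.intros)
    then show ?case
      by induction (auto simp: outer_perp[OF assms(1)] ip_add ip_scale)
  next
    case (gen_span_T x a b)
    then show ?case
      using f_raise[of b a] by (simp add: ip_adjoint)
  qed (auto simp: ip_add ip_scale)
qed

lemma chain_in_cut_iff:
  assumes "\<And>j r. j \<in> D \<Longrightarrow> 1 \<le> r \<Longrightarrow> r < m \<Longrightarrow> j r \<le> \<Lambda> r" "length js < m"
  shows "snd (chain js) \<in> cut D \<longleftrightarrow> pad js \<notin> D"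
proof
  assume "pad js \<notin> D"
  then show "snd (chain js) \<in> cut D"
    unfolding cut_def using assms(2) by (auto intro: gen_span_base)
next
  assume cut: "snd (chain js) \<in> cut D"
  show "pad js \<notin> D"
  proof
    assume D: "pad js \<in> D"
    have "pad js r \<le> \<Lambda> r" for r
      using assms(1)[OF D, of r] assms(2) by (auto simp: pad_def)
    then show False
      using chain_pairing[OF assms(2)] cut_perp[OF D cut] by simp
  qed
qed

end

end

section \<open>Modules presented as images of a linear map\<close>

text \<open>A record-based vector space \<open>V\<close> given as the image of a subspace \<open>C\<close> of a type-class vector space. Both the
  irreducible module, where \<open>q\<close> is a coordinate map, and its quotient, where \<open>q\<close> also passes to cosets, are
  of this form; all structure on them is computed upstairs.\<close>

locale presentation = vector_space scale
  for scale :: "complex \<Rightarrow> 'a::ab_group_add \<Rightarrow> 'a" (infixr "*s" 75) +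
  fixes C :: "'a set" and V :: "(complex, 'v) module" and q :: "'a \<Rightarrow> 'v"
  assumes C_zero: "0 \<in> C" and C_add: "x \<in> C \<Longrightarrow> y \<in> C \<Longrightarrow> x + y \<in> C"
    and C_scale: "x \<in> C \<Longrightarrow> c *s x \<in> C"
    and carrier_eq: "carrier V = q ` C"
    and q_add: "x \<in> C \<Longrightarrow> y \<in> C \<Longrightarrow> q x \<oplus>\<^bsub>V\<^esub> q y = q (x + y)"
    and q_scale: "x \<in> C \<Longrightarrow> c \<odot>\<^bsub>V\<^esub> q x = q (c *s x)"
    and q_zero: "\<zero>\<^bsub>V\<^esub> = q 0"
begin

lemma C_minus: "x \<in> C \<Longrightarrow> - x \<in> C"
  using C_scale[of x "-1"] by simp

lemma C_sum: "(\<And>i. i \<in> I \<Longrightarrow> g i \<in> C) \<Longrightarrow> sum g I \<in> C"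
  by (induction I rule: infinite_finite_induct) (auto intro: C_zero C_add)

lemma q_closed: "x \<in> C \<Longrightarrow> q x \<in> carrier V"
  by (simp add: carrier_eq)

lemma vectorspace: "vectorspace class_ring V"
proof (rule vs_criteria)
  show "field (class_ring :: complex ring)" by (rule class_field)
  show "\<forall>v\<in>carrier V. \<exists>v'\<in>carrier V. v \<oplus>\<^bsub>V\<^esub> v' = \<zero>\<^bsub>V\<^esub>"
  proof
    fix v assume "v \<in> carrier V"
    then obtain x where x: "x \<in> C" "v = q x" by (auto simp: carrier_eq)
    then have "v \<oplus>\<^bsub>V\<^esub> q (- x) = \<zero>\<^bsub>V\<^esub>"
      by (simp add: q_add C_minus q_zero)
    then show "\<exists>v'\<in>carrier V. v \<oplus>\<^bsub>V\<^esub> v' = \<zero>\<^bsub>V\<^esub>"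
      using x C_minus q_closed by blast
  qed
qed (auto simp: carrier_eq q_add q_scale q_zero C_add C_scale C_zero algebra_simps
    scale_left_distrib scale_right_distrib)

lemma abelian_group: "abelian_group V"
  using vectorspace by (simp add: vectorspace_def Module.module_def)

lemma q_minus: "x \<in> C \<Longrightarrow> y \<in> C \<Longrightarrow> q x \<ominus>\<^bsub>V\<^esub> q y = q (x - y)"
proof -
  assume x: "x \<in> C" "y \<in> C"
  interpret abelian_group V by (rule abelian_group)
  have "q (- y) \<oplus>\<^bsub>V\<^esub> q y = \<zero>\<^bsub>V\<^esub>"
    using x by (simp add: q_add C_minus q_zero)
  then have "\<ominus>\<^bsub>V\<^esub> q y = q (- y)"
    using x by (intro minus_equality q_closed C_minus) auto
  then show ?thesis
    using x by (simp add: a_minus_def q_add C_minus)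
qed

lemma q_finsum:
  assumes "\<And>i. i \<in> I \<Longrightarrow> g i \<in> C" "finite I"
  shows "(\<Oplus>\<^bsub>V\<^esub>i\<in>I. q (g i)) = q (sum g I)"
proof -
  interpret abelian_group V by (rule abelian_group)
  show ?thesis
    using assms(2,1)
  proof (induction I)
    case (insert i I)
    then have "(\<Oplus>\<^bsub>V\<^esub>i\<in>insert i I. q (g i)) = q (g i) \<oplus>\<^bsub>V\<^esub> (\<Oplus>\<^bsub>V\<^esub>i\<in>I. q (g i))"
      by (intro finsum_insert) (auto intro: q_closed)
    then show ?case
      using insert by (simp add: q_add C_sum)
  qed (simp add: q_zero)
qed

text \<open>A subspace of a finitely spanned space has a finite basis, whose image generates \<open>V\<close>.\<close>

lemma fin_dim:
  assumes "finite G" "C \<subseteq> span G"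
  shows "vectorspace.fin_dim class_ring V"
proof -
  interpret V: vectorspace class_ring V by (rule vectorspace)
  obtain B where B: "B \<subseteq> C" "independent B" "C \<subseteq> span B"
    using maximal_independent_subset by blast
  have "finite B"
    using independent_span_bound[OF assms(1) B(2)] B(1) assms(2) by blast
  have gen: "submodule class_ring (V.span (q ` B)) V"
    by (rule V.span_is_submodule) (use B(1) in \<open>auto simp: carrier_eq\<close>)
  interpret S: LinearCombinations.submodule class_ring "V.span (q ` B)" V
    by (rule gen)
  have "x \<in> C \<and> q x \<in> V.span (q ` B)" if "x \<in> span B" for x
    using that
  proof (induction rule: span_induct_alt)
    case base
    then show ?case using C_zero S.zero_closed q_zero by simp
  next
    case (step c x y)
    have x: "x \<in> C" using step(1) B(1) by blast
    have "q x \<in> V.span (q ` B)"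
      using step(1) V.in_own_span[of "q ` B"] B(1) by (auto simp: carrier_eq)
    then have "c \<odot>\<^bsub>V\<^esub> q x \<oplus>\<^bsub>V\<^esub> q y \<in> V.span (q ` B)"
      using step(2) by (intro S.m_closed S.smult_closed) auto
    then show ?case
      using x step(2) by (simp add: q_scale q_add C_scale C_add)
  qed
  then have "carrier V \<subseteq> V.span (q ` B)"
    using B(3) by (auto simp: carrier_eq)
  then have "V.span (q ` B) = carrier V"
    using S.subset by blast
  then show ?thesis
    unfolding V.fin_dim_def using \<open>finite B\<close> B(1)
    by (intro exI[of _ "q ` B"]) (auto simp: carrier_eq)
qed

text \<open>The analogue of \<open>env_act\<close> in the type-class space.\<close>

definition env_eval :: "('g \<Rightarrow> 'a \<Rightarrow> 'a) \<Rightarrow> 'g env \<Rightarrow> 'a \<Rightarrow> 'a" where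
  "env_eval R u x = foldr (\<lambda>(c, w) s. c *s foldr R w x + s) u 0"

lemma env_eval_simps [simp]:
  "env_eval R [] x = 0"
  "env_eval R ((c, w) # u) x = c *s foldr R w x + env_eval R u x"
  by (simp_all add: env_eval_def)

lemma env_act_q:
  assumes R: "\<And>g x. g \<in> carrier L \<Longrightarrow> x \<in> C \<Longrightarrow> R g x \<in> C"
    "\<And>g x. g \<in> carrier L \<Longrightarrow> x \<in> C \<Longrightarrow> act g (q x) = q (R g x)"
    and x: "x \<in> C" and u: "u \<in> env L"
  shows "env_eval R u x \<in> C \<and> env_act V act u (q x) = q (env_eval R u x)"
  using u
proof (induction u)
  case Nil
  then show ?case
    by (simp add: env_act_def q_zero C_zero)
next
  case (Cons cw u)
  obtain c w where cw: "cw = (c, w)" by fastforce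
  have w: "set w \<subseteq> carrier L" and u: "u \<in> env L"
    using Cons(2) by (auto simp: env_def cw)
  have "foldr R w x \<in> C \<and> foldr act w (q x) = q (foldr R w x)"
    using w by (induction w) (auto simp: R x)
  then show ?case
    using Cons.IH[OF u] by (simp add: cw env_act_def q_scale q_add C_scale C_add)
qed

text \<open>The image of a representation by operators \<open>R g\<close> on \<open>C\<close> that descend along \<open>q\<close>.\<close>

lemma lie_module:
  assumes R: "\<And>g x. g \<in> carrier L \<Longrightarrow> x \<in> C \<Longrightarrow> R g x \<in> C"
    "\<And>g x. g \<in> carrier L \<Longrightarrow> x \<in> C \<Longrightarrow> act g (q x) = q (R g x)"
    and add: "\<And>g x y. R g (x + y) = R g x + R g y"
    and scale: "\<And>g c x. R g (c *s x) = c *s R g x"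
    and L: "\<And>g h x. g \<in> carrier L \<Longrightarrow> h \<in> carrier L \<Longrightarrow> x \<in> C \<Longrightarrow> R (g \<oplus>\<^bsub>L\<^esub> h) x = R g x + R h x"
    "\<And>g c x. g \<in> carrier L \<Longrightarrow> x \<in> C \<Longrightarrow> R (c \<odot>\<^bsub>L\<^esub> g) x = c *s R g x"
    "\<And>g h x. g \<in> carrier L \<Longrightarrow> h \<in> carrier L \<Longrightarrow> x \<in> C \<Longrightarrow>
      R (lie_bracket L g h) x = R g (R h x) - R h (R g x)"
    and closed: "\<And>g h. g \<in> carrier L \<Longrightarrow> h \<in> carrier L \<Longrightarrow> g \<oplus>\<^bsub>L\<^esub> h \<in> carrier L"
    "\<And>g c. g \<in> carrier L \<Longrightarrow> c \<odot>\<^bsub>L\<^esub> g \<in> carrier L"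
    "\<And>g h. g \<in> carrier L \<Longrightarrow> h \<in> carrier L \<Longrightarrow> lie_bracket L g h \<in> carrier L"
  shows "lie_module L V act"
proof -
  interpret V: vectorspace class_ring V by (rule vectorspace)
  show ?thesis
    by standard
      (auto simp: carrier_eq R q_add q_scale q_minus C_add C_scale add scale L closed)
qed

context
  fixes K :: "'a set"
  assumes K: "K \<subseteq> C" "0 \<in> K" "\<And>x y. x \<in> K \<Longrightarrow> y \<in> K \<Longrightarrow> x + y \<in> K" "\<And>c x. x \<in> K \<Longrightarrow> c *s x \<in> K"
begin

definition coset :: "'a \<Rightarrow> 'v set" where
  "coset x = q ` K +>\<^bsub>V\<^esub> q x"

lemma coset_image: "x \<in> C \<Longrightarrow> coset x = (\<lambda>k. q (k + x)) ` K"
  using K(1) by (force simp: coset_def a_r_coset_def' q_add)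

lemma coset_eqI:
  assumes "x \<in> C" "y \<in> C" "x - y \<in> K"
  shows "coset x = coset y"
proof -
  have "coset a \<subseteq> coset b" if ab: "a \<in> C" "b \<in> C" "a - b \<in> K" for a b
  proof
    fix z assume "z \<in> coset a"
    then obtain k where k: "k \<in> K" "z = q (k + a)" using ab(1) by (auto simp: coset_image)
    have "k + (a - b) \<in> K" using k(1) ab(3) by (rule K(3))
    moreover have "z = q ((k + (a - b)) + b)" using k by simp
    ultimately show "z \<in> coset b" unfolding coset_image[OF ab(2)] by blast
  qed
  moreover have "y - x \<in> K"
    using K(4)[OF assms(3), of "-1"] by simp
  ultimately show ?thesis
    using assms by blast
qed

lemma coset_eq_zeroD:
  assumes "x \<in> C" "inj_on q C" "coset x = coset 0"
  shows "x \<in> K"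
proof -
  have "q x \<in> coset x"
    using assms(1) K(2) by (force simp: coset_image)
  then obtain k where "k \<in> K" "q x = q k"
    using assms(3) C_zero by (auto simp: coset_image)
  then show ?thesis
    using assms(1,2) K(1) by (metis inj_onD subsetD)
qed

text \<open>The unions over representatives in the quotient are single cosets when the map respects \<open>K\<close>.\<close>

lemma Union_coset:
  assumes "x \<in> C" "\<And>y. y \<in> C \<Longrightarrow> f (q y) = q (g y)" "\<And>y. y \<in> C \<Longrightarrow> g y \<in> C"
    "\<And>k. k \<in> K \<Longrightarrow> g (k + x) - g x \<in> K"
  shows "(\<Union>v\<in>coset x. q ` K +>\<^bsub>V\<^esub> f v) = coset (g x)"
proof -
  have "q ` K +>\<^bsub>V\<^esub> f (q (k + x)) = coset (g x)" if "k \<in> K" for k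
  proof -
    have kx: "k + x \<in> C" using that K(1) assms(1) C_add by blast
    then have "q ` K +>\<^bsub>V\<^esub> f (q (k + x)) = coset (g (k + x))"
      by (simp add: assms(2) coset_def)
    also have "\<dots> = coset (g x)"
      using kx that assms by (intro coset_eqI) auto
    finally show ?thesis .
  qed
  then show ?thesis
    using K(2) assms(1) by (auto simp: coset_image)
qed

lemma quotient_presentation: "presentation scale C (quotient_space V (q ` K)) coset"
proof
  show "carrier (quotient_space V (q ` K)) = coset ` C"
    by (auto simp: quotient_space_def A_RCOSETS_def' coset_def carrier_eq)
  show "coset x \<oplus>\<^bsub>quotient_space V (q ` K)\<^esub> coset y = coset (x + y)" if xy: "x \<in> C" "y \<in> C" for x y
  proof -
    have "coset x <+>\<^bsub>V\<^esub> coset y = coset (x + y)"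
    proof
      show "coset x <+>\<^bsub>V\<^esub> coset y \<subseteq> coset (x + y)"
      proof
        fix z assume "z \<in> coset x <+>\<^bsub>V\<^esub> coset y"
        then obtain k l where kl: "k \<in> K" "l \<in> K" "z = q (k + x) \<oplus>\<^bsub>V\<^esub> q (l + y)"
          using xy by (auto simp: set_add_def' coset_image)
        then have "z = q ((k + l) + (x + y))"
          using xy K(1) C_add by (subst kl(3), subst q_add) (auto simp: algebra_simps)
        then show "z \<in> coset (x + y)"
          using xy kl K(3) C_add by (auto simp: coset_image)
      qed
      show "coset (x + y) \<subseteq> coset x <+>\<^bsub>V\<^esub> coset y"
      proof
        fix z assume "z \<in> coset (x + y)"
        then obtain k where k: "k \<in> K" "z = q (k + (x + y))"
          using xy C_add by (auto simp: coset_image)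
        then have "z = q (k + x) \<oplus>\<^bsub>V\<^esub> q (0 + y)"
          using xy K(1) C_add by (subst q_add) (auto simp: algebra_simps)
        then show "z \<in> coset x <+>\<^bsub>V\<^esub> coset y"
          using xy k K(2) unfolding set_add_def' by (force simp: coset_image)
      qed
    qed
    then show ?thesis
      by (simp add: quotient_space_def)
  qed
  show "c \<odot>\<^bsub>quotient_space V (q ` K)\<^esub> coset x = coset (c *s x)" if "x \<in> C" for c x
  proof -
    have "(\<Union>v\<in>coset x. q ` K +>\<^bsub>V\<^esub> (c \<odot>\<^bsub>V\<^esub> v)) = coset (c *s x)"
      using that by (intro Union_coset) (auto simp: q_scale C_scale scale_right_distrib K)
    then show ?thesis
      by (simp add: quotient_space_def)
  qed
  show "\<zero>\<^bsub>quotient_space V (q ` K)\<^esub> = coset 0"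
    by (simp add: quotient_space_def coset_image C_zero)
qed (auto intro: C_zero C_add C_scale)

lemma quotient_act_coset:
  assumes "x \<in> C" "\<And>y. y \<in> C \<Longrightarrow> act g (q y) = q (R y)" "\<And>y. y \<in> C \<Longrightarrow> R y \<in> C"
    "\<And>k. k \<in> K \<Longrightarrow> R k \<in> K" "\<And>x y. R (x + y) = R x + R y"
  shows "quotient_act V (q ` K) act g (coset x) = coset (R x)"
  unfolding quotient_act_def using assms by (intro Union_coset) auto

end

end

section \<open>The Lie algebras of matrices and the embedding\<close>

lemma sl_simps [simp]:
  "carrier (sl m) = {X \<in> carrier_mat m m. (\<Sum>i<m. X $$ (i, i)) = 0}"
  "X \<oplus>\<^bsub>sl m\<^esub> Y = X + Y" "c \<odot>\<^bsub>sl m\<^esub> X = c \<cdot>\<^sub>m X" "lie_bracket (sl m) X Y = X * Y - Y * X"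
  by (simp_all add: sl_def)

lemma mult_entry:
  assumes "X \<in> carrier_mat m m" "Y \<in> carrier_mat m m" "i < m" "j < m"
  shows "(X * Y) $$ (i, j) = (\<Sum>k<m. X $$ (i, k) * Y $$ (k, j))"
  using assms by (auto simp: scalar_prod_def lessThan_atLeast0)

lemma sl_closed:
  assumes "X \<in> carrier (sl m)" "Y \<in> carrier (sl m)"
  shows "X + Y \<in> carrier (sl m)" "c \<cdot>\<^sub>m X \<in> carrier (sl m)" "X * Y - Y * X \<in> carrier (sl m)"
proof -
  have XY: "X \<in> carrier_mat m m" "Y \<in> carrier_mat m m" "(\<Sum>i<m. X $$ (i, i)) = 0" "(\<Sum>i<m. Y $$ (i, i)) = 0"
    using assms by auto
  show "X + Y \<in> carrier (sl m)"
    using XY by (auto simp: sum.distrib)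
  show "c \<cdot>\<^sub>m X \<in> carrier (sl m)"
    using XY by (auto simp flip: sum_distrib_left)
  have "(\<Sum>i<m. (X * Y - Y * X) $$ (i, i)) =
      (\<Sum>i<m. \<Sum>k<m. X $$ (i, k) * Y $$ (k, i)) - (\<Sum>i<m. \<Sum>k<m. Y $$ (i, k) * X $$ (k, i))"
    using XY mult_entry[OF XY(1,2)] mult_entry[OF XY(2,1)]
    by (simp add: sum_subtractf del: index_mult_mat(1))
  also have "(\<Sum>i<m. \<Sum>k<m. Y $$ (i, k) * X $$ (k, i)) = (\<Sum>i<m. \<Sum>k<m. X $$ (i, k) * Y $$ (k, i))"
    by (subst sum.swap) (simp add: mult.commute)
  finally show "X * Y - Y * X \<in> carrier (sl m)"
    using XY by auto
qed

lemma mat_unit_sl: "a \<noteq> b \<Longrightarrow> mat_unit m a b \<in> carrier (sl m)"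
  by (auto simp: mat_unit_def intro!: sum.neutral)

lemma semidirect_simps [simp]:
  "carrier (sl_semidirect n) = carrier (sl (n + 1)) \<times> carrier_vec (n + 1)"
  "(X, p) \<oplus>\<^bsub>sl_semidirect n\<^esub> (Y, r) = (X + Y, p + r)"
  "c \<odot>\<^bsub>sl_semidirect n\<^esub> (X, p) = (c \<cdot>\<^sub>m X, c \<cdot>\<^sub>v p)"
  "lie_bracket (sl_semidirect n) (X, p) (Y, r) = (X * Y - Y * X, X *\<^sub>v r - Y *\<^sub>v p)"
  by (simp_all add: sl_semidirect_def)

lemma semidirect_closed:
  assumes "g \<in> carrier (sl_semidirect n)" "h \<in> carrier (sl_semidirect n)"
  shows "g \<oplus>\<^bsub>sl_semidirect n\<^esub> h \<in> carrier (sl_semidirect n)"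
    "c \<odot>\<^bsub>sl_semidirect n\<^esub> g \<in> carrier (sl_semidirect n)"
    "lie_bracket (sl_semidirect n) g h \<in> carrier (sl_semidirect n)"
proof -
  obtain X p Y r where gh: "g = (X, p)" "h = (Y, r)" by fastforce
  have X: "X \<in> carrier (sl (n + 1))" "Y \<in> carrier (sl (n + 1))"
    and p: "p \<in> carrier_vec (n + 1)" "r \<in> carrier_vec (n + 1)"
    using assms by (simp_all add: gh del: sl_simps)
  have "X *\<^sub>v r - Y *\<^sub>v p \<in> carrier_vec (n + 1)"
    using X p by auto
  then show "g \<oplus>\<^bsub>sl_semidirect n\<^esub> h \<in> carrier (sl_semidirect n)"
    "c \<odot>\<^bsub>sl_semidirect n\<^esub> g \<in> carrier (sl_semidirect n)"
    "lie_bracket (sl_semidirect n) g h \<in> carrier (sl_semidirect n)"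
    using sl_closed[OF X] p by (simp_all add: gh del: sl_simps)
qed

lemma Phi_carrier: "Phi n g \<in> carrier_mat (n + 2) (n + 2)"
  by (cases g) (simp add: Phi_def)

lemma Phi_dim [simp]: "dim_row (Phi n g) = n + 2" "dim_col (Phi n g) = n + 2"
  by (cases g; simp add: Phi_def)+

lemma Phi_entry:
  "r < n + 2 \<Longrightarrow> c < n + 2 \<Longrightarrow> Phi n (X, p) $$ (r, c) =
    (if r = 0 then 0 else if c = 0 then p $ (r - 1) else X $$ (r - 1, c - 1))"
  by (simp add: Phi_def)

text \<open>A product of two matrices with zero top row depends on their first columns and lower right blocks as in the
  semidirect sum.\<close>

lemma Phi_hom:
  assumes "g \<in> carrier (sl_semidirect n)" "h \<in> carrier (sl_semidirect n)"
  shows "Phi n (g \<oplus>\<^bsub>sl_semidirect n\<^esub> h) = Phi n g + Phi n h"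
    "Phi n (c \<odot>\<^bsub>sl_semidirect n\<^esub> g) = c \<cdot>\<^sub>m Phi n g"
    "Phi n (lie_bracket (sl_semidirect n) g h) = Phi n g * Phi n h - Phi n h * Phi n g"
proof -
  obtain X p Y r where gh: "g = (X, p)" "h = (Y, r)" by fastforce
  have X: "X \<in> carrier_mat (n + 1) (n + 1)" "Y \<in> carrier_mat (n + 1) (n + 1)"
    and p: "p \<in> carrier_vec (n + 1)" "r \<in> carrier_vec (n + 1)"
    using assms by (simp_all add: gh)
  show "Phi n (g \<oplus>\<^bsub>sl_semidirect n\<^esub> h) = Phi n g + Phi n h"
    using X p by (intro eq_matI) (auto simp: gh Phi_def)
  show "Phi n (c \<odot>\<^bsub>sl_semidirect n\<^esub> g) = c \<cdot>\<^sub>m Phi n g"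
    using X p by (intro eq_matI) (auto simp: gh Phi_def)
  have prod: "(Phi n (X, p) * Phi n (Y, r)) $$ (i, j) =
      (if i = 0 then 0 else if j = 0 then (X *\<^sub>v r) $ (i - 1) else (X * Y) $$ (i - 1, j - 1))"
    if "i < n + 2" "j < n + 2" "X \<in> carrier_mat (n + 1) (n + 1)" "Y \<in> carrier_mat (n + 1) (n + 1)"
      "p \<in> carrier_vec (n + 1)" "r \<in> carrier_vec (n + 1)" for X Y p r i j
  proof -
    have "(Phi n (X, p) * Phi n (Y, r)) $$ (i, j) =
        (\<Sum>k<n + 2. Phi n (X, p) $$ (i, k) * Phi n (Y, r) $$ (k, j))"
      using that Phi_carrier by (intro mult_entry) auto
    also have "\<dots> = (\<Sum>k<n + 1. Phi n (X, p) $$ (i, Suc k) * Phi n (Y, r) $$ (Suc k, j))"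
      using that by (simp add: sum.lessThan_Suc_shift Phi_entry del: sum.lessThan_Suc)
    also have "\<dots> = (if i = 0 then 0 else if j = 0 then (X *\<^sub>v r) $ (i - 1) else (X * Y) $$ (i - 1, j - 1))"
    proof (cases "i = 0")
      case True
      then show ?thesis by (simp add: Phi_entry)
    next
      case False
      show ?thesis
      proof (cases "j = 0")
        case True
        then show ?thesis
          using False that by (simp add: Phi_entry scalar_prod_def lessThan_atLeast0 del: sum.lessThan_Suc sum.op_ivl_Suc)
      next
        case j: False
        have "(X * Y) $$ (i - 1, j - 1) = (\<Sum>k<n + 1. X $$ (i - 1, k) * Y $$ (k, j - 1))"
          using False j that by (intro mult_entry) auto
        then show ?thesis
          using False j that by (simp add: Phi_entry del: sum.lessThan_Suc index_mult_mat(1))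
      qed
    qed
    finally show ?thesis .
  qed
  show "Phi n (lie_bracket (sl_semidirect n) g h) = Phi n g * Phi n h - Phi n h * Phi n g"
  proof (rule eq_matI)
    fix i j assume "i < dim_row (Phi n g * Phi n h - Phi n h * Phi n g)"
      "j < dim_col (Phi n g * Phi n h - Phi n h * Phi n g)"
    then have ij: "i < n + 2" "j < n + 2"
      by simp_all
    have "(Phi n g * Phi n h - Phi n h * Phi n g) $$ (i, j) =
        (Phi n g * Phi n h) $$ (i, j) - (Phi n h * Phi n g) $$ (i, j)"
      using ij by (simp del: index_mult_mat(1))
    moreover have "(if i = 0 then 0 else if j = 0 then (X *\<^sub>v r - Y *\<^sub>v p) $ (i - 1)
        else (X * Y - Y * X) $$ (i - 1, j - 1)) =
      (if i = 0 then 0 else if j = 0 then (X *\<^sub>v r) $ (i - 1) else (X * Y) $$ (i - 1, j - 1)) -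
      (if i = 0 then 0 else if j = 0 then (Y *\<^sub>v p) $ (i - 1) else (Y * X) $$ (i - 1, j - 1))"
      using ij X by (auto simp del: index_mult_mat(1) index_mult_mat_vec)
    ultimately show "Phi n (lie_bracket (sl_semidirect n) g h) $$ (i, j) =
        (Phi n g * Phi n h - Phi n h * Phi n g) $$ (i, j)"
      using prod[OF ij X p] prod[OF ij X(2,1) p(2,1)] ij
      by (simp add: gh Phi_entry del: index_mult_mat(1) index_mult_mat_vec)
  qed simp_all
qed

context gl_module
begin

definition rep :: "complex mat \<Rightarrow> 'a \<Rightarrow> 'a" where
  "rep X x = (\<Sum>a<m. \<Sum>b<m. X $$ (a, b) *s T a b x)"

lemma rep_add: "rep X (x + y) = rep X x + rep X y"
  by (simp add: rep_def T_add scale_right_distrib sum.distrib)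

lemma rep_scale: "rep X (c *s x) = c *s rep X x"
  by (simp add: rep_def T_scale scale_sum_right mult.commute)

lemma rep_plus:
  "X \<in> carrier_mat m m \<Longrightarrow> Y \<in> carrier_mat m m \<Longrightarrow> rep (X + Y) x = rep X x + rep Y x"
  by (simp add: rep_def scale_left_distrib sum.distrib)

lemma rep_minus:
  "X \<in> carrier_mat m m \<Longrightarrow> Y \<in> carrier_mat m m \<Longrightarrow> rep (X - Y) x = rep X x - rep Y x"
  by (simp add: rep_def scale_left_diff_distrib sum_subtractf)

lemma rep_smult: "X \<in> carrier_mat m m \<Longrightarrow> rep (c \<cdot>\<^sub>m X) x = c *s rep X x"
  by (simp add: rep_def scale_sum_right)

lemma rep_unit:
  assumes "a < m" "b < m"
  shows "rep (mat_unit m (Suc a) (Suc b)) x = T a b x"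
proof -
  have "rep (mat_unit m (Suc a) (Suc b)) x =
      (\<Sum>a'<m. \<Sum>b'<m. if b' = b then (if a' = a then T a b x else 0) else 0)"
    unfolding rep_def by (intro sum.cong refl) (auto simp: mat_unit_def)
  also have "\<dots> = T a b x"
    using assms by (simp add: sum.delta)
  finally show ?thesis .
qed

lemma rep_mult:
  assumes "X \<in> carrier_mat m m" "Y \<in> carrier_mat m m"
  shows "(\<Sum>a<m. \<Sum>b<m. \<Sum>p<m. \<Sum>q<m. (X $$ (a, b) * Y $$ (p, q)) *s (if b = p then T a q x else 0)) =
    rep (X * Y) x"
proof -
  have "(\<Sum>p<m. \<Sum>q<m. (X $$ (a, b) * Y $$ (p, q)) *s (if b = p then T a q x else 0)) =
      (\<Sum>q<m. (X $$ (a, b) * Y $$ (b, q)) *s T a q x)" if "b < m" for a b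
  proof -
    have "(\<Sum>p<m. \<Sum>q<m. (X $$ (a, b) * Y $$ (p, q)) *s (if b = p then T a q x else 0)) =
        (\<Sum>p<m. if p = b then (\<Sum>q<m. (X $$ (a, b) * Y $$ (b, q)) *s T a q x) else 0)"
      by (intro sum.cong refl) auto
    then show ?thesis using that by simp
  qed
  then have "(\<Sum>a<m. \<Sum>b<m. \<Sum>p<m. \<Sum>q<m. (X $$ (a, b) * Y $$ (p, q)) *s (if b = p then T a q x else 0)) =
      (\<Sum>a<m. \<Sum>b<m. \<Sum>q<m. (X $$ (a, b) * Y $$ (b, q)) *s T a q x)"
    by - (rule sum.cong[OF refl], rule sum.cong[OF refl], simp)
  also have "\<dots> = (\<Sum>a<m. \<Sum>q<m. (\<Sum>b<m. X $$ (a, b) * Y $$ (b, q)) *s T a q x)"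
    by (rule sum.cong[OF refl], rule trans[OF sum.swap]) (simp add: scale_sum_left)
  also have "\<dots> = rep (X * Y) x"
    unfolding rep_def using mult_entry[OF assms] by (intro sum.cong refl) simp
  finally show ?thesis .
qed

lemma rep_rep: "rep X (rep Y x) =
    (\<Sum>a<m. \<Sum>b<m. \<Sum>p<m. \<Sum>q<m. (X $$ (a, b) * Y $$ (p, q)) *s T a b (T p q x))"
  by (simp add: rep_def T_sum T_scale scale_sum_right)

lemma sum3_swap:
  fixes h :: "nat \<Rightarrow> nat \<Rightarrow> nat \<Rightarrow> 'a"
  shows "(\<Sum>q<m. \<Sum>a<m. \<Sum>b<m. h a b q) = (\<Sum>a<m. \<Sum>b<m. \<Sum>q<m. h a b q)"
  by (rule trans[OF sum.swap], rule sum.cong[OF refl], rule sum.swap)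

lemma sum4_swap:
  fixes g :: "nat \<Rightarrow> nat \<Rightarrow> nat \<Rightarrow> nat \<Rightarrow> 'a"
  shows "(\<Sum>p<m. \<Sum>q<m. \<Sum>a<m. \<Sum>b<m. g a b p q) = (\<Sum>a<m. \<Sum>b<m. \<Sum>p<m. \<Sum>q<m. g a b p q)"
proof -
  have "(\<Sum>p<m. \<Sum>q<m. \<Sum>a<m. \<Sum>b<m. g a b p q) = (\<Sum>p<m. \<Sum>a<m. \<Sum>b<m. \<Sum>q<m. g a b p q)"
    by (rule sum.cong[OF refl], rule sum3_swap)
  also have "\<dots> = (\<Sum>a<m. \<Sum>b<m. \<Sum>p<m. \<Sum>q<m. g a b p q)"
    by (rule sum3_swap)
  finally show ?thesis .
qed

text \<open>Expanding both sides in matrix units reduces the claim to the commutators of the \<open>T a b\<close>.\<close>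

lemma rep_bracket:
  assumes XY: "X \<in> carrier_mat m m" "Y \<in> carrier_mat m m"
  shows "rep (X * Y - Y * X) x = rep X (rep Y x) - rep Y (rep X x)"
proof -
  define g where "g a b p q = X $$ (a, b) * Y $$ (p, q)" for a b p q
  have "rep Y (rep X x) = (\<Sum>p<m. \<Sum>q<m. \<Sum>a<m. \<Sum>b<m. g a b p q *s T p q (T a b x))"
    by (simp add: rep_rep g_def mult.commute)
  also have "\<dots> = (\<Sum>a<m. \<Sum>b<m. \<Sum>p<m. \<Sum>q<m. g a b p q *s T p q (T a b x))"
    by (rule sum4_swap)
  finally have YX: "rep Y (rep X x) = \<dots>" .
  have "rep X (rep Y x) = (\<Sum>a<m. \<Sum>b<m. \<Sum>p<m. \<Sum>q<m. g a b p q *s T p q (T a b x) +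
      g a b p q *s (if b = p then T a q x else 0) - g a b p q *s (if a = q then T p b x else 0))"
    unfolding rep_rep g_def
  proof (intro sum.cong refl)
    fix a b p q assume "a \<in> {..<m}" "b \<in> {..<m}" "p \<in> {..<m}" "q \<in> {..<m}"
    then show "(X $$ (a, b) * Y $$ (p, q)) *s T a b (T p q x) =
        (X $$ (a, b) * Y $$ (p, q)) *s T p q (T a b x) +
        (X $$ (a, b) * Y $$ (p, q)) *s (if b = p then T a q x else 0) -
        (X $$ (a, b) * Y $$ (p, q)) *s (if a = q then T p b x else 0)"
      by (subst T_bracket) (auto simp: scale_right_distrib scale_right_diff_distrib)
  qed
  also have "\<dots> = rep Y (rep X x) +
      (\<Sum>a<m. \<Sum>b<m. \<Sum>p<m. \<Sum>q<m. g a b p q *s (if b = p then T a q x else 0)) -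
      (\<Sum>a<m. \<Sum>b<m. \<Sum>p<m. \<Sum>q<m. g a b p q *s (if a = q then T p b x else 0))"
    by (simp only: YX sum.distrib sum_subtractf)
  also have "(\<Sum>a<m. \<Sum>b<m. \<Sum>p<m. \<Sum>q<m. g a b p q *s (if b = p then T a q x else 0)) = rep (X * Y) x"
    unfolding g_def by (rule rep_mult[OF XY])
  also have "(\<Sum>a<m. \<Sum>b<m. \<Sum>p<m. \<Sum>q<m. g a b p q *s (if a = q then T p b x else 0)) =
      (\<Sum>p<m. \<Sum>q<m. \<Sum>a<m. \<Sum>b<m. g a b p q *s (if a = q then T p b x else 0))"
    by (rule sum4_swap[symmetric])
  also have "\<dots> = (\<Sum>p<m. \<Sum>q<m. \<Sum>a<m. \<Sum>b<m. (Y $$ (p, q) * X $$ (a, b)) *s (if q = a then T p b x else 0))"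
    by (intro sum.cong refl) (auto simp: g_def mult.commute)
  also have "\<dots> = rep (Y * X) x"
    by (rule rep_mult[OF XY(2,1)])
  finally show ?thesis
    using XY by (simp add: rep_minus)
qed

lemma rep_closed:
  assumes "\<And>a b. a < m \<Longrightarrow> b < m \<Longrightarrow> X $$ (a, b) \<noteq> 0 \<Longrightarrow> (a, b) \<in> N" "x \<in> gen_span N B"
  shows "rep X x \<in> gen_span N B"
  unfolding rep_def
proof (intro gen_span_sum)
  fix a b assume "a \<in> {..<m}" "b \<in> {..<m}"
  then show "X $$ (a, b) *s T a b x \<in> gen_span N B"
    using assms by (cases "X $$ (a, b) = 0") (auto intro: gen_span.intros)
qed

end

section \<open>The irreducible module in coordinates\<close>

text \<open>Coordinates identify \<open>A\<close> with a space of column vectors.\<close>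

locale realized_family = extremal_family +
  fixes n :: nat and N :: nat and coords :: "'a \<Rightarrow> complex vec" and G :: "'a set"
  assumes m_eq: "n + 2 = m"
    and coords_dim: "coords x \<in> carrier_vec N"
    and coords_add: "coords (x + y) = coords x + coords y"
    and coords_scale: "coords (c *s x) = c \<cdot>\<^sub>v coords x"
    and coords_inj: "inj_on coords A"
    and G_finite: "finite G" and G_spans: "A \<subseteq> span G"
begin

definition U :: "'a set" where
  "U = gen_span all_units {v}"

definition U_mod :: "(complex, complex vec) module" where
  "U_mod = (module_vec TYPE(complex) N)\<lparr>carrier := coords ` U\<rparr>"

definition U_act :: "complex mat \<Rightarrow> complex vec \<Rightarrow> complex vec" where
  "U_act X u = coords (rep X (the_inv_into U coords u))"

lemma U_A: "U \<subseteq> A"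
  unfolding U_def using gen_span_in_A v_in_A .

lemma coords_inj_U: "inj_on coords U"
  using coords_inj U_A inj_on_subset by blast

lemma coords_0: "coords 0 = 0\<^sub>v N"
proof -
  have "coords 0 = 0 \<cdot>\<^sub>v coords 0"
    using coords_scale[of 0 0] by simp
  also have "\<dots> = 0\<^sub>v N"
    using coords_dim[of 0] by (intro eq_vecI) auto
  finally show ?thesis .
qed

lemma U_presentation: "presentation scale U U_mod coords"
proof
  show "\<zero>\<^bsub>U_mod\<^esub> = coords 0"
    by (simp add: U_mod_def module_vec_simps coords_0)
qed (auto simp: U_mod_def module_vec_simps coords_add coords_scale U_def
    intro: gen_span_zero gen_span_add gen_span_scale)

sublocale U: presentation scale U U_mod coords
  by (rule U_presentation)

lemma rep_U: "x \<in> U \<Longrightarrow> rep X x \<in> U"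
  unfolding U_def by (rule rep_closed) auto

lemma U_act_coords: "x \<in> U \<Longrightarrow> U_act X (coords x) = coords (rep X x)"
  by (simp add: U_act_def the_inv_into_f_f[OF coords_inj_U])

lemma U_lie_module: "lie_module (sl m) U_mod U_act"
proof (rule U.lie_module[where R = rep])
  show "rep (X \<oplus>\<^bsub>sl m\<^esub> Y) x = rep X x + rep Y x"
    if "X \<in> carrier (sl m)" "Y \<in> carrier (sl m)" for X Y x
    using that by (simp add: rep_plus)
  show "rep (c \<odot>\<^bsub>sl m\<^esub> X) x = c *s rep X x" if "X \<in> carrier (sl m)" for c X x
    using that by (simp add: rep_smult)
  show "rep (lie_bracket (sl m) X Y) x = rep X (rep Y x) - rep Y (rep X x)"
    if "X \<in> carrier (sl m)" "Y \<in> carrier (sl m)" for X Y x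
    using that by (simp add: rep_bracket)
  show "X \<oplus>\<^bsub>sl m\<^esub> Y \<in> carrier (sl m)" "lie_bracket (sl m) X Y \<in> carrier (sl m)"
    if "X \<in> carrier (sl m)" "Y \<in> carrier (sl m)" for X Y
    using sl_closed[OF that] by (simp_all only: sl_simps(2,4))
  show "c \<odot>\<^bsub>sl m\<^esub> X \<in> carrier (sl m)" if "X \<in> carrier (sl m)" for c X
    using sl_closed(2)[OF that that] by (simp only: sl_simps(3))
qed (simp_all add: rep_U U_act_coords rep_add rep_scale)

lemma span_U: "U \<subseteq> span G"
  using U_A G_spans by blast

lemma U_fin_dim: "fin_dim_lie_module (sl m) U_mod U_act"
  using U_lie_module U.fin_dim[OF G_finite span_U] by (simp add: fin_dim_lie_module_def)

lemma subspace_preimage: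
  assumes S: "VectorSpace.subspace class_ring S U_mod"
  shows "S = coords ` {x \<in> U. coords x \<in> S}" "0 \<in> {x \<in> U. coords x \<in> S}"
    "\<And>x y. x \<in> {x \<in> U. coords x \<in> S} \<Longrightarrow> y \<in> {x \<in> U. coords x \<in> S} \<Longrightarrow> x + y \<in> {x \<in> U. coords x \<in> S}"
    "\<And>c x. x \<in> {x \<in> U. coords x \<in> S} \<Longrightarrow> c *s x \<in> {x \<in> U. coords x \<in> S}"
proof -
  interpret S: LinearCombinations.submodule class_ring S U_mod
    using S by (simp add: VectorSpace.subspace_def)
  show "S = coords ` {x \<in> U. coords x \<in> S}"
    using S.subset by (auto simp: U.carrier_eq)
  show "0 \<in> {x \<in> U. coords x \<in> S}"
    using S.zero_closed by (simp add: U.q_zero U.C_zero)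
  show "x + y \<in> {x \<in> U. coords x \<in> S}"
    if "x \<in> {x \<in> U. coords x \<in> S}" "y \<in> {x \<in> U. coords x \<in> S}" for x y
    using that S.m_closed[of "coords x" "coords y"] by (simp add: U.q_add U.C_add)
  show "c *s x \<in> {x \<in> U. coords x \<in> S}" if "x \<in> {x \<in> U. coords x \<in> S}" for c x
    using that S.smult_closed[of c "coords x"] by (simp add: U.q_scale U.C_scale)
qed

lemma subspace_image:
  assumes "K \<subseteq> U" "0 \<in> K" "\<And>x y. x \<in> K \<Longrightarrow> y \<in> K \<Longrightarrow> x + y \<in> K" "\<And>c x. x \<in> K \<Longrightarrow> c *s x \<in> K"
  shows "VectorSpace.subspace class_ring (coords ` K) U_mod"
proof -
  have "LinearCombinations.submodule class_ring (coords ` K) U_mod"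
  proof (rule LinearCombinations.submodule.intro)
    show "Module.module class_ring U_mod"
      using U.vectorspace by (simp add: vectorspace_def)
    show "coords ` K \<subseteq> carrier U_mod"
      using assms(1) by (auto simp: U.carrier_eq)
    show "\<zero>\<^bsub>U_mod\<^esub> \<in> coords ` K"
      using assms(2) by (simp add: U.q_zero)
    show "x \<oplus>\<^bsub>U_mod\<^esub> y \<in> coords ` K" if "x \<in> coords ` K" "y \<in> coords ` K" for x y
      using that assms(1,3) by (auto simp: U.q_add subset_iff)
    show "c \<odot>\<^bsub>U_mod\<^esub> x \<in> coords ` K" if "x \<in> coords ` K" for c x
      using that assms(1,4) by (auto simp: U.q_scale subset_iff)
  qed
  then show ?thesis
    using U.vectorspace by (simp add: VectorSpace.subspace_def)
qed

lemma v_in_U: "v \<in> U"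
  unfolding U_def by (simp add: gen_span_base)

text \<open>The preimage of a submodule under the coordinate map is stable under the \<open>T a b\<close> with \<open>a \<noteq> b\<close>, whose
  matrix units have trace zero.\<close>

lemma U_irreducible: "irreducible_lie_module (sl m) U_mod U_act"
  unfolding irreducible_lie_module_def
proof (intro conjI allI impI)
  show "lie_module (sl m) U_mod U_act" by (rule U_lie_module)
  show "carrier U_mod \<noteq> {\<zero>\<^bsub>U_mod\<^esub>}"
  proof
    assume "carrier U_mod = {\<zero>\<^bsub>U_mod\<^esub>}"
    then have "coords v = coords 0"
      using v_in_U by (auto simp: U.carrier_eq U.q_zero)
    then show False
      using v_nonzero v_in_U U.C_zero inj_onD[OF coords_inj_U] by blast
  qed
next
  fix S assume S: "lie_submodule (sl m) U_mod U_act S"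
  let ?K = "{x \<in> U. coords x \<in> S}"
  have sub: "VectorSpace.subspace class_ring S U_mod"
    and act: "\<And>X u. X \<in> carrier (sl m) \<Longrightarrow> u \<in> S \<Longrightarrow> U_act X u \<in> S"
    using S by (auto simp: lie_submodule_def)
  note K = subspace_preimage[OF sub]
  have units: "T a b x \<in> ?K" if "a \<noteq> b" "a < m" "b < m" "x \<in> ?K" for a b x
  proof -
    have x: "x \<in> U" "coords x \<in> S"
      using that(4) by auto
    have "U_act (mat_unit m (Suc a) (Suc b)) (coords x) \<in> S"
      using that(1) x(2) by (intro act mat_unit_sl) auto
    then have "coords (T a b x) \<in> S"
      unfolding U_act_coords[OF x(1)] rep_unit[OF that(2,3)] .
    moreover have "T a b x \<in> U"
      using rep_U[OF x(1)] rep_unit[OF that(2,3)] by metis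
    ultimately show ?thesis by blast
  qed
  show "S = {\<zero>\<^bsub>U_mod\<^esub>} \<or> S = carrier U_mod"
  proof (cases "?K = {0}")
    case True
    then show ?thesis
      using K(1) by (simp add: U.q_zero)
  next
    case False
    have "?K = U"
      unfolding U_def
      by (rule gen_span_irreducible[OF v_in_A v_nonzero v_weight v_highest])
        (use K False units in \<open>auto simp: U_def\<close>)
    then show ?thesis
      using K(1) by (simp add: U.carrier_eq)
  qed
qed

lemma mat_unit_carrier: "mat_unit k a b \<in> carrier_mat k k"
  by (simp add: mat_unit_def)

lemma rep_H:
  assumes "1 \<le> i" "i \<le> n + 1"
  shows "rep (H_el (n + 1) i) x = T (i - 1) (i - 1) x - T i i x"
proof -
  have i: "i - 1 < m" "i < m" using assms m_eq by linarith+
  have "H_el (n + 1) i = mat_unit m (Suc (i - 1)) (Suc (i - 1)) - mat_unit m (Suc i) (Suc i)"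
    using assms by (simp add: H_el_def flip: m_eq)
  then show ?thesis
    using rep_unit[OF i(1,1)] rep_unit[OF i(2,2)] by (simp only: rep_minus mat_unit_carrier)
qed

lemma U_highest:
  assumes "\<And>i. i \<in> {1..n + 1} \<Longrightarrow> L i = int (\<Lambda> i)"
  shows "highest_weight_vector (n + 1) U_mod U_act L (coords v)"
  unfolding highest_weight_vector_def
proof (intro conjI ballI allI impI)
  show "coords v \<in> carrier U_mod"
    using v_in_U by (simp add: U.carrier_eq)
  show "coords v \<noteq> \<zero>\<^bsub>U_mod\<^esub>"
    using v_nonzero v_in_U U.C_zero inj_onD[OF coords_inj_U] by (auto simp: U.q_zero)
  fix i assume i: "i \<in> {1..n + 1}"
  then have im: "1 \<le> i" "i \<le> n + 1" "i - 1 < m" "i < m" using m_eq by auto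
  have "rep (H_el (n + 1) i) v = of_int (w\<^sub>0 (i - 1) - w\<^sub>0 i) *s v"
    using im(3,4) v_weight rep_H[OF im(1,2), of v]
    by (simp add: weight_vector_def scale_left_diff_distrib)
  also have "w\<^sub>0 (i - 1) - w\<^sub>0 i = L i"
    using w\<^sub>0_diff[of i] im assms[OF i] by simp
  finally show "U_act (H_el (n + 1) i) (coords v) = of_int (L i) \<odot>\<^bsub>U_mod\<^esub> coords v"
    using v_in_U by (simp add: U_act_coords U.q_scale)
next
  fix p r assume pr: "1 \<le> p \<and> p \<le> r \<and> r \<le> n + 1"
  then have im: "p - 1 < r" "p - 1 < m" "r < m" using m_eq by linarith+
  have "E_el (n + 1) p r = mat_unit m (Suc (p - 1)) (Suc r)"
    using pr by (simp add: E_el_def flip: m_eq)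
  then have "rep (E_el (n + 1) p r) v = 0"
    using v_highest rep_unit[OF im(2,3), of v] im by (simp add: highest_in_def)
  then show "U_act (E_el (n + 1) p r) (coords v) = \<zero>\<^bsub>U_mod\<^esub>"
    using v_in_U by (simp add: U_act_coords U.q_zero)
qed

lemma U_is_irreducible_of_highest_weight:
  assumes "\<And>i. i \<in> {1..n + 1} \<Longrightarrow> L i = int (\<Lambda> i)"
  shows "is_irreducible_of_highest_weight (n + 1) L U_mod U_act"
  using U_fin_dim U_irreducible U_highest[OF assms]
  unfolding is_irreducible_of_highest_weight_def by (auto simp flip: m_eq)

end

section \<open>The quotient attached to a family\<close>

definition prefix :: "(nat \<Rightarrow> nat) \<Rightarrow> nat \<Rightarrow> nat list" where
  "prefix j h = map j [1..<h + 1]"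

lemma length_prefix [simp]: "length (prefix j h) = h"
  by (simp add: prefix_def)

lemma prefix_0 [simp]: "prefix j 0 = []"
  by (simp add: prefix_def)

lemma prefix_Suc: "prefix j (Suc h) = prefix j h @ [j (Suc h)]"
  by (simp add: prefix_def)

lemma nth_prefix: "l < h \<Longrightarrow> prefix j h ! l = j (l + 1)"
  by (simp add: prefix_def del: upt_Suc)

lemma prefix_pad: "h \<le> length js \<Longrightarrow> prefix (pad js) h = take h js"
  by (rule nth_equalityI) (auto simp: nth_prefix pad_def)

lemma index_dom_Nil: "[] \<in> index_dom n M"
  by (simp add: index_dom_def)

lemma index_dom_snoc:
  "js @ [i] \<in> index_dom n M \<longleftrightarrow> js \<in> index_dom n M \<and> length js < n \<and> i < M js"
proof -
  have "(\<forall>h<Suc (length js). (js @ [i]) ! h < M (take h (js @ [i]))) \<longleftrightarrow>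
      (\<forall>h<length js. js ! h < M (take h js)) \<and> i < M js"
    by (auto simp: less_Suc_eq nth_append)
  then show ?thesis
    by (auto simp: index_dom_def)
qed

text \<open>The highest weight is fitted to the family: the bound on \<open>M\<^sub>k\<close> for \<open>k \<ge> 2\<close> is that of the box given by
  \<open>\<mu>\<close>, while the first fundamental weight, which is invisible to \<open>sl(n+1)\<close>, is used to
  accommodate \<open>M\<^sub>1\<close>.\<close>

locale target_family = realized_family +
  fixes \<mu> :: "nat \<Rightarrow> int" and M :: "nat list \<Rightarrow> nat"
  assumes coll: "(\<mu>, M) \<in> collection_M n"
    and \<Lambda>_first: "\<Lambda> 1 + 1 = M []"
    and \<Lambda>_rest: "1 \<le> i \<Longrightarrow> i \<le> n \<Longrightarrow> int (\<Lambda> (i + 1)) = \<mu> i"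
begin

lemma M_props:
  shows "js \<in> index_dom n M \<Longrightarrow> 1 \<le> M js"
    and "js \<in> index_dom n M \<Longrightarrow> js \<noteq> [] \<Longrightarrow> int (M js) \<le> \<mu> (length js) + 1"
    and "hs \<in> index_dom n M \<Longrightarrow> js \<in> index_dom n M \<Longrightarrow> list_all2 (\<le>) hs js \<Longrightarrow> M js \<le> M hs"
  using coll by (auto simp: collection_M_def)

text \<open>The admissible displacements: the bound on coordinate \<open>h + 1\<close> depends on the first \<open>h\<close> coordinates.\<close>

definition D :: "(nat \<Rightarrow> nat) set" where
  "D = {j. \<forall>h\<le>n. j (h + 1) < M (prefix j h)}"

lemma D_prefix: "j \<in> D \<Longrightarrow> h \<le> n \<Longrightarrow> prefix j h \<in> index_dom n M"
proof (induction h)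
  case (Suc h)
  then show ?case
    by (simp add: prefix_Suc index_dom_snoc D_def)
qed (simp add: index_dom_Nil)

text \<open>Going down in the first \<open>k - 1\<close> coordinates increases the bound on the next one, so admissibility is checked
  one coordinate after the other.\<close>

lemma D_down:
  assumes i: "i \<in> D" and le: "\<And>r. 1 \<le> r \<Longrightarrow> r < m \<Longrightarrow> j r \<le> i r"
  shows "j \<in> D"
proof -
  have step: "j (h + 1) < M (prefix j h)" if dom: "prefix j h \<in> index_dom n M" and h: "h \<le> n" for h
  proof -
    have "list_all2 (\<le>) (prefix j h) (prefix i h)"
      using le h m_eq by (auto simp: list_all2_conv_all_nth nth_prefix)
    then have "M (prefix i h) \<le> M (prefix j h)"
      by (rule M_props(3)[OF dom D_prefix[OF i h]])
    moreover have "i (h + 1) < M (prefix i h)"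
      using i h by (simp add: D_def)
    moreover have "j (h + 1) \<le> i (h + 1)"
      using le[of "h + 1"] h m_eq by linarith
    ultimately show ?thesis by linarith
  qed
  have "prefix j h \<in> index_dom n M" if "h \<le> n" for h
    using that
  proof (induction h)
    case (Suc h)
    then show ?case
      using step[of h] by (simp add: prefix_Suc index_dom_snoc)
  qed (simp add: index_dom_Nil)
  then show ?thesis
    using step by (simp add: D_def)
qed

lemma D_box:
  assumes "j \<in> D" "1 \<le> r" "r < m"
  shows "j r \<le> \<Lambda> r"
proof -
  define h where "h = r - 1"
  have h: "r = h + 1" "h \<le> n"
    using assms(2,3) m_eq by (simp_all add: h_def)
  have less: "j r < M (prefix j h)"
    using assms(1) h by (simp add: D_def)
  show ?thesis
  proof (cases h)
    case 0
    then show ?thesis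
      using less \<Lambda>_first h by simp
  next
    case (Suc h')
    then have "prefix j h \<noteq> []" by (simp add: prefix_Suc)
    then have "int (M (prefix j h)) \<le> \<mu> h + 1"
      using M_props(2)[OF D_prefix[OF assms(1) h(2)]] by simp
    then show ?thesis
      using less \<Lambda>_rest[of h] h Suc by simp
  qed
qed

text \<open>The zeros added by \<open>pad\<close> are admissible because all members of the family are positive.\<close>

lemma pad_in_D:
  assumes js: "\<And>h. h < length js \<Longrightarrow> js ! h < M (take h js)"
  shows "pad js \<in> D"
proof -
  have step: "pad js (h + 1) < M (prefix (pad js) h)" if "prefix (pad js) h \<in> index_dom n M" for h
  proof (cases "h < length js")
    case True
    then show ?thesis
      using js[of h] by (simp add: prefix_pad) (simp add: pad_def)
  next
    case False
    then show ?thesis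
      using M_props(1)[OF that] by (simp add: pad_def)
  qed
  have "prefix (pad js) h \<in> index_dom n M" if "h \<le> n" for h
    using that
  proof (induction h)
    case (Suc h)
    then show ?case
      using step[of h] by (simp add: prefix_Suc index_dom_snoc)
  qed (simp add: index_dom_Nil)
  then show ?thesis
    using step by (simp add: D_def)
qed

text \<open>Here the family enters the invariant: raising the last iteration number from \<open>M js - 1\<close> to \<open>M js\<close> is
  the moment when the displacement leaves \<open>D\<close>.\<close>

lemma pad_snoc_in_D_iff:
  assumes js: "js \<in> index_dom n M"
  shows "pad (js @ [i]) \<in> D \<longleftrightarrow> i < M js"
proof
  assume "pad (js @ [i]) \<in> D"
  moreover have "length js \<le> n"
    using js by (simp add: index_dom_def)
  ultimately have "pad (js @ [i]) (length js + 1) < M (prefix (pad (js @ [i])) (length js))"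
    by (simp add: D_def)
  then show "i < M js"
    by (simp add: prefix_pad) (simp add: pad_def)
next
  assume i: "i < M js"
  show "pad (js @ [i]) \<in> D"
  proof (rule pad_in_D)
    fix h assume "h < length (js @ [i])"
    then show "(js @ [i]) ! h < M (take h (js @ [i]))"
      using js i by (auto simp: index_dom_def less_Suc_eq nth_append)
  qed
qed

definition W :: "'a set" where
  "W = cut D"

lemma W_U: "W \<subseteq> U"
  unfolding W_def cut_def U_def
proof (rule gen_span_subset)
  show "{snd (chain js) |js. length js < m \<and> pad js \<notin> D} \<subseteq> gen_span all_units {v}"
  proof safe
    fix js :: "nat list" assume "length js < m"
    then have "snd (chain js) \<in> gen_span parabolic {v}"
      by (rule chain_in_gen_span)
    also have "\<dots> \<subseteq> gen_span all_units {v}"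
      by (rule gen_span_subset) (auto intro: gen_span_base)
    finally show "snd (chain js) \<in> gen_span all_units {v}" .
  qed
qed auto

lemma W_sub: "0 \<in> W" "\<And>x y. x \<in> W \<Longrightarrow> y \<in> W \<Longrightarrow> x + y \<in> W" "\<And>c x. x \<in> W \<Longrightarrow> c *s x \<in> W"
  by (auto simp: W_def cut_def intro: gen_span.intros)

definition act :: "complex mat \<times> complex vec \<Rightarrow> 'a \<Rightarrow> 'a" where
  "act g = rep (Phi n g)"

lemma act_linear: "act g (x + y) = act g x + act g y" "act g (c *s x) = c *s act g x"
  by (simp_all add: act_def rep_add rep_scale)

lemma act_U: "x \<in> U \<Longrightarrow> act g x \<in> U"
  by (simp add: act_def rep_U)

lemma act_W: "x \<in> W \<Longrightarrow> act g x \<in> W"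
proof -
  assume "x \<in> W"
  moreover have "(a, b) \<in> parabolic" if "a < m" "b < m" "Phi n g $$ (a, b) \<noteq> 0" for a b
    using that m_eq by (cases g) (cases "a = 0"; auto simp: Phi_entry)
  ultimately show ?thesis
    unfolding W_def cut_def act_def by (intro rep_closed)
qed

abbreviation V :: "(complex, complex vec set) module" where
  "V \<equiv> quotient_space U_mod (coords ` W)"

definition \<rho> :: "complex mat \<times> complex vec \<Rightarrow> complex vec set \<Rightarrow> complex vec set" where
  "\<rho> = quotient_act U_mod (coords ` W) (U_act \<circ> Phi n)"

abbreviation cls :: "'a \<Rightarrow> complex vec set" where
  "cls \<equiv> U.coset W"

sublocale Q: presentation scale U V cls
  using W_U W_sub by (rule U.quotient_presentation)

lemma rho_cls: "x \<in> U \<Longrightarrow> \<rho> g (cls x) = cls (act g x)"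
  unfolding \<rho>_def using W_U W_sub
  by (rule U.quotient_act_coset) (auto simp: U_act_coords act_def rep_U rep_add act_W[unfolded act_def])

lemma cls_zero_iff: "x \<in> U \<Longrightarrow> cls x = \<zero>\<^bsub>V\<^esub> \<longleftrightarrow> x \<in> W"
  using U.coset_eq_zeroD[OF W_U W_sub _ coords_inj_U, of x] U.coset_eqI[OF W_U W_sub, of x 0] U.C_zero
  by (auto simp: Q.q_zero)

lemma V_lie_module: "lie_module (sl_semidirect n) V \<rho>"
proof (rule Q.lie_module[where R = act])
  note closed = semidirect_closed[where n = n]
  fix g h :: "complex mat \<times> complex vec" and c x
  assume g: "g \<in> carrier (sl_semidirect n)"
  show "act (c \<odot>\<^bsub>sl_semidirect n\<^esub> g) x = c *s act g x"
    unfolding act_def Phi_hom(2)[OF g g] using Phi_carrier[of n g] m_eq by (intro rep_smult) simp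
  show "c \<odot>\<^bsub>sl_semidirect n\<^esub> g \<in> carrier (sl_semidirect n)"
    by (rule closed(2)[OF g g])
  assume h: "h \<in> carrier (sl_semidirect n)"
  have mats: "Phi n g \<in> carrier_mat m m" "Phi n h \<in> carrier_mat m m"
    using Phi_carrier[of n g] Phi_carrier[of n h] m_eq by simp_all
  show "act (g \<oplus>\<^bsub>sl_semidirect n\<^esub> h) x = act g x + act h x"
    unfolding act_def Phi_hom(1)[OF g h] by (rule rep_plus[OF mats])
  show "act (lie_bracket (sl_semidirect n) g h) x = act g (act h x) - act h (act g x)"
    unfolding act_def Phi_hom(3)[OF g h] by (rule rep_bracket[OF mats])
  show "g \<oplus>\<^bsub>sl_semidirect n\<^esub> h \<in> carrier (sl_semidirect n)"
    "lie_bracket (sl_semidirect n) g h \<in> carrier (sl_semidirect n)"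
    by (rule closed(1)[OF g h], rule closed(3)[OF g h])
qed (simp_all add: act_U rho_cls act_linear del: semidirect_simps)

lemma V_fin_dim: "fin_dim_lie_module (sl_semidirect n) V \<rho>"
  using V_lie_module Q.fin_dim[OF G_finite span_U] by (simp add: fin_dim_lie_module_def)

lemma W_lie_submodule: "lie_submodule (sl_semidirect n) U_mod (U_act \<circ> Phi n) (coords ` W)"
  unfolding lie_submodule_def
proof (intro conjI ballI)
  show "VectorSpace.subspace class_ring (coords ` W) U_mod"
    using W_U W_sub by (rule subspace_image)
  fix g u assume "u \<in> coords ` W"
  then obtain x where x: "x \<in> W" "u = coords x" by auto
  then have "(U_act \<circ> Phi n) g u = coords (act g x)"
    using W_U by (auto simp: U_act_coords act_def)
  then show "(U_act \<circ> Phi n) g u \<in> coords ` W"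
    using act_W[OF x(1)] by simp
qed

end

section \<open>The maps between highest weight vectors on the quotient\<close>

context presentation
begin

lemma env_eval_append: "env_eval R (u @ u') x = env_eval R u x + env_eval R u' x"
  by (induction u) (auto simp: add.assoc)

lemma env_eval_concat: "env_eval R (concat us) x = (\<Sum>u\<leftarrow>us. env_eval R u x)"
  by (induction us) (auto simp: env_eval_append)

lemma env_eval_mult_single: "env_eval R (env_mult u [(1, [g])]) x = env_eval R u (R g x)"
  unfolding env_mult_def by (induction u) auto

end

lemma env_mult_single_in_env:
  assumes "u \<in> env L" "g \<in> carrier L"
  shows "env_mult u [(1, [g])] \<in> env L"
  using assms by (fastforce simp: env_def env_mult_def)

context target_family
begin

lemma of_sl_carrier: "X \<in> carrier (sl (n + 1)) \<Longrightarrow> of_sl n X \<in> carrier (sl_semidirect n)"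
  by (simp add: of_sl_def del: sl_simps)

lemma F_carrier: "1 \<le> k \<Longrightarrow> k \<le> l \<Longrightarrow> F_el n k l \<in> carrier (sl (n + 1))"
  unfolding F_el_def by (rule mat_unit_sl) simp

lemma act_unit:
  assumes "Phi n g = mat_unit (n + 2) (Suc a) (Suc b)" "a < m" "b < m"
  shows "act g x = T a b x"
  using rep_unit[OF assms(2,3), of x] unfolding act_def assms(1) m_eq .

lemma act_E: "1 \<le> p \<Longrightarrow> p \<le> r \<Longrightarrow> r \<le> n \<Longrightarrow> act (of_sl n (E_el n p r)) x = T p (r + 1) x"
  using m_eq by (intro act_unit) (simp_all add: Phi_E)

lemma act_F: "1 \<le> k \<Longrightarrow> k \<le> l \<Longrightarrow> l \<le> n \<Longrightarrow> act (of_sl n (F_el n k l)) x = T (l + 1) k x"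
  using m_eq by (intro act_unit) (simp_all add: Phi_F)

lemma act_P: "1 \<le> j \<Longrightarrow> j \<le> n + 1 \<Longrightarrow> act (P_el n j) x = T j 0 x"
  using m_eq by (intro act_unit) (simp_all add: Phi_P)

lemma act_H:
  assumes "1 \<le> i" "i \<le> n"
  shows "act (of_sl n (H_el n i)) x = T i i x - T (i + 1) (i + 1) x"
proof -
  have i: "i < m" "i + 1 < m" using assms m_eq by linarith+
  have "Phi n (of_sl n (H_el n i)) = mat_unit m (Suc i) (Suc i) - mat_unit m (Suc (i + 1)) (Suc (i + 1))"
    using assms m_eq by (simp add: Phi_H)
  then show ?thesis
    using rep_unit[OF i(1,1)] rep_unit[OF i(2,2)] by (simp only: act_def rep_minus mat_unit_carrier)
qed

lemma act_smult: "g \<in> carrier (sl_semidirect n) \<Longrightarrow> act (c \<odot>\<^bsub>sl_semidirect n\<^esub> g) x = c *s act g x"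
  using Phi_carrier[of n g] m_eq by (simp only: act_def Phi_hom(2) rep_smult)

lemma act_F_mu:
  assumes "1 \<le> k" "k \<le> l" "l \<le> n"
  shows "act (of_sl n (F_mu n \<nu> s k l)) x = skip_factor \<nu> s k l *s T (l + 1) k x"
proof -
  have "of_sl n (F_mu n \<nu> s k l) = skip_factor \<nu> s k l \<odot>\<^bsub>sl_semidirect n\<^esub> of_sl n (F_el n k l)"
    by (auto simp: of_sl_def F_mu_def skip_factor_def)
  then show ?thesis
    using act_smult[OF of_sl_carrier[OF F_carrier[OF assms(1,2)]]] act_F[OF assms] by simp
qed

lemma act_P_mu:
  assumes "1 \<le> k" "k \<le> n + 1"
  shows "act (P_mu n \<nu> i k) x = skip_factor \<nu> (i - 1) 0 (k - 1) *s T k 0 x"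
proof -
  have "{1..<k} = {0 + 1..k - 1}" using assms by auto
  then have "P_mu n \<nu> i k = skip_factor \<nu> (i - 1) 0 (k - 1) \<odot>\<^bsub>sl_semidirect n\<^esub> P_el n k"
    by (simp only: P_mu_def skip_factor_def)
  moreover have "P_el n k \<in> carrier (sl_semidirect n)"
    by (simp add: P_el_def)
  ultimately show ?thesis
    using act_smult act_P[OF assms] by simp
qed

text \<open>The recursion of \<open>Q_mu\<close> in the enveloping algebra is the one of \<open>lower_op\<close>.\<close>

lemma Q_mu_eval:
  assumes "1 \<le> k" "s \<le> n"
  shows "Q_mu n \<nu> s k \<in> env (sl (n + 1)) \<and>
    Q.env_eval (act \<circ> of_sl n) (Q_mu n \<nu> s k) x = lower_op \<nu> s k x"
  using assms(1)
proof (induction "s + 1 - k" arbitrary: k x rule: less_induct)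
  case less
  show ?case
  proof (cases "k \<le> s")
    case False
    then show ?thesis
      by (simp add: Q_mu.simps lower_op_above env_def)
  next
    case True
    let ?u = "\<lambda>l. env_mult (Q_mu n \<nu> s (l + 1)) [(1, [F_mu n \<nu> s k l])]"
    have Q: "Q_mu n \<nu> s k = concat (map ?u [k..<s + 1])"
      using True by (subst Q_mu.simps) simp
    have IH: "Q_mu n \<nu> s (l + 1) \<in> env (sl (n + 1))"
      "Q.env_eval (act \<circ> of_sl n) (Q_mu n \<nu> s (l + 1)) y = lower_op \<nu> s (l + 1) y" if "l \<in> {k..s}" for l y
      using less(1)[of "l + 1"] that by auto
    have "F_mu n \<nu> s k l \<in> carrier (sl (n + 1))" if "l \<in> {k..s}" for l
    proof -
      have F: "F_el n k l \<in> carrier (sl (n + 1))"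
        using that less(2) by (intro F_carrier) auto
      show ?thesis
        unfolding F_mu_def sl_simps(3) by (rule sl_closed(2)[OF F F])
    qed
    then have u: "?u l \<in> env (sl (n + 1))" if "l \<in> {k..s}" for l
      using IH that by (intro env_mult_single_in_env)
    have "Q.env_eval (act \<circ> of_sl n) (?u l) x = lower_op \<nu> s (l + 1) (skip_factor \<nu> s k l *s T (l + 1) k x)"
      if l: "l \<in> {k..s}" for l
      using l IH(2)[OF l] act_F_mu[of k l \<nu> s x] less(2) assms(2)
      by (simp add: Q.env_eval_mult_single)
    then have "Q.env_eval (act \<circ> of_sl n) (Q_mu n \<nu> s k) x = lower_op \<nu> s k x"
      unfolding Q Q.env_eval_concat lower_op_rec[OF True]
      by (simp add: interv_sum_list_conv_sum_set_nat comp_def atLeastLessThanSuc_atLeastAtMost del: upt_Suc)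
    moreover have "Q_mu n \<nu> s k \<in> env (sl (n + 1))"
      using u unfolding Q env_def by fastforce
    ultimately show ?thesis by blast
  qed
qed

lemma T_U: "a < m \<Longrightarrow> b < m \<Longrightarrow> x \<in> U \<Longrightarrow> T a b x \<in> U"
  unfolding U_def by (rule gen_span_T) auto

text \<open>The leading summand of \<open>\<phi>\<^sub>i\<close> is the one-step chain, the others have first step \<open>0 \<rightarrow> k\<close> with
  \<open>k < i\<close>; together they are the recursion for \<open>lower_op\<close> at \<open>0\<close>.\<close>

lemma phi_of_weight_cls:
  assumes x: "x \<in> U" and i: "1 \<le> i" "i \<le> n + 1"
  shows "phi_of_weight n V \<rho> \<nu> i (cls x) = cls (lower_op \<nu> (i - 1) 0 x)"
proof -
  define s where "s = i - 1"
  have s: "i = s + 1" "s \<le> n" using i by (simp_all add: s_def)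
  define y where "y k = skip_factor \<nu> s 0 (k - 1) *s T k 0 x" for k
  have y: "y k \<in> U" "\<rho> (P_mu n \<nu> i k) (cls x) = cls (y k)" if "k \<in> {1..i}" for k
  proof -
    have k: "1 \<le> k" "k \<le> n + 1" "k < m" "0 < m" using that i m_eq by auto
    show "y k \<in> U"
      unfolding y_def using k x by (intro U.C_scale T_U)
    show "\<rho> (P_mu n \<nu> i k) (cls x) = cls (y k)"
      unfolding rho_cls[OF x] act_P_mu[OF k(1,2)] y_def s_def ..
  qed
  have env: "lower_op \<nu> s k (y k) \<in> U \<and>
      env_act V (\<rho> \<circ> of_sl n) (Q_mu n \<nu> s k) (cls (y k)) = cls (lower_op \<nu> s k (y k))"
    if k: "k \<in> {1..<i}" for k
  proof -
    have "Q.env_eval (act \<circ> of_sl n) (Q_mu n \<nu> s k) (y k) \<in> U \<and>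
      env_act V (\<rho> \<circ> of_sl n) (Q_mu n \<nu> s k) (cls (y k)) =
      cls (Q.env_eval (act \<circ> of_sl n) (Q_mu n \<nu> s k) (y k))"
      by (rule Q.env_act_q[where L = "sl (n + 1)"])
        (use y Q_mu_eval s k in \<open>auto simp: act_U rho_cls simp del: sl_simps(1)\<close>)
    then show ?thesis
      using Q_mu_eval[of k s \<nu> "y k"] k s by simp
  qed
  have fin: "(\<Oplus>\<^bsub>V\<^esub>k\<in>{1..<i}. env_act V (\<rho> \<circ> of_sl n) (Q_mu n \<nu> (i - 1) k) (\<rho> (P_mu n \<nu> i k) (cls x))) =
      (\<Oplus>\<^bsub>V\<^esub>k\<in>{1..<i}. cls (lower_op \<nu> s k (y k)))"
  proof -
    interpret abelian_group V by (rule Q.abelian_group)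
    show ?thesis
    proof (rule finsum_cong')
      fix k assume k: "k \<in> {1..<i}"
      then have "k \<in> {1..i}" by simp
      then show "env_act V (\<rho> \<circ> of_sl n) (Q_mu n \<nu> (i - 1) k) (\<rho> (P_mu n \<nu> i k) (cls x)) =
          cls (lower_op \<nu> s k (y k))"
        using env[OF k] y(2) by (simp add: s_def)
    qed (use env in \<open>auto intro: Q.q_closed\<close>)
  qed
  have "phi_of_weight n V \<rho> \<nu> i (cls x) = cls (y i) \<oplus>\<^bsub>V\<^esub> cls (\<Sum>k\<in>{1..<i}. lower_op \<nu> s k (y k))"
    unfolding phi_of_weight_def fin using env y(2)[of i] i by (subst Q.q_finsum) auto
  also have "\<dots> = cls (y i + (\<Sum>k\<in>{1..<i}. lower_op \<nu> s k (y k)))"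
    using y(1)[of i] env i by (intro Q.q_add Q.C_sum) auto
  also have "y i + (\<Sum>k\<in>{1..<i}. lower_op \<nu> s k (y k)) = (\<Sum>k=1..i. lower_op \<nu> s k (y k))"
    using i by (simp add: s lower_op_above flip: atLeastLessThanSuc_atLeastAtMost)
  also have "\<dots> = (\<Sum>l=0..s. lower_op \<nu> s (l + 1) (y (l + 1)))"
    using sum.shift_bounds_cl_Suc_ivl[of "\<lambda>k. lower_op \<nu> s k (y k)" 0 s] by (simp add: s)
  also have "\<dots> = lower_op \<nu> s 0 x"
    unfolding lower_op_rec[OF le0] by (simp add: y_def)
  finally show ?thesis
    by (simp add: s_def)
qed

text \<open>Nonvanishing of the coset is what makes the eigenvalue, hence \<open>weight_of\<close>, unique.\<close>

lemma weight_of_cls: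
  assumes x: "x \<in> U" "weight_vector w x" and nz: "x \<notin> W"
  shows "weight_of n V (\<rho> \<circ> of_sl n) (cls x) = levi_weight w"
proof
  fix i
  show "weight_of n V (\<rho> \<circ> of_sl n) (cls x) i = levi_weight w i"
  proof (cases "i \<in> {1..n}")
    case False
    then show ?thesis
      using m_eq by (auto simp: weight_of_def levi_weight_def)
  next
    case True
    then have i: "1 \<le> i" "i \<le> n" "i < m" "i + 1 < m" using m_eq by auto
    have "act (of_sl n (H_el n i)) x = of_int (levi_weight w i) *s x"
      using x(2) i act_H[OF i(1,2), of x]
      by (simp add: levi_weight_def weight_vector_def scale_left_diff_distrib)
    then have H: "(\<rho> \<circ> of_sl n) (H_el n i) (cls x) = of_int (levi_weight w i) \<odot>\<^bsub>V\<^esub> cls x"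
      using x(1) by (simp add: rho_cls Q.q_scale)
    have "k = levi_weight w i" if "(\<rho> \<circ> of_sl n) (H_el n i) (cls x) = of_int k \<odot>\<^bsub>V\<^esub> cls x" for k
    proof (rule ccontr)
      assume ne: "k \<noteq> levi_weight w i"
      let ?d = "complex_of_int k - of_int (levi_weight w i)"
      have "cls (of_int k *s x) \<ominus>\<^bsub>V\<^esub> cls (of_int (levi_weight w i) *s x) = cls (?d *s x)"
        using x(1) by (simp add: Q.q_minus Q.C_scale scale_left_diff_distrib)
      moreover have "cls (of_int k *s x) = cls (of_int (levi_weight w i) *s x)"
        using H that x(1) by (simp add: Q.q_scale)
      ultimately have "cls (?d *s x) = \<zero>\<^bsub>V\<^esub>"
        using x(1) by (metis Q.C_scale Q.q_minus Q.q_zero diff_self)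
      then have "?d *s x \<in> W"
        using x(1) cls_zero_iff Q.C_scale by blast
      then have "(1 / ?d) *s ?d *s x \<in> W"
        by (rule W_sub(3))
      then show False
        using nz ne by simp
    qed
    then show ?thesis
      unfolding weight_of_def using True H by (auto intro!: the_equality)
  qed
qed

lemma phi_cls:
  assumes "x \<in> U" "weight_vector w x" "x \<notin> W" "1 \<le> i" "i \<le> n + 1"
  shows "phi n V \<rho> i (cls x) = cls (snd (step i (w, x)))"
  using assms cls_zero_iff[OF assms(1)]
  by (simp add: phi_def weight_of_cls phi_of_weight_cls step_def)

lemma chain_U: "length js < m \<Longrightarrow> snd (chain js) \<in> U"
proof -
  assume "length js < m"
  then have "snd (chain js) \<in> gen_span parabolic {v}"
    by (rule chain_in_gen_span)
  also have "\<dots> \<subseteq> U"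
    unfolding U_def by (rule gen_span_subset) (auto intro: gen_span_base)
  finally show ?thesis .
qed

lemma chain_W_iff: "length js < m \<Longrightarrow> snd (chain js) \<in> W \<longleftrightarrow> pad js \<notin> D"
  unfolding W_def by (rule chain_in_cut_iff) (auto intro: D_down D_box)

text \<open>Up to the last step before \<open>M js\<close> the iterates are nonzero cosets, so \<open>weight_of\<close> returns the weight
  that \<open>chain\<close> has carried along.\<close>

lemma phi_power_cls:
  assumes js: "js \<in> index_dom n M" and start: "phi_seq n V \<rho> js (cls v) = cls (snd (chain js))"
    and J: "J \<le> M js"
  shows "(phi n V \<rho> (length js + 1) ^^ J) (phi_seq n V \<rho> js (cls v)) = cls (snd (chain (js @ [J])))"
  using J
proof (induction J)
  case 0
  then show ?case
    by (simp add: start chain_snoc_0)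
next
  case (Suc J)
  have len: "length js \<le> n"
    using js by (simp add: index_dom_def)
  then have lm: "length (js @ [J]) < m"
    using m_eq by simp
  have "weight_vector (fst (chain (js @ [J]))) (snd (chain (js @ [J])))"
    using chain_singular[OF lm] by (simp add: levi_singular_def)
  moreover have "snd (chain (js @ [J])) \<notin> W"
    using Suc.prems pad_snoc_in_D_iff[OF js] chain_W_iff[OF lm] by simp
  ultimately have "phi n V \<rho> (length js + 1) (cls (snd (chain (js @ [J])))) =
      cls (snd (step (length js + 1) (chain (js @ [J]))))"
    using chain_U[OF lm] len by (subst phi_cls) auto
  then show ?case
    using Suc by (simp add: chain_snoc_Suc)
qed

lemma phi_seq_snoc:
  "phi_seq n V' \<rho>' (js @ [i]) x = (phi n V' \<rho>' (length js + 1) ^^ i) (phi_seq n V' \<rho>' js x)"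
  by (simp add: phi_seq_def enumerate_append_eq)

lemma phi_seq_cls:
  "js \<in> index_dom n M \<Longrightarrow> phi_seq n V \<rho> js (cls v) = cls (snd (chain js))"
proof (induction js rule: rev_induct)
  case Nil
  then show ?case
    by (simp add: phi_seq_def)
next
  case (snoc i js)
  then have "js \<in> index_dom n M" "i < M js"
    by (simp_all add: index_dom_snoc)
  then show ?case
    using snoc.IH phi_power_cls[of js i] by (simp add: phi_seq_snoc)
qed

lemma J_val_eq:
  assumes js: "js \<in> index_dom n M"
  shows "J_val n V \<rho> (cls v) js = M js"
proof -
  have lm: "length (js @ [J]) < m" for J
    using js m_eq by (simp add: index_dom_def)
  have power: "(phi n V \<rho> (length js + 1) ^^ J) (phi_seq n V \<rho> js (cls v)) = \<zero>\<^bsub>V\<^esub> \<longleftrightarrow> J = M js"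
    if "J \<le> M js" for J
    using that phi_power_cls[OF js phi_seq_cls[OF js] that] cls_zero_iff[OF chain_U[OF lm]]
      chain_W_iff[OF lm] pad_snoc_in_D_iff[OF js] by auto
  show ?thesis
    unfolding J_val_def
  proof (rule Least_equality)
    show "0 < M js \<and> (phi n V \<rho> (length js + 1) ^^ M js) (phi_seq n V \<rho> js (cls v)) = \<zero>\<^bsub>V\<^esub>"
      using power[of "M js"] M_props(1)[OF js] by simp
    fix J assume "0 < J \<and> (phi n V \<rho> (length js + 1) ^^ J) (phi_seq n V \<rho> js (cls v)) = \<zero>\<^bsub>V\<^esub>"
    then show "M js \<le> J"
      using power[of J] by (cases "J \<le> M js") auto
  qed
qed

text \<open>Membership of a list only involves the values of the family at its proper prefixes, which lie in the same
  domain.\<close>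

lemma index_dom_cong:
  assumes "\<And>js. js \<in> index_dom n M \<Longrightarrow> M' js = M js"
  shows "index_dom n M' = index_dom n M"
proof -
  have "js \<in> index_dom n M' \<longleftrightarrow> js \<in> index_dom n M" for js
    by (induction js rule: rev_induct) (auto simp: index_dom_Nil index_dom_snoc assms)
  then show ?thesis by blast
qed

lemma v_notin_W: "v \<notin> W"
proof -
  have "pad [] \<in> D"
    by (rule pad_in_D) simp
  then show ?thesis
    using chain_W_iff[of "[]"] m_eq by simp
qed

lemma levi_weight_start: "levi_weight w\<^sub>0 = \<mu>"
proof
  fix i
  show "levi_weight w\<^sub>0 i = \<mu> i"
  proof (cases "i \<in> {1..n}")
    case True
    then show ?thesis
      using w\<^sub>0_diff[of "i + 1"] \<Lambda>_rest[of i] m_eq by (auto simp: levi_weight_def)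
  next
    case False
    then show ?thesis
      using coll m_eq by (auto simp: levi_weight_def collection_M_def dominant_integral_def)
  qed
qed

lemma J_invariant_eq: "J_invariant n V \<rho> (cls v) = (\<mu>, M)"
proof -
  have "index_dom n (J_val n V \<rho> (cls v)) = index_dom n M"
    by (rule index_dom_cong) (rule J_val_eq)
  moreover have "restrict (J_val n V \<rho> (cls v)) (index_dom n M) = M"
  proof -
    have "M \<in> extensional (index_dom n M)"
      using coll by (simp add: collection_M_def)
    then show ?thesis
      by (auto simp: fun_eq_iff J_val_eq restrict_def extensional_def)
  qed
  ultimately show ?thesis
    using weight_of_cls[OF v_in_U v_weight v_notin_W] by (simp add: J_invariant_def levi_weight_start)
qed

lemma V_highest: "highest_weight_vector n V (\<rho> \<circ> of_sl n) \<mu> (cls v)"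
  unfolding highest_weight_vector_def
proof (intro conjI ballI allI impI)
  show "cls v \<in> carrier V"
    using v_in_U by (rule Q.q_closed)
  show "cls v \<noteq> \<zero>\<^bsub>V\<^esub>"
    using v_in_U v_notin_W cls_zero_iff by blast
  fix i assume "i \<in> {1..n}"
  then have i: "1 \<le> i" "i \<le> n" "i < m" "i + 1 < m" using m_eq by auto
  have "levi_weight w\<^sub>0 i = \<mu> i"
    by (simp add: levi_weight_start)
  then have "act (of_sl n (H_el n i)) v = of_int (\<mu> i) *s v"
    using v_weight i act_H[OF i(1,2), of v]
    by (simp add: levi_weight_def weight_vector_def flip: scale_left_diff_distrib of_int_diff)
  then show "(\<rho> \<circ> of_sl n) (H_el n i) (cls v) = of_int (\<mu> i) \<odot>\<^bsub>V\<^esub> cls v"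
    using v_in_U by (simp add: rho_cls Q.q_scale)
next
  fix p r assume pr: "1 \<le> p \<and> p \<le> r \<and> r \<le> n"
  then have "act (of_sl n (E_el n p r)) v = 0"
    using v_highest m_eq by (subst act_E) (auto simp: highest_in_def)
  then show "(\<rho> \<circ> of_sl n) (E_el n p r) (cls v) = \<zero>\<^bsub>V\<^esub>"
    using v_in_U by (simp add: rho_cls Q.q_zero)
qed

lemma lowering_from_semidirect:
  assumes "b < a" "a < m"
  obtains g where "g \<in> carrier (sl_semidirect n)" "\<And>x. act g x = T a b x"
proof (cases "b = 0")
  case True
  then show ?thesis
    using that[of "P_el n a"] act_P[of a] assms m_eq by (auto simp: P_el_def)
next
  case False
  then have ab: "1 \<le> b" "b \<le> a - 1" "a - 1 \<le> n" "a - 1 + 1 = a" using assms m_eq by auto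
  then show ?thesis
    using that[of "of_sl n (F_el n b (a - 1))"] act_F[OF ab(1-3)] of_sl_carrier[OF F_carrier[OF ab(1,2)]]
    by auto
qed

text \<open>The module generated by the highest weight vector is reached by lowering operators alone, and all of them come
  from the semidirect sum.\<close>

lemma V_generated: "generates (sl_semidirect n) V \<rho> (cls v)"
  unfolding generates_def
proof
  show "cls v \<in> carrier V"
    using v_in_U by (rule Q.q_closed)
  have env: "Q.env_eval act u v \<in> U \<and> env_act V \<rho> u (cls v) = cls (Q.env_eval act u v)"
    if "u \<in> env (sl_semidirect n)" for u
    by (rule Q.env_act_q[OF _ _ v_in_U that]) (simp_all add: act_U rho_cls del: semidirect_simps)
  have "\<exists>u\<in>env (sl_semidirect n). Q.env_eval act u v = x" if "x \<in> gen_span lowering {v}" for x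
    using that
  proof induction
    case (gen_span_base x)
    then show ?case
      by (intro bexI[of _ "[(1, [])]"]) (auto simp: env_def)
  next
    case gen_span_zero
    then show ?case
      by (intro bexI[of _ "[]"]) (auto simp: env_def)
  next
    case (gen_span_add x y)
    then obtain u u' where "u \<in> env (sl_semidirect n)" "Q.env_eval act u v = x"
      "u' \<in> env (sl_semidirect n)" "Q.env_eval act u' v = y"
      by blast
    then show ?case
      by (intro bexI[of _ "u @ u'"]) (auto simp: env_def Q.env_eval_append)
  next
    case (gen_span_scale x c)
    then obtain u where u: "u \<in> env (sl_semidirect n)" "Q.env_eval act u v = x"
      by blast
    have "Q.env_eval act (map (\<lambda>(d, w). (c * d, w)) u) v = c *s Q.env_eval act u v"
      by (induction u) (auto simp: scale_right_distrib)
    then show ?case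
      using u by (intro bexI[of _ "map (\<lambda>(d, w). (c * d, w)) u"]) (auto simp: env_def)
  next
    case (gen_span_T x a b)
    then obtain u where u: "u \<in> env (sl_semidirect n)" "Q.env_eval act u v = x"
      by blast
    obtain g where g: "g \<in> carrier (sl_semidirect n)" "\<And>x. act g x = T a b x"
      using lowering_from_semidirect gen_span_T(2) by blast
    have "Q.env_eval act (map (\<lambda>(d, w). (d, g # w)) u) v = act g (Q.env_eval act u v)"
      by (induction u) (auto simp: g(2) T_add T_scale)
    moreover have "map (\<lambda>(d, w). (d, g # w)) u \<in> env (sl_semidirect n)"
      using u(1) g(1) by (fastforce simp: env_def simp del: semidirect_simps)
    ultimately show ?case
      using u(2) g(2) by metis
  qed
  then have "U \<subseteq> (\<lambda>u. Q.env_eval act u v) ` env (sl_semidirect n)"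
    unfolding U_def gen_span_highest[OF v_weight v_highest] by blast
  then show "carrier V = (\<lambda>u. env_act V \<rho> u (cls v)) ` env (sl_semidirect n)"
    using env by (auto simp: Q.carrier_eq)
qed

end

section \<open>Fermionic Fock space\<close>

text \<open>Functions on states are treated as vectors; their sums and differences are evaluated pointwise only on demand.\<close>

lemmas fun_ops = plus_fun_apply zero_fun_apply minus_apply uminus_apply

declare fun_ops [simp del]

definition fscale :: "complex \<Rightarrow> ('s \<Rightarrow> complex) \<Rightarrow> 's \<Rightarrow> complex" where
  "fscale c F = (\<lambda>S. c * F S)"

lemma sum_fun_apply: "(sum g I) S = (\<Sum>i\<in>I. g i S)"
  by (induction I rule: infinite_finite_induct) (auto simp: fun_ops)

definition basis :: "'s \<Rightarrow> 's \<Rightarrow> complex" where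
  "basis S = (\<lambda>S'. of_bool (S' = S))"

text \<open>Particles sit in the boxes \<open>(i, r)\<close> of a grid with columns \<open>i \<in> I\<close> and rows \<open>r < m\<close>, at most one in each. A
  state is the set of occupied boxes. The lexicographic order of the boxes fixes the signs.\<close>

locale fermions =
  fixes I :: "'i::linorder set" and m :: nat
  assumes finite_I: "finite I"
begin

abbreviation modes :: "('i \<times> nat) set" where
  "modes \<equiv> I \<times> {..<m}"

text \<open>The sign of moving a particle at \<open>x\<close> past the particles before it.\<close>

definition sg :: "'i \<times> nat \<Rightarrow> ('i \<times> nat) set \<Rightarrow> complex" where
  "sg x S = (-1) ^ card {y \<in> S \<inter> modes. y < x}"

definition ann :: "'i \<times> nat \<Rightarrow> (('i \<times> nat) set \<Rightarrow> complex) \<Rightarrow> ('i \<times> nat) set \<Rightarrow> complex" where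
  "ann x F S = (if x \<in> S then 0 else sg x S * F (insert x S))"

definition cre :: "'i \<times> nat \<Rightarrow> (('i \<times> nat) set \<Rightarrow> complex) \<Rightarrow> ('i \<times> nat) set \<Rightarrow> complex" where
  "cre x F S = (if x \<in> S then sg x S * F (S - {x}) else 0)"

definition T :: "nat \<Rightarrow> nat \<Rightarrow> (('i \<times> nat) set \<Rightarrow> complex) \<Rightarrow> ('i \<times> nat) set \<Rightarrow> complex" where
  "T a b F = (\<Sum>i\<in>I. cre (i, a) (ann (i, b) F))"

lemma finite_modes [simp]: "finite modes"
  using finite_I by simp

lemma sg_square [simp]: "sg x S * sg x S = 1" "sg x S * (sg x S * z) = z"
proof -
  show *: "sg x S * sg x S = 1"
    unfolding sg_def power_add[symmetric] by (simp flip: mult_2)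
  show "sg x S * (sg x S * z) = z"
    unfolding mult.assoc[symmetric] * by simp
qed

lemma cnj_sg [simp]: "cnj (sg x S) = sg x S"
  by (simp add: sg_def)

lemma sg_insert:
  assumes "x \<in> modes"
  shows "sg y (insert x S) = (if x < y \<and> x \<notin> S then - sg y S else sg y S)"
proof (cases "x < y \<and> x \<notin> S")
  case True
  then have "{z \<in> insert x S \<inter> modes. z < y} = insert x {z \<in> S \<inter> modes. z < y}"
    using assms by auto
  moreover have "x \<notin> {z \<in> S \<inter> modes. z < y}" "finite {z \<in> S \<inter> modes. z < y}"
    using True by (auto intro: finite_subset[OF _ finite_modes])
  ultimately show ?thesis
    using True by (simp add: sg_def)
next
  case False
  then have "{z \<in> insert x S \<inter> modes. z < y} = {z \<in> S \<inter> modes. z < y}"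
    by auto
  then show ?thesis
    unfolding sg_def using False by auto
qed

lemma sg_remove:
  assumes "x \<in> modes"
  shows "sg y (S - {x}) = (if x < y \<and> x \<in> S then - sg y S else sg y S)"
proof (cases "x \<in> S")
  case True
  then show ?thesis
    using sg_insert[OF assms, of y "S - {x}"] by (auto simp: insert_absorb)
qed simp

text \<open>The canonical anticommutation relations, here and in the next two lemmas, are all that is needed for the
  commutators of the \<open>T a b\<close>.\<close>

lemma ann_cre:
  assumes "x \<in> modes" "y \<in> modes"
  shows "ann x (cre y F) = (if x = y then F else 0) - cre y (ann x F)"
proof
  fix S
  show "ann x (cre y F) S = ((if x = y then F else 0) - cre y (ann x F)) S"
  proof (cases "x = y")
    case True
    then show ?thesis
      using assms by (auto simp: ann_def cre_def sg_insert sg_remove insert_absorb fun_ops)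
  next
    case False
    then have comm: "insert x S - {y} = insert x (S - {y})" by auto
    consider "x < y" | "y < x" using False by fastforce
    then show ?thesis
      using False sg_insert[OF assms(1), of y S] sg_remove[OF assms(2), of x S]
      by cases (auto simp: ann_def cre_def comm fun_ops)
  qed
qed

lemma ann_ann:
  assumes "x \<in> modes" "y \<in> modes"
  shows "ann x (ann y F) = - ann y (ann x F)"
proof
  fix S
  consider "x = y" | "x < y" | "y < x" by fastforce
  then show "ann x (ann y F) S = (- ann y (ann x F)) S"
    using sg_insert[OF assms(1), of y S] sg_insert[OF assms(2), of x S]
    by cases (auto simp: ann_def insert_commute[of x y] fun_ops)
qed

lemma cre_cre:
  assumes "x \<in> modes" "y \<in> modes"
  shows "cre x (cre y F) = - cre y (cre x F)"
proof
  fix S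
  have comm: "S - {x} - {y} = S - {y} - {x}" by auto
  consider "x = y" | "x < y" | "y < x" by fastforce
  then show "cre x (cre y F) S = (- cre y (cre x F)) S"
    using sg_remove[OF assms(1), of y S] sg_remove[OF assms(2), of x S]
    by cases (auto simp: cre_def comm fun_ops)
qed

lemma ann_linear: "ann x (F + G) = ann x F + ann x G" "ann x (fscale c F) = fscale c (ann x F)"
    "ann x (- F) = - ann x F" "ann x (F - G) = ann x F - ann x G" "ann x 0 = 0"
  by (auto simp: ann_def fun_eq_iff fscale_def algebra_simps fun_ops)

lemma cre_linear: "cre x (F + G) = cre x F + cre x G" "cre x (fscale c F) = fscale c (cre x F)"
    "cre x (- F) = - cre x F" "cre x (F - G) = cre x F - cre x G" "cre x 0 = 0"
  by (auto simp: cre_def fun_eq_iff fscale_def algebra_simps fun_ops)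

lemma ann_sum: "ann x (sum g K) = (\<Sum>k\<in>K. ann x (g k))"
  by (induction K rule: infinite_finite_induct) (simp_all only: sum.infinite sum.empty sum.insert ann_linear not_False_eq_True)

lemma cre_sum: "cre x (sum g K) = (\<Sum>k\<in>K. cre x (g k))"
  by (induction K rule: infinite_finite_induct) (simp_all only: sum.infinite sum.empty sum.insert cre_linear not_False_eq_True)

text \<open>Both products of four operators can be brought to the form with the two creation operators on the left. The quartic
  terms agree, since two signs cancel, and the contractions remain.\<close>

lemma hop_commutator:
  assumes "x \<in> modes" "y \<in> modes" "z \<in> modes" "w \<in> modes"
  shows "cre x (ann y (cre z (ann w F))) = cre z (ann w (cre x (ann y F))) +
    (if y = z then cre x (ann w F) else 0) - (if x = w then cre z (ann y F) else 0)"
proof -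
  have "cre x (cre z (ann y (ann w F))) = cre z (cre x (ann w (ann y F)))"
    using assms by (simp add: ann_ann[of y w] cre_cre[of x z] cre_linear)
  then show ?thesis
    using assms by (auto simp: ann_cre cre_linear)
qed

lemma T_commutator:
  assumes "a < m" "b < m" "p < m" "q < m"
  shows "T a b (T p q F) = T p q (T a b F) + (if b = p then T a q F else 0) - (if a = q then T p b F else 0)"
proof -
  have "T a b (T p q F) = (\<Sum>i\<in>I. \<Sum>k\<in>I. cre (i, a) (ann (i, b) (cre (k, p) (ann (k, q) F))))"
    by (simp add: T_def ann_sum cre_sum)
  also have "\<dots> = (\<Sum>i\<in>I. \<Sum>k\<in>I. cre (k, p) (ann (k, q) (cre (i, a) (ann (i, b) F))) +
    (if i = k then (if b = p then cre (i, a) (ann (i, q) F) else 0) -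
      (if a = q then cre (i, p) (ann (i, b) F) else 0) else 0))"
  proof (intro sum.cong refl)
    fix i k assume "i \<in> I" "k \<in> I"
    then show "cre (i, a) (ann (i, b) (cre (k, p) (ann (k, q) F))) =
      cre (k, p) (ann (k, q) (cre (i, a) (ann (i, b) F))) +
      (if i = k then (if b = p then cre (i, a) (ann (i, q) F) else 0) -
        (if a = q then cre (i, p) (ann (i, b) F) else 0) else 0)"
      using assms by (subst hop_commutator) auto
  qed
  also have "\<dots> = (\<Sum>i\<in>I. \<Sum>k\<in>I. cre (k, p) (ann (k, q) (cre (i, a) (ann (i, b) F)))) +
    (\<Sum>i\<in>I. (if b = p then cre (i, a) (ann (i, q) F) else 0) - (if a = q then cre (i, p) (ann (i, b) F) else 0))"
    using finite_I by (simp add: sum.distrib)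
  also have "(\<Sum>i\<in>I. \<Sum>k\<in>I. cre (k, p) (ann (k, q) (cre (i, a) (ann (i, b) F)))) = T p q (T a b F)"
    by (subst sum.swap) (simp add: T_def ann_sum cre_sum)
  finally show ?thesis
    by (auto simp: T_def sum_subtractf)
qed

text \<open>Functions supported on states within the grid; there are finitely many such states.\<close>

definition A :: "(('i \<times> nat) set \<Rightarrow> complex) set" where
  "A = {F. \<forall>S. \<not> S \<subseteq> modes \<longrightarrow> F S = 0}"

definition ip :: "(('i \<times> nat) set \<Rightarrow> complex) \<Rightarrow> (('i \<times> nat) set \<Rightarrow> complex) \<Rightarrow> complex" where
  "ip F G = (\<Sum>S\<in>Pow modes. F S * cnj (G S))"

lemma ip_cre:
  assumes x: "x \<in> modes"
  shows "ip (cre x F) G = ip F (ann x G)"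
proof -
  have "ip (cre x F) G = (\<Sum>S\<in>{S \<in> Pow modes. x \<in> S}. sg x S * F (S - {x}) * cnj (G S))"
    unfolding ip_def by (rule sum.mono_neutral_cong_right) (auto simp: cre_def)
  also have "\<dots> = (\<Sum>S\<in>{S \<in> Pow modes. x \<notin> S}. F S * cnj (sg x S * G (insert x S)))"
    by (rule sum.reindex_bij_witness[of _ "insert x" "\<lambda>S. S - {x}"])
      (use x in \<open>auto simp: sg_remove insert_absorb\<close>)
  also have "\<dots> = ip F (ann x G)"
    unfolding ip_def by (rule sum.mono_neutral_cong_left) (auto simp: ann_def)
  finally show ?thesis .
qed

lemma ip_sum_right: "ip F (sum g K) = (\<Sum>k\<in>K. ip F (g k))"
  unfolding ip_def sum_fun_apply cnj_sum sum_distrib_left by (rule sum.swap)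

lemma ip_sum_left: "ip (sum g K) G = (\<Sum>k\<in>K. ip (g k) G)"
  unfolding ip_def sum_fun_apply sum_distrib_right by (rule sum.swap)

lemma ip_sym: "ip G F = cnj (ip F G)"
  by (simp add: ip_def mult.commute)

lemma ip_ann: "x \<in> modes \<Longrightarrow> ip (ann x F) G = ip F (cre x G)"
  using ip_cre[of x G F] by (metis ip_sym complex_cnj_cnj)

lemma ip_T: "a < m \<Longrightarrow> b < m \<Longrightarrow> ip (T a b F) G = ip F (T b a G)"
  by (auto simp: T_def ip_sum_left ip_sum_right ip_cre ip_ann intro!: sum.cong)

lemma A_support: "F \<in> A \<Longrightarrow> F S \<noteq> 0 \<Longrightarrow> S \<subseteq> modes"
  unfolding A_def mem_Collect_eq by metis

lemma T_support:
  assumes "T a b F S \<noteq> 0"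
  obtains k R where "k \<in> I" "S = insert (k, a) R" "(k, a) \<notin> R" "(k, b) \<notin> R" "F (insert (k, b) R) \<noteq> 0"
proof -
  have "(\<Sum>i\<in>I. cre (i, a) (ann (i, b) F) S) \<noteq> 0"
    using assms by (simp add: T_def sum_fun_apply)
  then obtain k where k: "k \<in> I" "cre (k, a) (ann (k, b) F) S \<noteq> 0"
    by (rule sum.not_neutral_contains_not_neutral)
  show ?thesis
    by (rule that[of k "S - {(k, a)}"]) (use k in \<open>auto simp: cre_def ann_def split: if_splits\<close>)
qed

lemma T_in_A:
  assumes "a < m" "F \<in> A"
  shows "T a b F \<in> A"
proof -
  have "S \<subseteq> modes" if nz: "T a b F S \<noteq> 0" for S
  proof -
    obtain k R where "k \<in> I" "S = insert (k, a) R" "F (insert (k, b) R) \<noteq> 0"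
      using nz by (rule T_support)
    then show ?thesis
      using A_support[OF assms(2), of "insert (k, b) R"] assms(1) by simp
  qed
  then show ?thesis
    unfolding A_def mem_Collect_eq by metis
qed

definition depth :: "('i \<times> nat) set \<Rightarrow> nat" where
  "depth S = (\<Sum>(i, r)\<in>S. r)"

text \<open>Applying \<open>T a b\<close> with \<open>a < b\<close> moves a particle to a row with smaller index. The total depth of a state bounds
  how often this is possible.\<close>

lemma raising_depth:
  assumes "F \<in> A" "\<forall>(a, b)\<in>set ws. a < b \<and> b < m" "foldr (\<lambda>(a, b). T a b) ws F S \<noteq> 0"
  shows "S \<subseteq> modes \<and> depth S + length ws \<le> depth modes"
  using assms(2,3)
proof (induction ws arbitrary: S)
  case Nil
  then have "S \<subseteq> modes"
    using A_support[OF assms(1)] by simp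
  then show ?case
    by (auto simp: depth_def intro!: sum_mono2)
next
  case (Cons ab ws)
  obtain a b where ab: "ab = (a, b)" "a < b" "b < m"
    using Cons(2) by (cases ab) auto
  let ?G = "foldr (\<lambda>(a, b). T a b) ws F"
  have "T a b ?G S \<noteq> 0"
    using Cons(3) ab by simp
  then obtain k R where k: "k \<in> I"
    and R: "S = insert (k, a) R" "(k, a) \<notin> R" "(k, b) \<notin> R" "?G (insert (k, b) R) \<noteq> 0"
    by (rule T_support)
  then have IH: "insert (k, b) R \<subseteq> modes" "depth (insert (k, b) R) + length ws \<le> depth modes"
    using Cons.IH[of "insert (k, b) R"] Cons(2) by auto
  have "finite R"
    using IH(1) by (auto intro: finite_subset[OF _ finite_modes])
  then show ?case
    using IH R(1,2,3) ab k by (simp add: depth_def)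
qed

lemma ip_pos:
  assumes "F \<in> A" "ip F F = 0"
  shows "F = 0"
proof -
  have "ip F F = of_real (\<Sum>S\<in>Pow modes. (cmod (F S))\<^sup>2)"
    unfolding ip_def of_real_sum by (intro sum.cong refl) (rule complex_norm_square[symmetric])
  then have "(\<Sum>S\<in>Pow modes. (cmod (F S))\<^sup>2) = 0"
    using assms(2) of_real_eq_0_iff by metis
  then have "F S = 0" if "S \<subseteq> modes" for S
    using that by (subst (asm) sum_nonneg_eq_0_iff) auto
  then show ?thesis
    using assms(1) by (auto simp: A_def fun_eq_iff fun_ops)
qed

lemma T_linear: "T a b (F + G) = T a b F + T a b G" "T a b (fscale c F) = fscale c (T a b F)"
  by (simp_all only: T_def ann_linear cre_linear sum.distrib)
    (simp add: fun_eq_iff fscale_def sum_fun_apply sum_distrib_left)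

lemma ip_linear: "ip (F + F') G = ip F G + ip F' G" "ip (fscale c F) G = c * ip F G"
  by (simp_all add: ip_def fscale_def fun_ops sum.distrib distrib_right sum_distrib_left mult.assoc)

lemma vector_space_fscale: "vector_space (fscale :: complex \<Rightarrow> ('s \<Rightarrow> complex) \<Rightarrow> _)"
  by standard (auto simp: fscale_def fun_eq_iff algebra_simps fun_ops)

lemma A_linear: "0 \<in> A" "F \<in> A \<Longrightarrow> G \<in> A \<Longrightarrow> F + G \<in> A" "F \<in> A \<Longrightarrow> fscale c F \<in> A"
  by (auto simp: A_def fscale_def fun_ops)

lemma unitary_gl_module: "unitary_gl_module fscale m T A ip"
proof -
  interpret vector_space "fscale :: complex \<Rightarrow> (('i \<times> nat) set \<Rightarrow> complex) \<Rightarrow> _"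
    by (rule vector_space_fscale)
  show ?thesis
  proof
    have "foldr (\<lambda>(a, b). T a b) ws F = 0" if "length ws = depth modes + 1"
        "\<forall>(a, b)\<in>set ws. a < b \<and> b < m" "F \<in> A" for ws F
      using raising_depth[OF that(3,2)] that(1) by (intro ext) (fastforce simp: fun_ops)
    then show "\<exists>N. \<forall>ws F. length ws = N \<longrightarrow> (\<forall>(a, b)\<in>set ws. a < b \<and> b < m) \<longrightarrow>
        F \<in> A \<longrightarrow> foldr (\<lambda>(a, b). T a b) ws F = 0"
      by blast
  qed (fact T_linear T_commutator ip_linear A_linear T_in_A ip_T ip_pos ip_sym | rule T_linear T_commutator ip_linear A_linear T_in_A ip_T ip_pos ip_sym; assumption)+
qed

end

section \<open>Column states\<close>

lemma fscale_simps: "fscale c 0 = 0" "fscale 1 F = F" "fscale c (fscale d F) = fscale (c * d) F"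
  by (simp_all add: fscale_def fun_eq_iff fun_ops)

text \<open>Each column \<open>i\<close> has a length, and there is room for one more box below the filled ones.\<close>

locale columns = fermions +
  fixes len :: "'a \<Rightarrow> nat"
  assumes len_bounds: "i \<in> I \<Longrightarrow> 1 \<le> len i \<and> len i < m"
begin

text \<open>The columns in \<open>C\<close> are shifted by one row, away from row \<open>0\<close>.\<close>

definition state :: "'a set \<Rightarrow> ('a \<times> nat) set" where
  "state C = (SIGMA i:I. {of_bool (i \<in> C)..<len i + of_bool (i \<in> C)})"

lemma state_iff: "(i, r) \<in> state C \<longleftrightarrow> i \<in> I \<and> of_bool (i \<in> C) \<le> r \<and> r < len i + of_bool (i \<in> C)"
  by (auto simp: state_def)

lemma state_modes: "state C \<subseteq> modes"
proof
  fix x assume "x \<in> state C"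
  then show "x \<in> modes"
    using len_bounds[of "fst x"] by (cases x) (auto simp: state_iff of_bool_def split: if_splits)
qed

text \<open>The sets of columns that contain exactly \<open>j k\<close> columns of each length \<open>k\<close>.\<close>

definition profiles :: "(nat \<Rightarrow> nat) \<Rightarrow> 'a set set" where
  "profiles j = {C. C \<subseteq> I \<and> (\<forall>k\<in>{1..<m}. card {i \<in> C. len i = k} = j k)}"

definition extremal :: "(nat \<Rightarrow> nat) \<Rightarrow> ('a \<times> nat) set \<Rightarrow> complex" where
  "extremal j = (\<Sum>C\<in>profiles j. basis (state C))"

definition height :: "nat \<Rightarrow> nat" where
  "height r = card {i \<in> I. r < len i}"

definition col_count :: "nat \<Rightarrow> nat" where
  "col_count k = card {i \<in> I. len i = k}"

lemma finite_profiles: "finite (profiles j)"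
  using finite_I by (simp add: profiles_def)

lemma finite_sub: "C \<subseteq> I \<Longrightarrow> finite C"
  using finite_I finite_subset by blast

lemma ann_basis:
  assumes "x \<in> modes"
  shows "ann x (basis S) = (if x \<in> S then fscale (sg x S) (basis (S - {x})) else 0)"
proof
  fix R
  show "ann x (basis S) R = (if x \<in> S then fscale (sg x S) (basis (S - {x})) else 0) R"
    using sg_remove[OF assms, of x S] by (auto simp: ann_def fscale_def basis_def fun_ops)
qed

lemma cre_basis:
  assumes "x \<in> modes"
  shows "cre x (basis S) = (if x \<notin> S then fscale (sg x S) (basis (insert x S)) else 0)"
proof
  fix R
  show "cre x (basis S) R = (if x \<notin> S then fscale (sg x S) (basis (insert x S)) else 0) R"
    using sg_insert[OF assms, of x S] by (auto simp: cre_def fscale_def basis_def fun_ops)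
qed

text \<open>A particle cannot hop to row \<open>a\<close> if every column with a particle in row \<open>b\<close> has one in row \<open>a\<close> already.\<close>

lemma T_basis_zero:
  assumes "a \<noteq> b" "a < m" "b < m" "\<And>i. i \<in> I \<Longrightarrow> (i, b) \<in> S \<Longrightarrow> (i, a) \<in> S"
  shows "T a b (basis S) = 0"
  unfolding T_def
proof (rule sum.neutral, rule ballI)
  fix i assume "i \<in> I"
  then show "cre (i, a) (ann (i, b) (basis S)) = 0"
    using assms by (auto simp: ann_basis cre_basis cre_linear fscale_simps)
qed

lemma T_basis_diag:
  assumes "a < m"
  shows "T a a (basis S) = fscale (of_nat (card {i \<in> I. (i, a) \<in> S})) (basis S)"
proof -
  have "cre (i, a) (ann (i, a) (basis S)) = (if (i, a) \<in> S then basis S else 0)" if "i \<in> I" for i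
    using that assms
    by (auto simp: ann_basis cre_basis cre_linear sg_remove insert_absorb fscale_simps)
  then have "T a a (basis S) = (\<Sum>i\<in>I. if (i, a) \<in> S then basis S else 0)"
    unfolding T_def by (rule sum.cong[OF refl])
  also have "\<dots> = (\<Sum>i\<in>{i \<in> I. (i, a) \<in> S}. basis S)"
    by (rule sum.inter_filter[symmetric, OF finite_I])
  also have "\<dots> = fscale (of_nat (card {i \<in> I. (i, a) \<in> S})) (basis S)"
    by (simp add: fun_eq_iff sum_fun_apply fscale_def)
  finally show ?thesis .
qed

text \<open>Moving the last particle of a shifted column to row \<open>0\<close> undoes the shift. The particle passes the other
  \<open>len i - 1\<close> particles of its column, so the sign depends on the length only.\<close>

lemma hop_state:
  assumes "C \<subseteq> I" "i \<in> C"
  shows "cre (i, 0) (ann (i, len i) (basis (state C))) =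
    fscale ((-1) ^ (len i - 1)) (basis (state (C - {i})))"
proof -
  let ?S = "state C" and ?k = "len i"
  have i: "i \<in> I" "1 \<le> ?k" "?k < m" using assms len_bounds by auto
  have mem: "(i, ?k) \<in> ?S" "(i, 0) \<notin> ?S"
    using assms i by (auto simp: state_iff)
  have "{y \<in> ?S \<inter> modes. y < (i, ?k)} = {y \<in> ?S \<inter> modes. y < (i, 0)} \<union> {i} \<times> {1..<?k}"
  proof (rule Set.set_eqI)
    fix y :: "'a \<times> nat"
    obtain i' r where y: "y = (i', r)" by fastforce
    have own: "(i, r) \<in> ?S \<inter> modes \<longleftrightarrow> 1 \<le> r \<and> r \<le> ?k" for r
      using assms i by (auto simp: state_iff)
    show "y \<in> {y \<in> ?S \<inter> modes. y < (i, ?k)} \<longleftrightarrow>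
        y \<in> {y \<in> ?S \<inter> modes. y < (i, 0)} \<union> {i} \<times> {1..<?k}"
    proof (cases "i' = i")
      case True
      then show ?thesis
        using own[of r] by (simp add: y) linarith
    next
      case False
      then have "y < (i, r') \<longleftrightarrow> i' < i" for r'
        by (auto simp: y)
      then show ?thesis
        using False by (simp add: y)
    qed
  qed
  moreover have "finite {y \<in> ?S \<inter> modes. y < (i, 0)}"
    using finite_modes by (rule rev_finite_subset) auto
  moreover have "{y \<in> ?S \<inter> modes. y < (i, 0)} \<inter> {i} \<times> {1..<?k} = {}"
    by auto
  ultimately have "sg (i, ?k) ?S = sg (i, 0) ?S * (-1) ^ (?k - 1)"
    by (simp add: sg_def card_Un_disjoint power_add)
  moreover have "sg (i, 0) (?S - {(i, ?k)}) = sg (i, 0) ?S"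
    using i by (simp add: sg_remove)
  ultimately have "sg (i, ?k) ?S * sg (i, 0) (?S - {(i, ?k)}) = (-1) ^ (?k - 1)"
    by (simp add: mult.commute mult.left_commute)
  moreover have "insert (i, 0) (?S - {(i, ?k)}) = state (C - {i})"
  proof (rule Set.set_eqI)
    fix y :: "'a \<times> nat"
    obtain i' r where y: "y = (i', r)" by fastforce
    show "y \<in> insert (i, 0) (?S - {(i, ?k)}) \<longleftrightarrow> y \<in> state (C - {i})"
    proof (cases "i' = i")
      case True
      then show ?thesis
        using assms i by (simp add: y state_iff) linarith
    next
      case False
      then show ?thesis
        by (simp add: y state_iff)
    qed
  qed
  ultimately show ?thesis
    using i mem by (simp add: ann_basis cre_basis cre_linear fscale_simps)
qed

text \<open>Among the columns with a particle in row \<open>k\<close> only the shifted ones have room in row \<open>0\<close>, and if no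
  shifted column is longer than \<open>k\<close>, these are the ones of length \<open>k\<close>.\<close>

lemma T_down_state:
  assumes "C \<subseteq> I" "1 \<le> k" "k < m" "\<And>i. i \<in> C \<Longrightarrow> len i \<le> k"
  shows "T 0 k (basis (state C)) =
    fscale ((-1) ^ (k - 1)) (\<Sum>i\<in>{i \<in> C. len i = k}. basis (state (C - {i})))"
proof -
  have "T 0 k (basis (state C)) = (\<Sum>i\<in>{i \<in> C. len i = k}. cre (i, 0) (ann (i, k) (basis (state C))))"
    unfolding T_def
  proof (rule sum.mono_neutral_right)
    show "\<forall>i\<in>I - {i \<in> C. len i = k}. cre (i, 0) (ann (i, k) (basis (state C))) = 0"
    proof
      fix i assume i: "i \<in> I - {i \<in> C. len i = k}"
      then have "(i, k) \<notin> state C \<or> (i, 0) \<in> state C"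
        using assms(4)[of i] len_bounds[of i] by (cases "i \<in> C") (auto simp: state_iff)
      then show "cre (i, 0) (ann (i, k) (basis (state C))) = 0"
        using i assms(2,3) by (auto simp: ann_basis cre_basis cre_linear fscale_simps)
    qed
  qed (use assms finite_I in auto)
  also have "\<dots> = (\<Sum>i\<in>{i \<in> C. len i = k}. fscale ((-1) ^ (k - 1)) (basis (state (C - {i}))))"
    using hop_state[OF assms(1)] by (intro sum.cong) auto
  also have "\<dots> = fscale ((-1) ^ (k - 1)) (\<Sum>i\<in>{i \<in> C. len i = k}. basis (state (C - {i})))"
    by (simp add: fun_eq_iff fscale_def sum_fun_apply sum_distrib_left)
  finally show ?thesis .
qed

lemma T_sum: "T a b (sum g K) = (\<Sum>k\<in>K. T a b (g k))"
  unfolding T_def ann_sum cre_sum by (rule sum.swap)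

lemma profile_len_le:
  assumes "C \<in> profiles j" "\<forall>l>k. j l = 0" "i \<in> C"
  shows "len i \<le> k"
proof (rule ccontr)
  assume k: "\<not> len i \<le> k"
  have C: "C \<subseteq> I" "\<And>k. k \<in> {1..<m} \<Longrightarrow> card {i \<in> C. len i = k} = j k"
    using assms(1) by (auto simp: profiles_def)
  have "len i \<in> {1..<m}"
    using C(1) assms(3) len_bounds[of i] by auto
  then have "card {i' \<in> C. len i' = len i} = 0"
    using C(2) assms(2) k by simp
  moreover have "finite {i' \<in> C. len i' = len i}"
    using finite_sub[OF C(1)] by simp
  ultimately show False
    using assms(3) by auto
qed

text \<open>Double counting of pairs: a set with one more column of length \<open>k\<close> together with such a column to be removed
  is the same as a set with \<open>j k\<close> such columns together with one of the \<open>col_count k - j k\<close> others of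
  that length.\<close>

lemma sum_profiles_remove:
  fixes g :: "'a set \<Rightarrow> 's \<Rightarrow> complex"
  assumes "1 \<le> k" "k < m" "j k < col_count k"
  shows "(\<Sum>C\<in>profiles (j(k := j k + 1)). \<Sum>i\<in>{i \<in> C. len i = k}. g (C - {i})) =
    fscale (of_nat (col_count k - j k)) (\<Sum>C\<in>profiles j. g C)"
proof -
  let ?P = "profiles (j(k := j k + 1))"
  have fin: "finite C" if "C \<in> profiles j'" for C j'
    using that finite_sub by (auto simp: profiles_def)
  have down: "C - {i} \<in> profiles j" if C: "C \<in> ?P" and i: "i \<in> C" "len i = k" for C i
  proof -
    have "card {i' \<in> C - {i}. len i' = k'} = j k'" if k': "k' \<in> {1..<m}" for k'
    proof -
      have c: "card {i' \<in> C. len i' = k'} = (j(k := j k + 1)) k'"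
        using C k' unfolding profiles_def by blast
      show ?thesis
      proof (cases "k' = k")
        case True
        then have "{i' \<in> C - {i}. len i' = k'} = {i' \<in> C. len i' = k'} - {i}" by auto
        then show ?thesis
          using c True i fin[OF C] by (simp add: card_Diff_singleton)
      next
        case False
        then have "{i' \<in> C - {i}. len i' = k'} = {i' \<in> C. len i' = k'}" using i by auto
        then show ?thesis
          using c False by simp
      qed
    qed
    then show ?thesis
      using C by (auto simp: profiles_def)
  qed
  have up: "insert i C \<in> ?P" if C: "C \<in> profiles j" and i: "i \<in> I - C" "len i = k" for C i
  proof -
    have "card {i' \<in> insert i C. len i' = k'} = (j(k := j k + 1)) k'" if k': "k' \<in> {1..<m}" for k'
    proof -
      have c: "card {i' \<in> C. len i' = k'} = j k'"
        using C k' unfolding profiles_def by blast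
      show ?thesis
      proof (cases "k' = k")
        case True
        then have "{i' \<in> insert i C. len i' = k'} = insert i {i' \<in> C. len i' = k'}" using i by auto
        then show ?thesis
          using c True i fin[OF C] by simp
      next
        case False
        then have "{i' \<in> insert i C. len i' = k'} = {i' \<in> C. len i' = k'}" using i by auto
        then show ?thesis
          using c False by simp
      qed
    qed
    then show ?thesis
      using C i by (auto simp: profiles_def)
  qed
  have "(\<Sum>C\<in>?P. \<Sum>i\<in>{i \<in> C. len i = k}. g (C - {i})) =
      (\<Sum>(C, i)\<in>(SIGMA C:?P. {i \<in> C. len i = k}). g (C - {i}))"
    using finite_profiles fin by (intro sum.Sigma) auto
  also have "\<dots> = (\<Sum>(C, i)\<in>(SIGMA C:profiles j. {i \<in> I - C. len i = k}). g C)"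
    by (rule sum.reindex_bij_witness[of _ "\<lambda>(C, i). (insert i C, i)" "\<lambda>(C, i). (C - {i}, i)"])
      (use down up in \<open>auto simp: insert_absorb profiles_def\<close>)
  also have "\<dots> = (\<Sum>C\<in>profiles j. \<Sum>i\<in>{i \<in> I - C. len i = k}. g C)"
    using finite_profiles finite_I by (intro sum.Sigma[symmetric]) auto
  also have "\<dots> = (\<Sum>C\<in>profiles j. fscale (of_nat (col_count k - j k)) (g C))"
  proof (rule sum.cong[OF refl])
    fix C assume C: "C \<in> profiles j"
    then have "card {i \<in> C. len i = k} = j k" "C \<subseteq> I"
      using assms by (auto simp: profiles_def)
    moreover have "{i \<in> I - C. len i = k} = {i \<in> I. len i = k} - {i \<in> C. len i = k}" by auto
    ultimately have "card {i \<in> I - C. len i = k} = col_count k - j k"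
      using fin[OF C] by (auto simp: col_count_def intro!: card_Diff_subset[THEN trans])
    then show "(\<Sum>i\<in>{i \<in> I - C. len i = k}. g C) = fscale (of_nat (col_count k - j k)) (g C)"
      by (simp add: fun_eq_iff fscale_def sum_fun_apply)
  qed
  also have "\<dots> = fscale (of_nat (col_count k - j k)) (\<Sum>C\<in>profiles j. g C)"
    by (simp add: fun_eq_iff fscale_def sum_fun_apply sum_distrib_left)
  finally show ?thesis .
qed

lemma extremal_descend:
  assumes "1 \<le> k" "k < m" "\<forall>l>k. j l = 0" "j k < col_count k"
  shows "T 0 k (extremal (j(k := j k + 1))) =
    fscale ((-1) ^ (k - 1) * of_nat (col_count k - j k)) (extremal j)"
proof -
  let ?P = "profiles (j(k := j k + 1))"
  have "T 0 k (basis (state C)) =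
      fscale ((-1) ^ (k - 1)) (\<Sum>i\<in>{i \<in> C. len i = k}. basis (state (C - {i})))" if "C \<in> ?P" for C
  proof (rule T_down_state)
    show "C \<subseteq> I" using that by (auto simp: profiles_def)
    show "len i \<le> k" if "i \<in> C" for i
      using profile_len_le[OF \<open>C \<in> ?P\<close>, of k i] that assms(3) by simp
  qed (use assms in auto)
  then have "T 0 k (extremal (j(k := j k + 1))) =
      (\<Sum>C\<in>?P. fscale ((-1) ^ (k - 1)) (\<Sum>i\<in>{i \<in> C. len i = k}. basis (state (C - {i}))))"
    unfolding extremal_def T_sum by (rule sum.cong[OF refl])
  also have "\<dots> = fscale ((-1) ^ (k - 1)) (\<Sum>C\<in>?P. \<Sum>i\<in>{i \<in> C. len i = k}. basis (state (C - {i})))"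
    by (simp add: fun_eq_iff fscale_def sum_fun_apply sum_distrib_left)
  also have "\<dots> = fscale ((-1) ^ (k - 1) * of_nat (col_count k - j k)) (extremal j)"
    unfolding sum_profiles_remove[where j = j, OF assms(1,2,4), of "\<lambda>C. basis (state C)"] extremal_def
    by (simp add: fscale_def mult.assoc)
  finally show ?thesis .
qed

lemma height_diff: "1 \<le> i \<Longrightarrow> height (i - 1) = height i + col_count i"
proof -
  assume "1 \<le> i"
  then have "{x \<in> I. i - 1 < len x} = {x \<in> I. i < len x} \<union> {x \<in> I. len x = i}" by auto
  then show ?thesis
    unfolding height_def col_count_def using finite_I by (simp add: card_Un_disjoint disjoint_iff)
qed

lemma state_weight:
  assumes "C \<in> profiles j" "1 \<le> r" "r < m"
  shows "card {i \<in> I. (i, r) \<in> state C} = height r + j r"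
proof -
  have C: "C \<subseteq> I" "card {i \<in> C. len i = r} = j r"
    using assms by (auto simp: profiles_def)
  have "{i \<in> I. (i, r) \<in> state C} = {i \<in> I. r < len i} \<union> {i \<in> C. len i = r}"
    using C(1) assms(2) by (auto simp: state_iff)
  then show ?thesis
    unfolding height_def using finite_I finite_sub[OF C(1)] C(2)
    by (simp add: card_Un_disjoint disjoint_iff)
qed

text \<open>Row \<open>r \<ge> 1\<close> of \<open>state C\<close> is occupied in the columns longer than \<open>r\<close> and in the shifted columns of length
  \<open>r\<close>, which gives the weight; and a particle in row \<open>b > a \<ge> 1\<close> always has one above it in row \<open>a\<close>, which
  gives singularity.\<close>

lemma extremal_family:
  "extremal_family fscale m T A ip (basis (state {})) (\<lambda>r. int (height r)) col_count extremal"
proof -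
  interpret unitary_gl_module fscale m T A ip
    by (rule unitary_gl_module)
  show ?thesis
  proof
    show "basis (state {}) \<in> A"
      using state_modes by (auto simp: A_def basis_def)
    show "basis (state {}) \<noteq> 0"
      by (metis basis_def fun_ops(2) of_bool_eq_1_iff zero_neq_one)
    have "{i \<in> I. (i, a) \<in> state {}} = {i \<in> I. a < len i}" for a
      by (auto simp: state_iff)
    then show "weight_vector (\<lambda>r. int (height r)) (basis (state {}))"
      by (auto simp: weight_vector_def T_basis_diag height_def)
    show "highest_in (basis (state {}))"
      unfolding highest_in_def by (intro allI impI T_basis_zero) (auto simp: state_iff)
    show "int (height (i - 1)) - int (height i) = int (col_count i)" if "1 \<le> i" "i < m" for i
      using height_diff[OF that(1)] by simp
    have "profiles (\<lambda>_. 0) = {{}}"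
    proof -
      have "C = {}" if "C \<in> profiles (\<lambda>_. 0)" for C
      proof (rule ccontr)
        assume "C \<noteq> {}"
        then obtain i where "i \<in> C" by auto
        then have "len i \<le> 0" "i \<in> I"
          using profile_len_le[OF that, of 0 i] that by (auto simp: profiles_def)
        then show False using len_bounds[of i] by simp
      qed
      moreover have "{} \<in> profiles (\<lambda>_. 0)" by (simp add: profiles_def)
      ultimately show ?thesis by blast
    qed
    then show "extremal (\<lambda>_. 0) = basis (state {})"
      by (simp add: extremal_def)
    show "T a b (extremal j) = 0" if "1 \<le> a" "a < b" "b < m" for a b j
      unfolding extremal_def T_sum
    proof (rule sum.neutral, rule ballI)
      fix C show "T a b (basis (state C)) = 0"
        using that by (intro T_basis_zero) (auto simp: state_iff)
    qed
    show "T r r (extremal j) = fscale (of_int (int (height r) + int (j r))) (extremal j)"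
      if "1 \<le> r" "r < m" for r j
    proof -
      have "T r r (extremal j) = (\<Sum>C\<in>profiles j. fscale (of_nat (height r + j r)) (basis (state C)))"
        unfolding extremal_def T_sum
        using that by (intro sum.cong refl) (simp add: T_basis_diag state_weight)
      then show ?thesis
        by (simp add: extremal_def fun_eq_iff fscale_def sum_fun_apply sum_distrib_left)
    qed
    show "\<exists>c. c \<noteq> 0 \<and> T 0 k (extremal (j(k := j k + 1))) = fscale c (extremal j)"
      if "1 \<le> k" "k < m" "\<forall>l>k. j l = 0" "j k < col_count k" for k j
      using extremal_descend[OF that] that(4) by (intro exI conjI) auto
  qed
qed

end

section \<open>Existence of a module with a prescribed invariant\<close>

context columns
begin

lemma realized:
  assumes "m = n + 2"
  shows "\<exists>N coords. realized_family fscale m T A ip (basis (state {})) (\<lambda>r. int (height r)) col_count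
    extremal n N coords (basis ` Pow modes)"
proof -
  interpret extremal_family fscale m T A ip "basis (state {})" "\<lambda>r. int (height r)" col_count extremal
    by (rule extremal_family)
  define N where "N = card (Pow modes)"
  obtain e where e: "bij_betw e {0..<N} (Pow modes)"
    unfolding N_def using ex_bij_betw_nat_finite[of "Pow modes"] finite_modes by blast
  define coords where "coords F = vec N (\<lambda>i. F (e i))" for F :: "('a \<times> nat) set \<Rightarrow> complex"
  have inj: "inj_on coords A"
  proof (rule inj_onI)
    fix F F' assume F: "F \<in> A" "F' \<in> A" "coords F = coords F'"
    have "F S = F' S" if S: "S \<subseteq> modes" for S
    proof -
      have "S \<in> e ` {0..<N}"
        using e S by (simp add: bij_betw_def)
      then obtain i where "i < N" "S = e i"
        by auto
      then show ?thesis
        using arg_cong[OF F(3), of "\<lambda>u. u $ i"] by (simp add: coords_def)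
    qed
    moreover have "F S = F' S" if "\<not> S \<subseteq> modes" for S
      using F(1,2) that by (simp add: A_def)
    ultimately show "F = F'"
      by blast
  qed
  have "A \<subseteq> span (basis ` Pow modes)"
  proof
    fix F assume F: "F \<in> A"
    have "F = (\<Sum>S\<in>Pow modes. fscale (F S) (basis S))"
    proof
      fix R
      have "(\<Sum>S\<in>Pow modes. fscale (F S) (basis S)) R = (\<Sum>S\<in>Pow modes. if S = R then F S else 0)"
        unfolding sum_fun_apply by (intro sum.cong) (auto simp: fscale_def basis_def)
      also have "\<dots> = (if R \<in> Pow modes then F R else 0)"
        using finite_modes by (simp only: sum.delta finite_Pow_iff)
      also have "\<dots> = F R"
        using F by (simp add: A_def)
      finally show "F R = (\<Sum>S\<in>Pow modes. fscale (F S) (basis S)) R" ..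
    qed
    then show "F \<in> span (basis ` Pow modes)"
      by (metis (no_types, lifting) span_sum span_scale span_base imageI)
  qed
  then have "realized_family fscale m T A ip (basis (state {})) (\<lambda>r. int (height r)) col_count
      extremal n N coords (basis ` Pow modes)"
    using inj finite_modes assms
    by unfold_locales (auto simp: coords_def fscale_def fun_ops)
  then show ?thesis by blast
qed

end

theorem theorem4p6:
  fixes n :: nat and \<M> :: "(nat \<Rightarrow> int) \<times> (nat list \<Rightarrow> nat)"
  assumes "n \<ge> 1" and "\<M> \<in> collection_M n"
  shows "\<exists>(V :: (complex, complex vec set) module) \<rho> v \<mu>.
    fin_dim_lie_module (sl_semidirect n) V \<rho> \<and>
    highest_weight_vector n V (\<rho> \<circ> of_sl n) \<mu> v \<and>
    generates (sl_semidirect n) V \<rho> v \<and>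
    J_invariant n V \<rho> v = \<M> \<and>
    (\<exists>\<Lambda> (U :: (complex, complex vec) module) \<pi> W.
      dominant_integral (n + 1) \<Lambda> \<and>
      is_irreducible_of_highest_weight (n + 1) \<Lambda> U \<pi> \<and>
      lie_submodule (sl_semidirect n) U (\<pi> \<circ> Phi n) W \<and>
      V = quotient_space U W \<and>
      \<rho> = quotient_act U W (\<pi> \<circ> Phi n))"
proof -
  obtain \<mu> M where \<M>: "\<M> = (\<mu>, M)" by fastforce
  have coll: "(\<mu>, M) \<in> collection_M n"
    using assms(2) by (simp add: \<M>)
  have M1: "1 \<le> M []" and \<mu>: "\<And>i. i \<in> {1..n} \<Longrightarrow> 0 \<le> \<mu> i"
    using coll index_dom_Nil[of n M] by (auto simp: collection_M_def dominant_integral_def)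
  define \<Lambda> where "\<Lambda> k = (if k = 1 then M [] - 1 else nat (\<mu> (k - 1)))" for k
  \<comment> \<open>column \<open>(k, t)\<close> is number \<open>t\<close> among the \<open>\<Lambda> k\<close> columns of length \<open>k\<close>\<close>
  define I where "I = (SIGMA k:{1..n + 1}. {..<\<Lambda> k})"
  interpret columns I "n + 2" fst
    by unfold_locales (auto simp: I_def)
  have count: "col_count k = \<Lambda> k" if "k \<in> {1..n + 1}" for k
  proof -
    have "{i \<in> I. fst i = k} = {k} \<times> {..<\<Lambda> k}"
      using that by (auto simp: I_def)
    then show ?thesis
      by (simp add: col_count_def card_cartesian_product)
  qed
  obtain N coords where "realized_family fscale (n + 2) T A ip (basis (state {})) (\<lambda>r. int (height r))
      col_count extremal n N coords (basis ` Pow modes)"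
    using realized[OF refl] by blast
  then interpret realized_family fscale "n + 2" T A ip "basis (state {})" "\<lambda>r. int (height r)"
      col_count extremal n N coords "basis ` Pow modes" .
  interpret target_family fscale "n + 2" T A ip "basis (state {})" "\<lambda>r. int (height r)"
      col_count extremal n N coords "basis ` Pow modes" \<mu> M
  proof
    show "col_count 1 + 1 = M []"
      using M1 by (subst count) (simp_all add: \<Lambda>_def)
    show "int (col_count (i + 1)) = \<mu> i" if "1 \<le> i" "i \<le> n" for i
      using that \<mu>[of i] by (subst count) (simp_all add: \<Lambda>_def)
  qed (rule coll)
  define L where "L i = (if i \<in> {1..n + 1} then int (\<Lambda> i) else 0)" for i
  have "dominant_integral (n + 1) L"
    by (simp add: dominant_integral_def L_def)
  moreover have "is_irreducible_of_highest_weight (n + 1) L U_mod U_act"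
    by (rule U_is_irreducible_of_highest_weight) (simp add: L_def count)
  ultimately show ?thesis
    using V_fin_dim V_highest V_generated J_invariant_eq W_lie_submodule \<M> \<rho>_def by blast
qed

end
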